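(* Let $K$ be a field of characteristic zero and let $\alpha\in K((T^{-1}))$. Suppose that $\alpha=[a_0,a_1,\ldots]$ is a quasi-periodic continued fraction, with associated sequences of positive integers $(\lambda_i)_{i\ge 0}$, $(r_i)_{i\ge 0}$, $(n_i)_{i\ge 0}$. Let $q_i$ denote the denominator of the $i$-th convergent of $\alpha$. (a) If there is a positive constant $C$ such that $r_i<Cn_i$ for all $i$, and $$\limsup_{i\to+\infty}\frac{\log\lambda_i\,\sqrt{\log n_i}}{n_i}=+\infty,$$ then $\alpha$ is either transcendental or quadratic over $K(T)$. (b) If the sequence $(|q_i|^{1/i})_{i\ge 1}$ is bounded and $$\limsup_{i\to+\infty}\frac{\lambda_i}{n_i}=+\infty,$$ then $\alpha$ is either transcendental or quadratic over $K(T)$.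
   Context: $K((T^{-1}))$ is the field of formal Laurent series in $T^{-1}$ over $K$, i.e. the completion of $K(T)$ for the ultrametric absolute value $|a/b|=\mu^{\deg a-\deg b}$ (for nonzero $a,b\in K[T]$), $|0|=0$, where $\mu>1$ is a fixed real number; the absolute value is extended to $K((T^{-1}))$. $\log$ denotes the logarithm with base $\mu$. Continued fractions: for nonzero $\alpha=\sum_{i\le k}b_iT^i\in K((T^{-1}))$ with $b_k\neq 0$, put $\lfloor\alpha\rfloor=\sum_{i=0}^k b_iT^i\in K[T]$ if $k\ge 0$ and $\lfloor\alpha\rfloor=0$ otherwise. The continued fraction expansion $\alpha=\alpha_0=[a_0,a_1,\ldots]$ is obtained by $a_i=\lfloor\alpha_i\rfloor$, $\alpha_{i+1}=1/(\alpha_i-a_i)$ for $i\ge 0$ (stopping if $\alpha_i=a_i$). Thus $a_i\in K[T]$ and $\deg a_i\ge 1$ for $i\ge 1$. The denominators of the convergents are defined by $q_{-2}=1$, $q_{-1}=0$, $q_i=a_iq_{i-1}+q_{i-2}$ for $i\ge 0$. An (infinite) continued fraction $[a_0,a_1,\ldots]$ is quasi-periodic if there are sequences of positive integers $(\lambda_i)_{i\ge 0}$, $(r_i)_{i\ge 0}$, $(n_i)_{i\ge 0}$, with $(n_i)_{i\ge 0}$ strictly increasing and $\lambda_i\ge 2$ for all $i$, such that for every $i\ge 0$ $$a_{m+r_i}=a_m\quad\text{for all } m \text{ with } n_i\le m\le n_i+(\lambda_i-1)r_i-1.$$ "Transcendental" means transcendental over $K(T)$; "quadratic" means algebraic of degree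 $2$ over $K(T)$. *)

theory Defs
  imports
    Complex_Main
    "HOL-Computational_Algebra.Formal_Laurent_Series"
    "HOL-Library.Extended_Real"
begin

text \<open>
  The field \<open>K((T\<^sup>-\<^sup>1))\<close> is the type \<open>'a fls\<close>, whose variable \<^const>\<open>fls_X\<close> plays the role of
  \<open>T\<^sup>-\<^sup>1\<close>. Thus \<open>T\<close> is \<^const>\<open>fls_X_inv\<close>, the coefficient of \<open>T ^ i\<close> in \<open>\<alpha>\<close> is \<open>fls_nth \<alpha> (- i)\<close>, and
  the degree of \<open>\<alpha> \<noteq> 0\<close> in \<open>T\<close> is \<open>- fls_subdegree \<alpha>\<close>.
\<close>

definition poly_in_T :: "'a::field poly \<Rightarrow> 'a fls" where
  "poly_in_T p = poly (map_poly fls_const p) fls_X_inv"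

lemma nth_poly_in_T:
  "fls_nth (poly_in_T p) k = (if k \<le> 0 then coeff p (nat (- k)) else 0)"
proof (induction p arbitrary: k)
  case 0
  then show ?case by (simp add: poly_in_T_def)
next
  case (pCons c p)
  have "poly_in_T (pCons c p) = fls_const c + fls_X_inv * poly_in_T p"
    by (cases "c = 0") (simp_all add: poly_in_T_def map_poly_pCons)
  then have "fls_nth (poly_in_T (pCons c p)) k = (if k = 0 then c else 0) + fls_nth (poly_in_T p) (k + 1)"
    by (simp add: fls_X_inv_times_conv_shift)
  then show ?case
    by (auto simp: pCons.IH coeff_pCons nat_diff_distrib split: nat.splits intro!: arg_cong[of _ _ "coeff p"])
qed

definition ratfun_field :: "'a::field fls set" where
  "ratfun_field = {poly_in_T a / poly_in_T b | a b. b \<noteq> 0}"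

definition abs_T :: "real \<Rightarrow> 'a::field fls \<Rightarrow> real" where
  "abs_T \<mu> \<alpha> = (if \<alpha> = 0 then 0 else \<mu> powi (- fls_subdegree \<alpha>))"

definition floor_T :: "'a::field fls \<Rightarrow> 'a poly" where
  "floor_T \<alpha> = (if - fls_subdegree \<alpha> \<ge> 0
     then (\<Sum>i\<le>nat (- fls_subdegree \<alpha>). monom (fls_nth \<alpha> (- int i)) i) else 0)"

lemma nth_floor_T:
  "fls_nth (poly_in_T (floor_T \<alpha>)) k = (if k \<le> 0 then fls_nth \<alpha> k else 0)"
proof -
  have "coeff (floor_T \<alpha>) j = fls_nth \<alpha> (- int j)" for j
  proof (cases "- int j < fls_subdegree \<alpha>")
    case True
    then show ?thesis by (auto simp: floor_T_def coeff_sum)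
  next
    case False
    then have "j \<le> nat (- fls_subdegree \<alpha>)" "fls_subdegree \<alpha> \<le> 0" by linarith+
    then show ?thesis by (simp add: floor_T_def coeff_sum)
  qed
  then show ?thesis by (simp add: nth_poly_in_T)
qed

text \<open>
  The expansion stops at the first \<open>i\<close> with \<open>\<alpha>\<^sub>i = a\<^sub>i\<close>. The values produced after that point by
  the convention \<open>1 / 0 = 0\<close> are meaningless; \<open>infinite_cf\<close> below excludes this case.
\<close>

fun complete_quotient :: "'a::field fls \<Rightarrow> nat \<Rightarrow> 'a fls" where
  "complete_quotient \<alpha> 0 = \<alpha>"
| "complete_quotient \<alpha> (Suc i) =
     1 / (complete_quotient \<alpha> i - poly_in_T (floor_T (complete_quotient \<alpha> i)))"

definition partial_quotient :: "'a::field fls \<Rightarrow> nat \<Rightarrow> 'a poly" where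
  "partial_quotient \<alpha> i = floor_T (complete_quotient \<alpha> i)"

definition infinite_cf :: "'a::field fls \<Rightarrow> bool" where
  "infinite_cf \<alpha> \<longleftrightarrow> (\<forall>i. complete_quotient \<alpha> i \<noteq> poly_in_T (partial_quotient \<alpha> i))"

text \<open>
  The recursion \<open>q\<^sub>i = a\<^sub>i q\<^sub>i\<^sub>-\<^sub>1 + q\<^sub>i\<^sub>-\<^sub>2\<close> starts from \<open>q\<^sub>-\<^sub>2 = 1\<close> and \<open>q\<^sub>-\<^sub>1 = 0\<close>, so it is
  carried out with indices shifted by two.
\<close>

fun shifted_denom :: "(nat \<Rightarrow> 'a::field poly) \<Rightarrow> nat \<Rightarrow> 'a poly" where
  "shifted_denom a 0 = 1"
| "shifted_denom a (Suc 0) = 0"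
| "shifted_denom a (Suc (Suc i)) = a i * shifted_denom a (Suc i) + shifted_denom a i"

definition convergent_denom :: "'a::field fls \<Rightarrow> nat \<Rightarrow> 'a poly" where
  "convergent_denom \<alpha> i = shifted_denom (partial_quotient \<alpha>) (i + 2)"

definition quasi_periodic_cf ::
    "'a::field fls \<Rightarrow> (nat \<Rightarrow> nat) \<Rightarrow> (nat \<Rightarrow> nat) \<Rightarrow> (nat \<Rightarrow> nat) \<Rightarrow> bool" where
  "quasi_periodic_cf \<alpha> l r n \<longleftrightarrow>
     infinite_cf \<alpha> \<and>
     (\<forall>i. l i \<ge> 2) \<and> (\<forall>i. r i > 0) \<and> (\<forall>i. n i > 0) \<and> strict_mono n \<and>
     (\<forall>i m. n i \<le> m \<and> m \<le> n i + (l i - 1) * r i - 1 \<longrightarrow>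
        partial_quotient \<alpha> (m + r i) = partial_quotient \<alpha> m)"

text \<open>Below, \<open>F\<close> is meant to be a subfield of the ambient field.\<close>

definition algebraic_over_subfield :: "'b::field set \<Rightarrow> 'b \<Rightarrow> bool" where
  "algebraic_over_subfield F x \<longleftrightarrow> (\<exists>P. (\<forall>i. coeff P i \<in> F) \<and> P \<noteq> 0 \<and> poly P x = 0)"

definition transcendental_over_subfield :: "'b::field set \<Rightarrow> 'b \<Rightarrow> bool" where
  "transcendental_over_subfield F x \<longleftrightarrow> \<not> algebraic_over_subfield F x"

text \<open>The degree of an algebraic element is that of its minimal polynomial.\<close>

definition algebraic_degree :: "'b::field set \<Rightarrow> 'b \<Rightarrow> nat" where
  "algebraic_degree F x =
     (LEAST d. \<exists>P. (\<forall>i. coeff P i \<in> F) \<and> P \<noteq> 0 \<and> poly P x = 0 \<and> degree P = d)"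

definition quadratic_over_subfield :: "'b::field set \<Rightarrow> 'b \<Rightarrow> bool" where
  "quadratic_over_subfield F x \<longleftrightarrow> algebraic_over_subfield F x \<and> algebraic_degree F x = 2"

end

theory Submission
  imports Defs "Jordan_Normal_Form.Char_Poly" "HOL-Algebra.Algebraic_Closure_Type"
begin

text \<open>
  Suppose that \<open>\<alpha>\<close> is algebraic over \<open>K(T)\<close> of a degree other than two; it is irrational because its
  continued fraction is infinite. The two limsup conditions are refuted by two estimates, one for
  the numbers of repetitions and one for the growth of the degrees of the denominators.

  Write \<open>\<epsilon>\<^sub>k = q\<^sub>k \<alpha> - p\<^sub>k\<close>. Since the complete quotient \<open>\<alpha>\<^sub>n\<close> equals \<open>- \<epsilon>\<^sub>n\<^sub>-\<^sub>2 / \<epsilon>\<^sub>n\<^sub>-\<^sub>1\<close>, a long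
  common initial segment of \<open>\<alpha>\<^sub>n\<close> and \<open>\<alpha>\<^sub>n\<^sub>+\<^sub>r\<close> makes the quadratic expression
  \<open>\<epsilon>\<^sub>n\<^sub>-\<^sub>2 \<epsilon>\<^sub>n\<^sub>+\<^sub>r\<^sub>-\<^sub>1 - \<epsilon>\<^sub>n\<^sub>-\<^sub>1 \<epsilon>\<^sub>n\<^sub>+\<^sub>r\<^sub>-\<^sub>2\<close> in \<open>\<alpha>\<close> small, while a Liouville inequality keeps its nonzero
  value large. The outcome is \<open>\<lambda> \<le> C (1 + deg q\<^sub>n\<^sub>-\<^sub>1)\<close> (\<open>repetition_count_bound\<close>). This settles the case of
  bounded \<open>\<bar>q\<^sub>i\<bar>\<^sup>1\<^sup>/\<^sup>i\<close>, where \<open>deg q\<^sub>n\<close> is linear in \<open>n\<close>. In the other case \<open>log (deg q\<^sub>n)\<close> must be shown to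
  be of order at most \<open>n / \<surd>(log n)\<close>, and this comes from a Roth theorem with an explicit dependence on
  \<open>\<epsilon>\<close>: it gives \<open>deg q\<^sub>k\<^sub>+\<^sub>1 \<le> (1 + \<epsilon>) deg q\<^sub>k + A \<epsilon>\<^sup>-\<^sup>b\<close> (\<open>roth_algebraic\<close>), which is iterated with
  \<open>\<epsilon> = 1 / \<surd>(log n)\<close> (\<open>log_denominator_growth\<close>).

  Liouville's and Roth's inequality are both instances of \<open>wronskian_inequality\<close>, which adapts to
  function fields the method of Osgood and Steinmetz. Let \<open>V\<close> be a finite-dimensional space over the
  constants, spanned by integral expressions in the conjugates \<open>\<rho>\<^sub>0, \<rho>\<^sub>1, \<dots>\<close> of \<open>\<alpha>\<close> and stable under all
  substitutions \<open>\<rho>\<^sub>i \<mapsto> \<rho>\<^bsub>\<sigma>(i)\<^esub>\<close>. Such a substitution multiplies the Wronskian \<open>W\<close> of a basis of \<open>V\<close> by a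
  constant. A suitable power sum of the substituted Wronskians is therefore a nonzero constant times a
  power of \<open>W\<close>; being symmetric in the conjugates it is a polynomial in \<open>T\<close>, and so \<open>W\<close> does not vanish at
  infinity. On the other hand the order of \<open>W\<close> at infinity is at least the sum of the orders of the
  basis elements, up to an error that is controlled by \<open>dim V\<close>. Hence \<open>V\<close> cannot contain many independent elements that are
  small at infinity. Liouville's inequality takes for \<open>V\<close> the span of the \<open>Q(\<rho>\<^sub>i)\<close>. For Roth's theorem let
  \<open>V\<^sub>s\<close> be the span of the monomials of degree at most \<open>s\<close> in the conjugates; then \<open>V = q V\<^sub>s\<^sub>+\<^sub>1 + p V\<^sub>s\<close>
  contains \<open>(p - q \<alpha>) V\<^sub>s\<close>, and as \<open>dim V\<^sub>s\<close> grows polynomially, some small \<open>s\<close> has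
  \<open>dim V\<^sub>s\<^sub>+\<^sub>1 \<le> (1 + \<epsilon>) dim V\<^sub>s\<close>.

  All this requires the conjugates to be Laurent series at infinity. They become such after passing
  to the algebraic closure of \<open>K\<close> and replacing \<open>T\<close> by a power of a new variable, by the Newton-Puiseux
  theorem (\<open>newton_puiseux\<close>), which follows from Hensel's lemma.
\<close>

hide_const (open) UnivPoly.coeff UnivPoly.monom Module.smult Coset.order Polynomials.degree Polynomials.lead_coeff

section \<open>Wronskians\<close>

definition wronskian_mat :: "('b \<Rightarrow> 'b) \<Rightarrow> nat \<Rightarrow> (nat \<Rightarrow> 'b) \<Rightarrow> 'b mat" where
  "wronskian_mat D m g = mat m m (\<lambda>(i, j). (D ^^ i) (g j))"

lemma wronskian_mat_carrier [simp]: "wronskian_mat D m g \<in> carrier_mat m m"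
  by (simp add: wronskian_mat_def)

text \<open>
  A linear relation between the columns, with coefficients in the field itself; the constants enter
  only in \<open>wronskian_nonzero\<close>.
\<close>

lemma det_wronskian_eq_0_iff:
  fixes g :: "nat \<Rightarrow> 'b::field"
  shows "det (wronskian_mat D m g) = 0 \<longleftrightarrow>
    (\<exists>v. (\<exists>j<m. v j \<noteq> 0) \<and> (\<forall>i<m. (\<Sum>j<m. (D ^^ i) (g j) * v j) = 0))"
proof
  assume "det (wronskian_mat D m g) = 0"
  then obtain v where v: "v \<in> carrier_vec m" "v \<noteq> 0\<^sub>v m" "wronskian_mat D m g *\<^sub>v v = 0\<^sub>v m"
    using det_0_iff_vec_prod_zero[OF wronskian_mat_carrier] by blast
  have nz: "\<exists>j<m. v $ j \<noteq> 0" using v(1,2) by (auto simp: vec_eq_iff)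
  have "(\<Sum>j<m. (D ^^ i) (g j) * v $ j) = 0" if "i < m" for i
  proof -
    have "(wronskian_mat D m g *\<^sub>v v) $ i = (\<Sum>j<m. (D ^^ i) (g j) * v $ j)"
      using that v(1) by (auto simp: wronskian_mat_def scalar_prod_def lessThan_atLeast0 intro!: sum.cong)
    then show ?thesis using v(3) that by simp
  qed
  with nz show "\<exists>v. (\<exists>j<m. v j \<noteq> 0) \<and> (\<forall>i<m. (\<Sum>j<m. (D ^^ i) (g j) * v j) = 0)"
    by (intro exI[of _ "\<lambda>j. v $ j"]) auto
next
  assume "\<exists>v. (\<exists>j<m. v j \<noteq> 0) \<and> (\<forall>i<m. (\<Sum>j<m. (D ^^ i) (g j) * v j) = 0)"
  then obtain v where v: "\<exists>j<m. v j \<noteq> 0" "\<forall>i<m. (\<Sum>j<m. (D ^^ i) (g j) * v j) = 0" by blast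
  have "vec m v \<noteq> 0\<^sub>v m" using v(1) by (auto simp: vec_eq_iff)
  moreover have "wronskian_mat D m g *\<^sub>v vec m v = 0\<^sub>v m"
    using v(2) by (intro eq_vecI) (auto simp: wronskian_mat_def scalar_prod_def lessThan_atLeast0)
  ultimately show "det (wronskian_mat D m g) = 0"
    using det_0_iff_vec_prod_zero[OF wronskian_mat_carrier] by (metis vec_carrier)
qed

lemma det_wronskian_nonzeroD:
  fixes g :: "nat \<Rightarrow> 'b::field"
  assumes "det (wronskian_mat D m g) \<noteq> 0" and "\<And>i. i < m \<Longrightarrow> (\<Sum>j<m. (D ^^ i) (g j) * v j) = 0"
    and "j < m"
  shows "v j = 0"
proof (rule ccontr)
  assume "v j \<noteq> 0"
  with assms have "\<exists>v. (\<exists>j<m. v j \<noteq> 0) \<and> (\<forall>i<m. (\<Sum>j<m. (D ^^ i) (g j) * v j) = 0)"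
    by (intro exI[of _ v]) auto
  with assms(1) show False using iffD2[OF det_wronskian_eq_0_iff] by blast
qed

locale derivation =
  fixes D :: "'b::field \<Rightarrow> 'b"
  assumes D_add: "D (x + y) = D x + D y"
    and D_mult: "D (x * y) = D x * y + x * D y"
begin

lemma D_0 [simp]: "D 0 = 0"
proof -
  have "D 0 + D 0 = D 0 + 0" using D_add[of 0 0] by (simp only: add_0_right)
  then show ?thesis by (simp only: add_left_cancel)
qed

lemma D_1 [simp]: "D 1 = 0"
proof -
  have "D 1 + D 1 = D 1 + 0" using D_mult[of 1 1] by (simp only: mult_1_left mult_1_right add_0_right)
  then show ?thesis by (simp only: add_left_cancel)
qed

lemma D_sum: "D (sum f A) = (\<Sum>x\<in>A. D (f x))"
  by (induction A rule: infinite_finite_induct) (auto simp: D_add)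

lemma D_power_add: "(D ^^ i) (x + y) = (D ^^ i) x + (D ^^ i) y"
  by (induction i) (auto simp: D_add)

lemma D_power_0 [simp]: "(D ^^ i) 0 = 0"
  by (induction i) auto

lemma D_power_sum: "(D ^^ i) (sum f A) = (\<Sum>x\<in>A. (D ^^ i) (f x))"
  by (induction A rule: infinite_finite_induct) (auto simp: D_power_add)

lemma D_power_const_mult: "D c = 0 \<Longrightarrow> (D ^^ i) (c * x) = c * (D ^^ i) x"
  by (induction i) (auto simp: D_mult)

text \<open>
  A shortest linear relation between the columns, normalised to have last coefficient \<open>1\<close>, can be
  differentiated: this gives a shorter relation between the derivatives of its coefficients, so these
  derivatives vanish and the relation has constant coefficients.
\<close>

lemma wronskian_nonzero:
  assumes "\<And>c. (\<And>j. j < m \<Longrightarrow> D (c j) = 0) \<Longrightarrow> (\<Sum>j<m. c j * g j) = 0 \<Longrightarrow> \<forall>j<m. c j = 0"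
  shows "det (wronskian_mat D m g) \<noteq> 0"
  using assms
proof (induction m)
  case 0
  then show ?case by (simp add: det_dim_zero[OF wronskian_mat_carrier])
next
  case (Suc m)
  have IH: "det (wronskian_mat D m g) \<noteq> 0"
  proof (rule Suc.IH)
    fix c assume c: "\<And>j. j < m \<Longrightarrow> D (c j) = 0" "(\<Sum>j<m. c j * g j) = 0"
    have "\<forall>j<Suc m. (c(m := 0)) j = 0"
      by (rule Suc.prems) (use c in auto)
    then have "(c(m := 0)) j = 0" if "j < m" for j using that less_SucI by blast
    then show "\<forall>j<m. c j = 0" by (simp add: fun_upd_def split: if_splits)
  qed
  show ?case
  proof
    assume "det (wronskian_mat D (Suc m) g) = 0"
    then obtain v where v: "\<exists>j<Suc m. v j \<noteq> 0"
      "\<And>i. i < Suc m \<Longrightarrow> (\<Sum>j<Suc m. (D ^^ i) (g j) * v j) = 0"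
      unfolding det_wronskian_eq_0_iff by blast
    have vm: "v m \<noteq> 0"
    proof
      assume "v m = 0"
      then have "(\<exists>j<m. v j \<noteq> 0) \<and> (\<forall>i<m. (\<Sum>j<m. (D ^^ i) (g j) * v j) = 0)"
        using v(1) v(2)[OF less_SucI] by (auto simp: less_Suc_eq)
      with IH show False unfolding det_wronskian_eq_0_iff by blast
    qed
    define c where "c j = v j / v m" for j
    have c: "(\<Sum>j<m. (D ^^ i) (g j) * c j) + (D ^^ i) (g m) = 0" if "i < Suc m" for i
    proof -
      have "((\<Sum>j<m. (D ^^ i) (g j) * v j) + (D ^^ i) (g m) * v m) / v m = 0"
        using v(2)[OF that] by simp
      then show ?thesis using vm by (simp add: add_divide_distrib sum_divide_distrib c_def)
    qed
    have "(\<Sum>j<m. (D ^^ i) (g j) * D (c j)) = 0" if i: "i < m" for i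
    proof -
      have "D ((\<Sum>j<m. (D ^^ i) (g j) * c j) + (D ^^ i) (g m)) = 0"
        using c[of i] i by simp
      then have "(\<Sum>j<m. (D ^^ i) (g j) * D (c j)) +
          ((\<Sum>j<m. (D ^^ Suc i) (g j) * c j) + (D ^^ Suc i) (g m)) = 0"
        by (simp add: D_add D_sum D_mult sum.distrib algebra_simps)
      then show ?thesis using c[of "Suc i"] i by simp
    qed
    then have Dc: "\<forall>j<m. D (c j) = 0"
      using det_wronskian_nonzeroD[OF IH, of "\<lambda>j. D (c j)"] by simp
    have "\<forall>j<Suc m. (c(m := 1)) j = 0"
    proof (rule Suc.prems)
      show "D ((c(m := 1)) j) = 0" if "j < Suc m" for j
        using that Dc by (auto simp: less_Suc_eq)
      show "(\<Sum>j<Suc m. (c(m := 1)) j * g j) = 0"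
        using c[of 0] by (simp add: mult.commute)
    qed
    then show False by auto
  qed
qed

lemma wronskian_linear_change:
  assumes "\<And>i j. i < m \<Longrightarrow> j < m \<Longrightarrow> D (c i j) = 0"
    and "\<And>j. j < m \<Longrightarrow> h j = (\<Sum>i<m. c i j * g i)"
  shows "det (wronskian_mat D m h) = det (mat m m (\<lambda>(i, j). c i j)) * det (wronskian_mat D m g)"
proof -
  have "wronskian_mat D m h = wronskian_mat D m g * mat m m (\<lambda>(i, j). c i j)"
  proof (rule eq_matI, goal_cases)
    case (1 i j)
    then have ij: "i < m" "j < m" by (auto simp: wronskian_mat_def)
    have "(D ^^ i) (h j) = (\<Sum>k<m. (D ^^ i) (c k j * g k))"
      using ij by (simp add: assms D_power_sum)
    also have "\<dots> = (\<Sum>k<m. (D ^^ i) (g k) * c k j)"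
      using ij assms(1) by (intro sum.cong refl, subst D_power_const_mult) auto
    finally have "(D ^^ i) (h j) = (\<Sum>k<m. (D ^^ i) (g k) * c k j)" .
    with ij show ?case
      by (simp add: wronskian_mat_def scalar_prod_def lessThan_atLeast0)
  qed (auto simp: wronskian_mat_def)
  then have "det (wronskian_mat D m h) = det (wronskian_mat D m g) * det (mat m m (\<lambda>(i, j). c i j))"
    by (simp add: det_mult[OF wronskian_mat_carrier])
  then show ?thesis by (simp only: mult.commute)
qed

end

section \<open>Orders and polynomials in the inverse variable\<close>

definition ord_ge :: "'k::zero fls \<Rightarrow> int \<Rightarrow> bool" where
  "ord_ge f n \<longleftrightarrow> (\<forall>k<n. fls_nth f k = 0)"

lemma ord_ge_0 [simp]: "ord_ge 0 n"
  by (simp add: ord_ge_def)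

lemma ord_ge_subdegree [simp]: "ord_ge f (fls_subdegree f)"
  by (simp add: ord_ge_def)

lemma ord_ge_iff: "ord_ge f n \<longleftrightarrow> f = 0 \<or> n \<le> fls_subdegree f"
  by (metis fls_eq0_below_subdegree fls_subdegree_geI less_le_trans ord_ge_def fls_zero_nth)

lemma ord_ge_mono: "ord_ge f n \<Longrightarrow> m \<le> n \<Longrightarrow> ord_ge f m"
  by (auto simp: ord_ge_def)

lemma ord_ge_add: "ord_ge f n \<Longrightarrow> ord_ge g n \<Longrightarrow> ord_ge (f + g) n"
  for f :: "'k::monoid_add fls" by (auto simp: ord_ge_def)

lemma ord_ge_diff: "ord_ge f n \<Longrightarrow> ord_ge g n \<Longrightarrow> ord_ge (f - g) n"
  for f :: "'k::group_add fls" by (auto simp: ord_ge_def)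

lemma ord_ge_uminus: "ord_ge f n \<Longrightarrow> ord_ge (- f) n"
  for f :: "'k::group_add fls" by (auto simp: ord_ge_def)

lemma ord_ge_sum: "(\<And>x. x \<in> A \<Longrightarrow> ord_ge (f x) n) \<Longrightarrow> ord_ge (sum f A) n"
  for f :: "_ \<Rightarrow> 'k::comm_monoid_add fls" by (auto simp: ord_ge_def fls_nth_sum)

lemma ord_ge_mult: "ord_ge f n \<Longrightarrow> ord_ge g m \<Longrightarrow> ord_ge (f * g) (n + m)"
  for f :: "'k::field fls" by (cases "f = 0 \<or> g = 0") (auto simp: ord_ge_iff)

lemma ord_ge_1 [simp]: "ord_ge (1::'k::field fls) 0"
  by (simp add: ord_ge_iff)

lemma ord_ge_prod:
  "(\<And>x. x \<in> A \<Longrightarrow> ord_ge (f x) (u x)) \<Longrightarrow> ord_ge (prod f A) (sum u A)"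
  for f :: "_ \<Rightarrow> 'k::field fls"
  by (induction A rule: infinite_finite_induct) (auto intro!: ord_ge_mult)

lemma ord_ge_power: "ord_ge f u \<Longrightarrow> ord_ge (f ^ n) (int n * u)"
  for f :: "'k::field fls"
  using ord_ge_prod[of "{..<n}" "\<lambda>_. f" "\<lambda>_. u"] by simp

text \<open>
  The ring \<open>k[T]\<close> inside \<open>k((T\<^sup>-\<^sup>1))\<close>: a Laurent series in \<open>T\<^sup>-\<^sup>1\<close> without terms of positive order
  is a polynomial in \<open>T\<close>. What matters for Wronskians is that this ring is closed under the derivation
  and that its nonzero elements have order at most \<open>0\<close>.
\<close>

definition nonpos_supp :: "'k::zero fls set" where
  "nonpos_supp = {f. \<forall>k>0. fls_nth f k = 0}"

lemma nonpos_supp_subdegree: "f \<in> nonpos_supp \<Longrightarrow> fls_subdegree f \<le> 0"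
  by (metis (mono_tags, lifting) mem_Collect_eq nonpos_supp_def not_le nth_fls_subdegree_nonzero
      fls_zero_subdegree order_refl)

lemma nonpos_supp_add: "f \<in> nonpos_supp \<Longrightarrow> g \<in> nonpos_supp \<Longrightarrow> f + g \<in> nonpos_supp"
  for f :: "'k::field fls" by (auto simp: nonpos_supp_def)

lemma nonpos_supp_uminus: "f \<in> nonpos_supp \<Longrightarrow> - f \<in> nonpos_supp"
  for f :: "'k::field fls" by (auto simp: nonpos_supp_def)

lemma nonpos_supp_diff: "f \<in> nonpos_supp \<Longrightarrow> g \<in> nonpos_supp \<Longrightarrow> f - g \<in> nonpos_supp"
  for f :: "'k::field fls" by (auto simp: nonpos_supp_def)

lemma nonpos_supp_const [simp]: "fls_const c \<in> nonpos_supp"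
  by (auto simp: nonpos_supp_def)

lemma nonpos_supp_0 [simp]: "0 \<in> nonpos_supp"
  by (auto simp: nonpos_supp_def)

lemma nonpos_supp_1 [simp]: "(1::'k::field fls) \<in> nonpos_supp"
  by (auto simp: nonpos_supp_def)

lemma nonpos_supp_of_nat [simp]: "(of_nat n::'k::field fls) \<in> nonpos_supp"
  by (simp add: fls_of_nat)

lemma nonpos_supp_mult: "f \<in> nonpos_supp \<Longrightarrow> g \<in> nonpos_supp \<Longrightarrow> f * g \<in> nonpos_supp"
  for f g :: "'k::field fls"
proof -
  assume f: "f \<in> nonpos_supp" and g: "g \<in> nonpos_supp"
  have "fls_nth (f * g) n = 0" if "n > 0" for n
    unfolding fls_times_nth(2)
  proof (intro sum.neutral ballI)
    fix i assume "i \<in> {fls_subdegree f..n - fls_subdegree g}"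
    show "fls_nth f i * fls_nth g (n - i) = 0"
      using f g that by (cases "i > 0") (auto simp: nonpos_supp_def)
  qed
  then show ?thesis by (simp add: nonpos_supp_def)
qed

lemma nonpos_supp_sum: "(\<And>x. x \<in> A \<Longrightarrow> f x \<in> nonpos_supp) \<Longrightarrow> sum f A \<in> nonpos_supp"
  for f :: "_ \<Rightarrow> 'k::field fls"
  by (induction A rule: infinite_finite_induct) (auto intro: nonpos_supp_add)

lemma nonpos_supp_prod: "(\<And>x. x \<in> A \<Longrightarrow> f x \<in> nonpos_supp) \<Longrightarrow> prod f A \<in> nonpos_supp"
  for f :: "_ \<Rightarrow> 'k::field fls"
  by (induction A rule: infinite_finite_induct) (auto intro: nonpos_supp_mult)

lemma nonpos_supp_power: "f \<in> nonpos_supp \<Longrightarrow> f ^ n \<in> nonpos_supp"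
  for f :: "'k::field fls"
  by (induction n) (auto intro: nonpos_supp_mult)

text \<open>
  The derivation \<open>X d/dX\<close> is chosen because it lowers no order and maps polynomials in \<open>X\<^sup>-\<^sup>1\<close> to such
  polynomials.
\<close>

definition euler :: "'k::field fls \<Rightarrow> 'k fls" where
  "euler f = fls_X * fls_deriv f"

lemma euler_nth [simp]: "fls_nth (euler f) n = of_int n * fls_nth f n"
  by (simp add: euler_def fls_X_times_conv_shift)

lemma derivation_euler: "derivation euler"
  by unfold_locales (simp_all add: euler_def algebra_simps)

lemma euler_eq_0_iff: "euler f = 0 \<longleftrightarrow> (\<exists>c. f = fls_const c)" for f :: "'k::field_char_0 fls"
proof
  assume "euler f = 0"
  then have "of_int n * fls_nth f n = 0" for n by (metis euler_nth fls_zero_nth)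
  then have "f = fls_const (fls_nth f 0)" by (intro fls_eqI) auto
  then show "\<exists>c. f = fls_const c" ..
qed (auto simp: euler_def)

lemma ord_ge_euler: "ord_ge f n \<Longrightarrow> ord_ge (euler f) n"
  by (simp add: ord_ge_def)

lemma nonpos_supp_euler: "f \<in> nonpos_supp \<Longrightarrow> euler f \<in> nonpos_supp"
  by (simp add: nonpos_supp_def)

section \<open>Linear algebra over the constants\<close>

definition const_scale :: "'k::field \<Rightarrow> 'k fls \<Rightarrow> 'k fls" where
  "const_scale c f = fls_const c * f"

interpretation fls_vs: vector_space const_scale
  by unfold_locales
    (simp_all add: const_scale_def algebra_simps fls_plus_const[symmetric] flip: fls_const_mult_const)

lemma fls_const_hom: "comm_ring_hom (fls_const :: 'k::field \<Rightarrow> 'k fls)"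
  by unfold_locales (simp_all add: fls_plus_const)

lemma span_enumeration_coords:
  fixes m :: nat
  assumes "bij_betw g {..<m} B" and "x \<in> fls_vs.span B"
  shows "\<exists>c. x = (\<Sum>i<m. fls_const (c i) * g i)"
proof -
  have "finite B" using bij_betw_finite[OF assms(1)] by simp
  with assms(2) obtain c where "x = (\<Sum>v\<in>B. fls_const (c v) * v)"
    by (auto simp: fls_vs.span_finite const_scale_def)
  also have "\<dots> = (\<Sum>i<m. fls_const (c (g i)) * g i)"
    by (rule sum.reindex_bij_betw[OF assms(1), symmetric])
  finally show ?thesis by (intro exI[of _ "\<lambda>i. c (g i)"])
qed

lemma independent_enumeration:
  fixes m :: nat
  assumes "bij_betw g {..<m} B" and "fls_vs.independent B"
    and "(\<Sum>i<m. fls_const (c i) * g i) = 0" and "j < m"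
  shows "c j = 0"
proof -
  let ?u = "\<lambda>v. c (inv_into {..<m} g v)"
  have fin: "finite B" using bij_betw_finite[OF assms(1)] by simp
  have inv: "inv_into {..<m} g (g i) = i" if "i < m" for i
    using assms(1) that by (simp add: bij_betw_def)
  have "(\<Sum>v\<in>B. fls_const (?u v) * v) = (\<Sum>i<m. fls_const (c i) * g i)"
    by (subst sum.reindex_bij_betw[OF assms(1), symmetric]) (simp add: inv)
  with assms(3) have "(\<Sum>v\<in>B. fls_const (?u v) * v) = 0" by simp
  moreover have "g j \<in> B" using assms(1,4) by (auto simp: bij_betw_def)
  ultimately have "?u (g j) = 0"
    using fls_vs.independentD[OF assms(2) fin order_refl, of ?u] by (simp add: const_scale_def)
  then show ?thesis using inv assms(4) by simp
qed

text \<open>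
  If all power sums vanished, then so would \<open>\<Sum> c\<^sub>s Q(c\<^sub>s)\<close> for every polynomial \<open>Q\<close>. A \<open>Q\<close> that vanishes
  at all values other than \<open>1\<close> turns this sum into a positive multiple of \<open>Q(1) \<noteq> 0\<close>.
\<close>

lemma exists_nonzero_power_sum:
  fixes c :: "'s \<Rightarrow> 'k::field_char_0"
  assumes fin: "finite S" and s0: "s0 \<in> S" "c s0 = 1"
  shows "\<exists>t>0. (\<Sum>s\<in>S. c s ^ t) \<noteq> 0"
proof (rule ccontr)
  assume "\<not> ?thesis"
  then have ps: "(\<Sum>s\<in>S. c s ^ t) = 0" if "t > 0" for t using that by blast
  define Q where "Q = (\<Prod>v\<in>c ` S - {1}. [:- v, 1:])"
  have "(\<Sum>s\<in>S. c s * poly Q (c s)) = (\<Sum>s\<in>S. \<Sum>i\<le>degree Q. coeff Q i * c s ^ Suc i)"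
    by (simp add: poly_altdef sum_distrib_left algebra_simps)
  also have "\<dots> = (\<Sum>i\<le>degree Q. coeff Q i * (\<Sum>s\<in>S. c s ^ Suc i))"
    by (subst sum.swap) (simp add: sum_distrib_left)
  also have "\<dots> = 0" using ps[of "Suc _"] by simp
  finally have 0: "(\<Sum>s\<in>S. c s * poly Q (c s)) = 0" .
  have "poly Q (c s) = 0" if "s \<in> S" "c s \<noteq> 1" for s
    using that fin by (auto simp: Q_def poly_prod)
  then have "(\<Sum>s\<in>S. c s * poly Q (c s)) = (\<Sum>s\<in>{s\<in>S. c s = 1}. c s * poly Q (c s))"
    using fin by (intro sum.mono_neutral_right) auto
  also have "\<dots> = of_nat (card {s\<in>S. c s = 1}) * poly Q 1" by simp
  finally have "of_nat (card {s\<in>S. c s = 1}) * poly Q 1 = 0" using 0 by simp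
  moreover have "poly Q 1 \<noteq> 0" using fin by (auto simp: Q_def poly_prod)
  moreover have "card {s\<in>S. c s = 1} \<noteq> 0" using fin s0 by auto
  ultimately show False by simp
qed

text \<open>
  The logarithmic derivative of \<open>\<Prod> (1 - \<rho>\<^sub>i X)\<close> is the generating function of the power sums, up to sign.
\<close>

lemma fps_deriv_prod_linear:
  fixes \<rho> :: "nat \<Rightarrow> 'b::field"
  shows "fps_deriv (\<Prod>i<d. 1 - fps_const (\<rho> i) * fps_X) =
    - (\<Prod>i<d. 1 - fps_const (\<rho> i) * fps_X) * Abs_fps (\<lambda>n. \<Sum>i<d. \<rho> i ^ Suc n)"
proof (induction d)
  case 0
  then show ?case by (simp add: fps_ext)
next
  case (Suc d)
  let ?F = "\<Prod>i<d. 1 - fps_const (\<rho> i) * fps_X" and ?G = "Abs_fps (\<lambda>n. \<Sum>i<d. \<rho> i ^ Suc n)"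
  let ?L = "1 - fps_const (\<rho> d) * fps_X" and ?H = "Abs_fps (\<lambda>n. \<rho> d ^ Suc n)"
  have GH: "Abs_fps (\<lambda>n. \<Sum>i<Suc d. \<rho> i ^ Suc n) = ?G + ?H"
    by (rule fps_ext) simp
  have LH: "?L * ?H = fps_const (\<rho> d)"
  proof (rule fps_ext)
    fix n show "fps_nth (?L * ?H) n = fps_nth (fps_const (\<rho> d)) n"
      by (cases n) (simp_all add: left_diff_distrib mult.assoc)
  qed
  have dL: "fps_deriv ?L = - fps_const (\<rho> d)" by simp
  have "fps_deriv (?F * ?L) = - (?F * ?L * ?G) - ?F * fps_const (\<rho> d)"
  proof -
    have "F * - c + - F * G * L = - (F * L * G) - F * c" for F G L c :: "'b fps"
      by (simp add: algebra_simps)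
    then show ?thesis unfolding fps_deriv_mult Suc.IH dL .
  qed
  also have "\<dots> = - (?F * ?L) * (?G + ?H)"
  proof -
    have "- (F * L * G) - F * (L * H) = - (F * L) * (G + H)" for F G L H :: "'b fps"
      by (simp add: algebra_simps)
    from this[of ?F ?L ?G ?H] show ?thesis unfolding LH .
  qed
  finally show ?case by (simp only: GH prod.lessThan_Suc)
qed

text \<open>
  Newton's identities, read off from \<open>fps_deriv_prod_linear\<close>: they express each power sum by earlier
  ones and the coefficients of the polynomial without any division.
\<close>

lemma power_sums_mem:
  fixes \<rho> :: "nat \<Rightarrow> 'b::field"
  assumes "0 \<in> R" "1 \<in> R" and add: "\<And>x y. x \<in> R \<Longrightarrow> y \<in> R \<Longrightarrow> x + y \<in> R"
    and um: "\<And>x. x \<in> R \<Longrightarrow> - x \<in> R" and mult: "\<And>x y. x \<in> R \<Longrightarrow> y \<in> R \<Longrightarrow> x * y \<in> R"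
    and coeffs: "\<And>j. coeff (\<Prod>i<d. [:- \<rho> i, 1:]) j \<in> R"
  shows "(\<Sum>i<d. \<rho> i ^ e) \<in> R"
proof -
  have of_nat: "of_nat n \<in> R" for n by (induction n) (auto intro: assms)
  have sum: "sum f A \<in> R" if "\<And>x. x \<in> A \<Longrightarrow> f x \<in> R" for f :: "nat \<Rightarrow> 'b" and A
    using that by (induction A rule: infinite_finite_induct) (auto intro: assms)
  define F where "F = (\<Prod>i<d. 1 - fps_const (\<rho> i) * fps_X)"
  have refl: "reflect_poly [:- r, 1:] = [:1, - r:]" for r :: 'b
    by (cases "r = 0") (auto simp: reflect_poly_def)
  have "F = fps_of_poly (reflect_poly (\<Prod>i<d. [:- \<rho> i, 1:]))"
    unfolding F_def reflect_poly_prod fps_of_poly_prod refl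
    by (intro prod.cong refl fps_ext) (auto simp: coeff_pCons fps_eq_iff split: nat.splits)
  then have F: "fps_nth F n \<in> R" for n
    using coeffs assms(1) by (simp add: coeff_reflect_poly)
  have F0: "fps_nth F 0 = 1"
    unfolding F_def by (induction d) auto
  have ps: "(\<Sum>i<d. \<rho> i ^ Suc n) \<in> R" for n
  proof (induction n rule: less_induct)
    case (less n)
    let ?G = "Abs_fps (\<lambda>n. \<Sum>i<d. \<rho> i ^ Suc n)"
    have "fps_nth (fps_deriv F) n = - fps_nth (F * ?G) n"
      using fps_deriv_prod_linear[where \<rho> = \<rho> and d = d] by (simp add: F_def)
    also have "fps_nth (F * ?G) n = fps_nth ?G n + (\<Sum>k=1..n. fps_nth F k * fps_nth ?G (n - k))"
      by (simp add: fps_mult_nth sum.atLeast_Suc_atMost[of 0 n] F0)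
    finally have eq: "fps_nth (fps_deriv F) n =
        - (fps_nth ?G n + (\<Sum>k=1..n. fps_nth F k * fps_nth ?G (n - k)))" .
    have "g = - a + - b" if "a = - (g + b)" for a b g :: 'b
      using that by simp
    from this[OF eq] have G: "fps_nth ?G n =
        - (fps_nth (fps_deriv F) n) + - (\<Sum>k=1..n. fps_nth F k * fps_nth ?G (n - k))" .
    have "fps_nth (fps_deriv F) n \<in> R" using F of_nat[of "Suc n"] by (auto intro: mult)
    moreover have "(\<Sum>k=1..n. fps_nth F k * fps_nth ?G (n - k)) \<in> R"
      using less.IH F by (intro sum mult) auto
    ultimately have "fps_nth ?G n \<in> R" unfolding G by (intro add um)
    then show ?case by simp
  qed
  show ?thesis
  proof (cases e)
    case 0
    then show ?thesis using of_nat[of d] by simp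
  next
    case (Suc n)
    then show ?thesis using ps by simp
  qed
qed

section \<open>Families of conjugates and the Wronskian inequality\<close>

text \<open>
  The roots \<open>\<rho>\<^sub>0, \<dots>, \<rho>\<^sub>d\<^sub>-\<^sub>1\<close> of a monic polynomial with polynomial coefficients. For a separable polynomial,
  \<open>\<Delta>\<close> and \<open>G\<close> result from implicit differentiation and a Bezout identity; they ensure that the
  derivation \<open>D = \<Delta> X d/dX\<close> preserves the integral expressions in the roots.
\<close>

locale conjugates =
  fixes d :: nat and \<rho> :: "nat \<Rightarrow> 'k::field_char_0 fls" and \<Delta> :: "'k fls" and G :: "'k fls poly"
  assumes coeffs: "\<And>j. coeff (\<Prod>i<d. [:- \<rho> i, 1:]) j \<in> nonpos_supp"
    and \<Delta>_nonpos: "\<Delta> \<in> nonpos_supp" and \<Delta>_nonzero: "\<Delta> \<noteq> 0"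
    and G_nonpos: "\<And>j. coeff G j \<in> nonpos_supp"
    and deriv_root: "\<And>i. i < d \<Longrightarrow> \<Delta> * euler (\<rho> i) = poly G (\<rho> i)"
begin

definition D :: "'k fls \<Rightarrow> 'k fls" where "D f = \<Delta> * euler f"

text \<open>
  All maps between the indices are used and not only the permutations: a sum over all maps of a
  monomial in the roots is a product of power sums.
\<close>

definition selfmaps :: "(nat \<Rightarrow> nat) set" where "selfmaps = {..<d} \<rightarrow>\<^sub>E {..<d}"

definition idmap :: "nat \<Rightarrow> nat" where "idmap = restrict id {..<d}"

definition Delta_deg :: int where "Delta_deg = - fls_subdegree \<Delta>"

text \<open>
  An integral polynomial expression in the roots, represented by the values that it takes after the
  substitutions \<open>\<rho>\<^sub>i \<mapsto> \<rho>\<^bsub>\<sigma>(i)\<^esub>\<close>. An expression is not determined by its value at \<open>\<sigma> = id\<close>, because algebraic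
  relations between the roots need not survive a substitution.
\<close>

inductive conj_family :: "((nat \<Rightarrow> nat) \<Rightarrow> 'k fls) \<Rightarrow> bool" where
  const: "r \<in> nonpos_supp \<Longrightarrow> conj_family (\<lambda>\<sigma>. r)"
| root_mult: "i < d \<Longrightarrow> conj_family F \<Longrightarrow> conj_family (\<lambda>\<sigma>. \<rho> (\<sigma> i) * F \<sigma>)"
| add: "conj_family F \<Longrightarrow> conj_family F' \<Longrightarrow> conj_family (\<lambda>\<sigma>. F \<sigma> + F' \<sigma>)"
| agree: "conj_family F \<Longrightarrow> (\<And>\<sigma>. \<sigma> \<in> selfmaps \<Longrightarrow> F \<sigma> = F' \<sigma>) \<Longrightarrow> conj_family F'"

lemma finite_selfmaps [simp]: "finite selfmaps"
  by (simp add: selfmaps_def finite_PiE)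

lemma selfmaps_less: "\<sigma> \<in> selfmaps \<Longrightarrow> i < d \<Longrightarrow> \<sigma> i < d"
  by (auto simp: selfmaps_def)

lemma idmap_in [simp]: "idmap \<in> selfmaps"
  by (auto simp: selfmaps_def idmap_def)

lemma idmap_eq [simp]: "i < d \<Longrightarrow> idmap i = i"
  by (simp add: idmap_def)

lemma Delta_deg_nonneg: "Delta_deg \<ge> 0"
  using nonpos_supp_subdegree[OF \<Delta>_nonpos] by (simp add: Delta_deg_def)

sublocale derivation D
proof
  show "D (x + y) = D x + D y" for x y
    unfolding D_def derivation.D_add[OF derivation_euler] by (rule distrib_left)
  show "D (x * y) = D x * y + x * D y" for x y
    unfolding D_def derivation.D_mult[OF derivation_euler] by (simp add: algebra_simps)
qed

lemma D_eq_0_iff: "D f = 0 \<longleftrightarrow> (\<exists>c. f = fls_const c)"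
  using \<Delta>_nonzero by (simp add: D_def euler_eq_0_iff)

lemma ord_ge_D: "ord_ge f n \<Longrightarrow> ord_ge (D f) (n - Delta_deg)"
  using ord_ge_mult[OF ord_ge_subdegree[of \<Delta>] ord_ge_euler[of f n]]
  by (simp add: D_def Delta_deg_def algebra_simps)

lemma ord_ge_D_power: "ord_ge f n \<Longrightarrow> ord_ge ((D ^^ i) f) (n - Delta_deg * int i)"
proof (induction i)
  case (Suc i)
  from ord_ge_D[OF Suc.IH[OF Suc.prems]] show ?case by (simp add: algebra_simps)
qed simp

lemma family_scale: "conj_family F \<Longrightarrow> r \<in> nonpos_supp \<Longrightarrow> conj_family (\<lambda>\<sigma>. r * F \<sigma>)"
proof (induction rule: conj_family.induct)
  case (const s)
  then show ?case by (auto intro: conj_family.const nonpos_supp_mult)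
next
  case (root_mult i F)
  then show ?case
    using conj_family.root_mult[of i "\<lambda>\<sigma>. r * F \<sigma>"] by (simp add: algebra_simps)
next
  case (add F F')
  from conj_family.add[OF add.IH(1)[OF add.prems] add.IH(2)[OF add.prems]]
  show ?case by (simp add: algebra_simps)
next
  case (agree F F')
  show ?case by (rule conj_family.agree[of "\<lambda>\<sigma>. r * F \<sigma>"]) (use agree in auto)
qed

lemma family_mult: "conj_family F \<Longrightarrow> conj_family F' \<Longrightarrow> conj_family (\<lambda>\<sigma>. F \<sigma> * F' \<sigma>)"
proof (induction rule: conj_family.induct)
  case (const s)
  then show ?case by (simp add: family_scale)
next
  case (root_mult i F)
  then show ?case
    using conj_family.root_mult[of i "\<lambda>\<sigma>. F \<sigma> * F' \<sigma>"] by (simp add: algebra_simps)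
next
  case (add F1 F2)
  from conj_family.add[OF add.IH(1)[OF add.prems] add.IH(2)[OF add.prems]]
  show ?case by (simp add: algebra_simps)
next
  case (agree F F2)
  show ?case by (rule conj_family.agree[of "\<lambda>\<sigma>. F \<sigma> * F' \<sigma>"]) (use agree in auto)
qed

lemma family_sum: "(\<And>x. x \<in> A \<Longrightarrow> conj_family (F x)) \<Longrightarrow> conj_family (\<lambda>\<sigma>. \<Sum>x\<in>A. F x \<sigma>)"
  by (induction A rule: infinite_finite_induct) (auto intro: conj_family.const conj_family.add)

lemma family_prod: "(\<And>x. x \<in> A \<Longrightarrow> conj_family (F x)) \<Longrightarrow> conj_family (\<lambda>\<sigma>. \<Prod>x\<in>A. F x \<sigma>)"
  by (induction A rule: infinite_finite_induct) (auto intro: conj_family.const family_mult)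

lemma family_power: "conj_family F \<Longrightarrow> conj_family (\<lambda>\<sigma>. F \<sigma> ^ n)"
  by (induction n) (auto intro: conj_family.const family_mult)

lemma family_root: "i < d \<Longrightarrow> conj_family (\<lambda>\<sigma>. \<rho> (\<sigma> i))"
  using conj_family.root_mult[OF _ conj_family.const[of 1], of i] by simp

lemma family_poly:
  assumes "\<And>j. coeff F j \<in> nonpos_supp" "i < d"
  shows "conj_family (\<lambda>\<sigma>. poly F (\<rho> (\<sigma> i)))"
  unfolding poly_altdef
  using assms by (intro family_sum family_mult family_power family_root conj_family.const) auto

lemma family_D: "conj_family F \<Longrightarrow> conj_family (\<lambda>\<sigma>. D (F \<sigma>))"
proof (induction rule: conj_family.induct)
  case (const r)
  then show ?case
    by (auto intro!: conj_family.const nonpos_supp_mult nonpos_supp_euler \<Delta>_nonpos simp: D_def)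
next
  case (root_mult i F)
  have "conj_family (\<lambda>\<sigma>. poly G (\<rho> (\<sigma> i)) * F \<sigma> + \<rho> (\<sigma> i) * D (F \<sigma>))"
    by (intro conj_family.add family_mult family_poly G_nonpos family_root root_mult)
  then show ?case
    by (rule conj_family.agree)
      (simp only: D_mult, simp add: D_def deriv_root selfmaps_less root_mult.hyps(1))
next
  case (add F F')
  from conj_family.add[OF add.IH] show ?case by (simp add: D_add)
next
  case (agree F F')
  show ?case by (rule conj_family.agree[of "\<lambda>\<sigma>. D (F \<sigma>)"]) (use agree in auto)
qed

lemma family_D_power: "conj_family F \<Longrightarrow> conj_family (\<lambda>\<sigma>. (D ^^ i) (F \<sigma>))"
  by (induction i) (auto intro: family_D)

lemma family_det:
  assumes "\<And>i j. i < m \<Longrightarrow> j < m \<Longrightarrow> conj_family (F i j)"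
  shows "conj_family (\<lambda>\<sigma>. det (mat m m (\<lambda>(i, j). F i j \<sigma>)))"
proof -
  have "conj_family (\<lambda>\<sigma>. \<Sum>p\<in>{p. p permutes {0..<m}}. signof p * (\<Prod>i = 0..<m. F i (p i) \<sigma>))"
  proof (intro family_sum family_mult family_prod)
    fix p show "conj_family (\<lambda>\<sigma>. signof p)"
      by (auto simp: sign_def intro!: conj_family.const nonpos_supp_uminus)
  next
    fix p i assume "p \<in> {p. p permutes {0..<m}}" "i \<in> {0..<m}"
    then show "conj_family (\<lambda>\<sigma>. F i (p i) \<sigma>)"
      using permutes_in_image[of p "{0..<m}" i] by (intro assms) auto
  qed
  moreover have "det (mat m m (\<lambda>(i, j). F i j \<sigma>)) =
      (\<Sum>p\<in>{p. p permutes {0..<m}}. signof p * (\<Prod>i = 0..<m. F i (p i) \<sigma>))" for \<sigma>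
    unfolding det_def'[OF mat_carrier]
  proof (intro sum.cong refl arg_cong2[where f = "(*)"] prod.cong)
    fix p i assume "p \<in> {p. p permutes {0..<m}}" "i \<in> {0..<m}"
    then show "mat m m (\<lambda>(i, j). F i j \<sigma>) $$ (i, p i) = F i (p i) \<sigma>"
      using permutes_in_image[of p "{0..<m}" i] by auto
  qed
  ultimately show ?thesis by simp
qed

lemma power_sum_nonpos: "(\<Sum>j<d. \<rho> j ^ e) \<in> nonpos_supp"
  by (rule power_sums_mem)
    (auto intro: nonpos_supp_add nonpos_supp_uminus nonpos_supp_mult coeffs)

text \<open>
  The factor with arbitrary exponents \<open>e\<close> is there for the induction: it absorbs the roots by which a
  family is multiplied.
\<close>

lemma sum_family_monomial:
  "conj_family F \<Longrightarrow> (\<Sum>\<sigma>\<in>selfmaps. F \<sigma> * (\<Prod>i<d. \<rho> (\<sigma> i) ^ e i)) \<in> nonpos_supp"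
proof (induction arbitrary: e rule: conj_family.induct)
  case (const r)
  have "(\<Sum>\<sigma>\<in>selfmaps. \<Prod>i<d. \<rho> (\<sigma> i) ^ e i) = (\<Prod>i<d. \<Sum>j<d. \<rho> j ^ e i)"
    unfolding selfmaps_def by (rule prod_sum_PiE[symmetric]) auto
  then show ?case
    using const by (auto simp flip: sum_distrib_left
        intro!: nonpos_supp_mult nonpos_supp_prod power_sum_nonpos)
next
  case (root_mult i F)
  have eq: "\<rho> (\<sigma> i) * F \<sigma> * (\<Prod>k<d. \<rho> (\<sigma> k) ^ e k) =
      F \<sigma> * (\<Prod>k<d. \<rho> (\<sigma> k) ^ (e(i := Suc (e i))) k)" for \<sigma>
  proof -
    have "(\<Prod>k<d. \<rho> (\<sigma> k) ^ (e(i := Suc (e i))) k) = \<rho> (\<sigma> i) * (\<Prod>k<d. \<rho> (\<sigma> k) ^ e k)"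
      using root_mult.hyps(1) by (simp add: prod.remove[of "{..<d}" i])
    then show ?thesis by (simp add: algebra_simps)
  qed
  show ?case unfolding eq by (rule root_mult.IH)
next
  case (add F F')
  then show ?case by (simp add: ring_distribs sum.distrib nonpos_supp_add)
next
  case (agree F F')
  then show ?case by (auto cong: sum.cong)
qed

lemma sum_family: "conj_family F \<Longrightarrow> (\<Sum>\<sigma>\<in>selfmaps. F \<sigma>) \<in> nonpos_supp"
  using sum_family_monomial[of F "\<lambda>_. 0"] by simp

end

context conjugates
begin

lemma wronskian_const_change:
  assumes "\<And>j. j < m \<Longrightarrow> h j = (\<Sum>i<m. fls_const (c j i) * g i)"
  shows "\<exists>k. det (wronskian_mat D m h) = fls_const k * det (wronskian_mat D m g)"
proof -
  interpret fc: comm_ring_hom "fls_const :: 'k \<Rightarrow> 'k fls" by (rule fls_const_hom)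
  have "det (wronskian_mat D m h) =
      det (mat m m (\<lambda>(i, j). fls_const (c j i))) * det (wronskian_mat D m g)"
    by (rule wronskian_linear_change) (use assms in \<open>auto simp: D_eq_0_iff\<close>)
  also have "mat m m (\<lambda>(i, j). fls_const (c j i)) = map_mat fls_const (mat m m (\<lambda>(i, j). c j i))"
    by (rule eq_matI) auto
  finally show ?thesis by (auto simp: fc.hom_det)
qed

lemma wronskian_independent_nonzero:
  fixes m :: nat
  assumes "bij_betw g {..<m} B" and "fls_vs.independent B"
  shows "det (wronskian_mat D m g) \<noteq> 0"
proof (rule wronskian_nonzero)
  fix c assume c: "\<And>j. j < m \<Longrightarrow> D (c j) = 0" "(\<Sum>j<m. c j * g j) = 0"
  from c(1) have "\<forall>j. \<exists>k. j < m \<longrightarrow> c j = fls_const k" by (auto simp: D_eq_0_iff)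
  then obtain k where k: "\<And>j. j < m \<Longrightarrow> c j = fls_const (k j)" by metis
  then have "(\<Sum>j<m. fls_const (k j) * g j) = 0" using c(2) by simp
  from independent_enumeration[OF assms this] show "\<forall>j<m. c j = 0" using k by simp
qed

text \<open>
  Each application of \<open>D\<close> lowers the order by at most \<open>Delta_deg\<close>, and row \<open>i < m\<close> applies it \<open>i\<close> times;
  the bound uses \<open>m\<close> for every row.
\<close>

lemma ord_ge_wronskian:
  assumes "\<And>j. j < m \<Longrightarrow> ord_ge (h j) (w j)"
  shows "ord_ge (det (wronskian_mat D m h)) ((\<Sum>j<m. w j) - Delta_deg * (int m)\<^sup>2)"
  unfolding det_def'[OF wronskian_mat_carrier]
proof (rule ord_ge_sum)
  fix p assume "p \<in> {p. p permutes {0..<m}}"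
  then have p: "p permutes {0..<m}" by simp
  have "ord_ge (\<Prod>i = 0..<m. wronskian_mat D m h $$ (i, p i)) (\<Sum>i = 0..<m. w (p i) - Delta_deg * int m)"
  proof (rule ord_ge_prod)
    fix i assume i: "i \<in> {0..<m}"
    then have pi: "p i < m" using permutes_in_image[OF p, of i] by simp
    have "ord_ge ((D ^^ i) (h (p i))) (w (p i) - Delta_deg * int m)"
      using i Delta_deg_nonneg by (intro ord_ge_mono[OF ord_ge_D_power[OF assms[OF pi]]])
        (auto intro!: mult_left_mono)
    then show "ord_ge (wronskian_mat D m h $$ (i, p i)) (w (p i) - Delta_deg * int m)"
      using i pi by (simp add: wronskian_mat_def)
  qed
  also have "(\<Sum>i = 0..<m. w (p i) - Delta_deg * int m) = (\<Sum>j<m. w j) - Delta_deg * (int m)\<^sup>2"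
    using sum.permute[OF p, of w]
    by (simp add: sum_subtractf lessThan_atLeast0 power2_eq_square o_def)
  finally show "ord_ge (signof p * (\<Prod>i = 0..<m. wronskian_mat D m h $$ (i, p i)))
      ((\<Sum>j<m. w j) - Delta_deg * (int m)\<^sup>2)"
    by (auto simp: sign_def intro: ord_ge_uminus)
qed

text \<open>
  By stability the substituted Wronskian \<open>W \<sigma>\<close> is a constant multiple \<open>k \<sigma>\<close> of \<open>W id\<close>, with \<open>k id = 1\<close>.
  Hence for some exponent \<open>t\<close> the sum of the powers \<open>W \<sigma> ^ t\<close> is a nonzero constant times \<open>W id ^ t\<close>,
  and this sum is a polynomial in the inverse variable.
\<close>

lemma wronskian_family_subdegree:
  fixes m :: nat
  assumes fam: "\<And>j. j < m \<Longrightarrow> conj_family (\<phi> j)"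
    and bij: "bij_betw (\<lambda>j. \<phi> j idmap) {..<m} B" and indep: "fls_vs.independent B"
    and stable: "\<And>j \<sigma>. j < m \<Longrightarrow> \<sigma> \<in> selfmaps \<Longrightarrow> \<phi> j \<sigma> \<in> fls_vs.span B"
  shows "fls_subdegree (det (wronskian_mat D m (\<lambda>j. \<phi> j idmap))) \<le> 0"
proof -
  define W where "W \<sigma> = det (wronskian_mat D m (\<lambda>j. \<phi> j \<sigma>))" for \<sigma>
  have W_fam: "conj_family W"
    unfolding W_def wronskian_mat_def by (intro family_det family_D_power fam)
  have W0: "W idmap \<noteq> 0"
    unfolding W_def by (rule wronskian_independent_nonzero[OF bij indep])
  have "\<exists>k. W \<sigma> = fls_const k * W idmap" if \<sigma>: "\<sigma> \<in> selfmaps" for \<sigma>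
  proof -
    have "\<forall>j. \<exists>c. j < m \<longrightarrow> \<phi> j \<sigma> = (\<Sum>i<m. fls_const (c i) * \<phi> i idmap)"
      using span_enumeration_coords[OF bij stable[OF _ \<sigma>]] by blast
    then obtain c where "\<And>j. j < m \<Longrightarrow> \<phi> j \<sigma> = (\<Sum>i<m. fls_const (c j i) * \<phi> i idmap)"
      by metis
    then show ?thesis unfolding W_def by (rule wronskian_const_change)
  qed
  then obtain k where k: "\<And>\<sigma>. \<sigma> \<in> selfmaps \<Longrightarrow> W \<sigma> = fls_const (k \<sigma>) * W idmap" by metis
  have "fls_const (k idmap) = 1" using k[OF idmap_in] W0 by simp
  then have "k idmap = 1" by simp
  then obtain t where t: "t > 0" "(\<Sum>\<sigma>\<in>selfmaps. k \<sigma> ^ t) \<noteq> 0"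
    using exists_nonzero_power_sum[OF finite_selfmaps idmap_in] by blast
  have "(\<Sum>\<sigma>\<in>selfmaps. W \<sigma> ^ t) = fls_const (\<Sum>\<sigma>\<in>selfmaps. k \<sigma> ^ t) * W idmap ^ t"
  proof -
    interpret fc: comm_ring_hom "fls_const :: 'k \<Rightarrow> 'k fls" by (rule fls_const_hom)
    have "(\<Sum>\<sigma>\<in>selfmaps. W \<sigma> ^ t) = (\<Sum>\<sigma>\<in>selfmaps. fls_const (k \<sigma> ^ t) * W idmap ^ t)"
    proof (intro sum.cong refl)
      fix \<sigma> assume "\<sigma> \<in> selfmaps"
      from k[OF this] show "W \<sigma> ^ t = fls_const (k \<sigma> ^ t) * W idmap ^ t"
        by (simp only: power_mult_distrib fls_const_power)
    qed
    then show ?thesis by (simp only: fc.hom_sum sum_distrib_right)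
  qed
  moreover have "(\<Sum>\<sigma>\<in>selfmaps. W \<sigma> ^ t) \<in> nonpos_supp"
    by (intro sum_family family_power W_fam)
  ultimately have "fls_subdegree (fls_const (\<Sum>\<sigma>\<in>selfmaps. k \<sigma> ^ t) * W idmap ^ t) \<le> 0"
    using nonpos_supp_subdegree by metis
  then have "int t * fls_subdegree (W idmap) \<le> 0"
    using t(2) W0 by (simp add: fls_subdegree_pow)
  then show ?thesis using t(1) by (simp add: W_def mult_le_0_iff)
qed

text \<open>
  The Wronskian of any basis of the span of \<open>E\<close> has order at most \<open>0\<close>, since it is a constant multiple
  of the one in \<open>wronskian_family_subdegree\<close>. Applied to a basis that extends \<open>U\<close> by elements of \<open>E\<close>, this
  limits how small the elements of \<open>U\<close> can be.
\<close>

theorem wronskian_inequality: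
  fixes \<phi> :: "'i \<Rightarrow> (nat \<Rightarrow> nat) \<Rightarrow> 'k fls" and I :: "'i set" and u u' :: int
  defines "E \<equiv> (\<lambda>i. \<phi> i idmap) ` I"
  assumes I: "finite I" and fam: "\<And>i. i \<in> I \<Longrightarrow> conj_family (\<phi> i)"
    and stable: "\<And>i \<sigma>. i \<in> I \<Longrightarrow> \<sigma> \<in> selfmaps \<Longrightarrow> \<phi> i \<sigma> \<in> fls_vs.span E"
    and U: "U \<subseteq> fls_vs.span E" "fls_vs.independent U"
    and u': "\<And>x. x \<in> U \<Longrightarrow> ord_ge x u'" and u: "\<And>x. x \<in> E \<Longrightarrow> ord_ge x u"
  shows "int (card U) * u' + (int (fls_vs.dim E) - int (card U)) * u \<le> Delta_deg * (int (fls_vs.dim E))\<^sup>2"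
    and "card U \<le> fls_vs.dim E"
proof -
  obtain B where B: "B \<subseteq> E" "fls_vs.independent B" "E \<subseteq> fls_vs.span B" "card B = fls_vs.dim E"
    by (rule fls_vs.basis_exists)
  define m where "m = fls_vs.dim E"
  have "finite E" using I by (simp add: E_def)
  then have finB: "finite B" using B(1) finite_subset by blast
  then obtain g where g: "bij_betw g {..<m} B"
    using ex_bij_betw_nat_finite[OF finB] B(4) by (auto simp: m_def atLeast0LessThan)
  have "\<forall>j. \<exists>i. j < m \<longrightarrow> i \<in> I \<and> \<phi> i idmap = g j"
    using g B(1) by (fastforce simp: E_def bij_betw_def)
  then obtain ix where ix: "\<And>j. j < m \<Longrightarrow> ix j \<in> I \<and> \<phi> (ix j) idmap = g j" by metis
  have bij: "bij_betw (\<lambda>j. \<phi> (ix j) idmap) {..<m} B"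
    using g by (rule bij_betw_cong[THEN iffD1, rotated]) (simp add: ix)
  have spanE: "fls_vs.span E \<subseteq> fls_vs.span B"
    using B(3) by (simp add: fls_vs.span_minimal)
  have W: "fls_subdegree (det (wronskian_mat D m (\<lambda>j. \<phi> (ix j) idmap))) \<le> 0"
    using ix fam stable spanE by (intro wronskian_family_subdegree[where \<phi> = "\<lambda>j. \<phi> (ix j)", OF _ bij B(2)]) auto
  obtain Y where Y: "U \<subseteq> Y" "Y \<subseteq> U \<union> E" "fls_vs.independent Y" "U \<union> E \<subseteq> fls_vs.span Y"
    using fls_vs.maximal_independent_subset_extend[of U "U \<union> E"] U(2) by blast
  have YB: "Y \<subseteq> fls_vs.span B" using Y(2) U(1) spanE B(3) by blast
  have finY: "finite Y" "card Y \<le> m"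
    using fls_vs.independent_span_bound[OF finB Y(3) YB] by (auto simp: B(4) m_def)
  have "m \<le> card Y"
    using fls_vs.independent_span_bound[OF finY(1) B(2)] B(1) Y(4) by (auto simp: B(4)[symmetric] m_def)
  with finY have cardY: "card Y = m" by simp
  then obtain h where h: "bij_betw h {..<m} Y"
    using ex_bij_betw_nat_finite[OF finY(1)] by (auto simp: atLeast0LessThan)
  have "\<forall>j. \<exists>c. j < m \<longrightarrow> h j = (\<Sum>i<m. fls_const (c i) * \<phi> (ix i) idmap)"
  proof (intro allI)
    fix j
    show "\<exists>c. j < m \<longrightarrow> h j = (\<Sum>i<m. fls_const (c i) * \<phi> (ix i) idmap)"
    proof (cases "j < m")
      case True
      then have "h j \<in> fls_vs.span B" using h YB by (auto simp: bij_betw_def)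
      from span_enumeration_coords[OF bij this] show ?thesis by blast
    qed auto
  qed
  then obtain c where "\<And>j. j < m \<Longrightarrow> h j = (\<Sum>i<m. fls_const (c j i) * \<phi> (ix i) idmap)" by metis
  then obtain k where k:
    "det (wronskian_mat D m h) = fls_const k * det (wronskian_mat D m (\<lambda>j. \<phi> (ix j) idmap))"
    using wronskian_const_change by metis
  have nz: "det (wronskian_mat D m h) \<noteq> 0"
    by (rule wronskian_independent_nonzero[OF h Y(3)])
  then have "fls_subdegree (det (wronskian_mat D m h)) \<le> 0"
    using W by (auto simp: k)
  moreover define w where "w y = (if y \<in> U then u' else u)" for y
  have "ord_ge (h j) (w (h j))" if "j < m" for j
  proof -
    have "h j \<in> Y" using h that by (auto simp: bij_betw_def)
    then show ?thesis using Y(2) u u' by (auto simp: w_def)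
  qed
  from ord_ge_wronskian[of m h "\<lambda>j. w (h j)", OF this] nz
  have "(\<Sum>j<m. w (h j)) - Delta_deg * (int m)\<^sup>2 \<le> fls_subdegree (det (wronskian_mat D m h))"
    by (simp add: ord_ge_iff)
  moreover have "(\<Sum>j<m. w (h j)) = int (card U) * u' + (int m - int (card U)) * u"
  proof -
    have "(\<Sum>j<m. w (h j)) = (\<Sum>y\<in>Y. w y)" by (rule sum.reindex_bij_betw[OF h])
    also have "\<dots> = (\<Sum>y\<in>U. w y) + (\<Sum>y\<in>Y - U. w y)"
      using sum.subset_diff[OF Y(1) finY(1), of w] by simp
    also have "(\<Sum>y\<in>U. w y) = int (card U) * u'" by (simp add: w_def)
    also have "(\<Sum>y\<in>Y - U. w y) = int (card (Y - U)) * u" by (simp add: w_def)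
    also have "int (card (Y - U)) = int m - int (card U)"
      using card_mono[OF finY(1) Y(1)] card_Diff_subset[OF finite_subset[OF Y(1) finY(1)] Y(1)]
      by (simp add: cardY of_nat_diff)
    finally show ?thesis .
  qed
  ultimately show "int (card U) * u' + (int (fls_vs.dim E) - int (card U)) * u
      \<le> Delta_deg * (int (fls_vs.dim E))\<^sup>2"
    by (simp add: m_def)
  show "card U \<le> fls_vs.dim E" using card_mono[OF finY(1) Y(1)] by (simp add: cardY m_def)
qed

end

section \<open>The inequalities of Roth and Liouville\<close>

lemma span_mult_image: "x \<in> fls_vs.span B \<Longrightarrow> c * x \<in> fls_vs.span ((*) c ` B)"
proof (induction rule: fls_vs.span_induct_alt)
  case base
  then show ?case by (simp add: fls_vs.span_zero)
next
  case (step k x y)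
  have "c * (const_scale k x + y) = const_scale k (c * x) + c * y"
    by (simp add: const_scale_def algebra_simps)
  also have "\<dots> \<in> fls_vs.span ((*) c ` B)"
    using step by (intro fls_vs.span_add fls_vs.span_scale) (auto intro: fls_vs.span_base)
  finally show ?case .
qed

lemma independent_mult_image:
  assumes "fls_vs.independent B" "c \<noteq> 0"
  shows "fls_vs.independent ((*) c ` B)"
  unfolding fls_vs.independent_explicit_module
proof (intro allI impI)
  fix t u v assume t: "finite t" "t \<subseteq> (*) c ` B" "(\<Sum>v\<in>t. const_scale (u v) v) = 0" "v \<in> t"
  obtain t' where t': "t' \<subseteq> B" "t = (*) c ` t'" using t(2) by (meson subset_imageE)
  have inj: "inj_on ((*) c) t'" using assms(2) by (simp add: inj_on_def)
  have fin: "finite t'" using t(1) inj unfolding t'(2) by (rule finite_imageD)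
  have "c * (\<Sum>b\<in>t'. const_scale (u (c * b)) b) = 0"
    using t(3) unfolding t'(2) sum.reindex[OF inj]
    by (simp add: sum_distrib_left const_scale_def algebra_simps)
  then have "(\<Sum>b\<in>t'. const_scale (u (c * b)) b) = 0" using assms(2) by simp
  from fls_vs.independentD[OF assms(1) fin t'(1) this] show "u v = 0"
    using t(4) unfolding t'(2) by auto
qed

lemma independent_card_le_dim:
  assumes "finite E" "fls_vs.independent U" "U \<subseteq> fls_vs.span E"
  shows "card U \<le> fls_vs.dim E"
proof -
  obtain B where B: "B \<subseteq> E" "fls_vs.independent B" "E \<subseteq> fls_vs.span B" "card B = fls_vs.dim E"
    by (rule fls_vs.basis_exists)
  have "U \<subseteq> fls_vs.span B" using assms(3) fls_vs.span_minimal[OF B(3)] by auto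
  from fls_vs.independent_span_bound[OF _ assms(2) this] show ?thesis
    using B(1,4) assms(1) finite_subset by auto
qed

text \<open>
  If \<open>f\<close> grew by a factor \<open>1 + \<epsilon>\<close> in each of the first \<open>M\<close> steps, then
  \<open>(M choose (d + 1)) \<epsilon>\<^sup>d\<^sup>+\<^sup>1 \<le> (1 + \<epsilon>)\<^sup>M \<le> (M + 1)\<^sup>d\<close>, which fails once \<open>M\<close> exceeds a fixed multiple of
  \<open>\<epsilon>\<^sup>-\<^sup>(\<^sup>d\<^sup>+\<^sup>1\<^sup>)\<close>. This is what keeps the constant of Roth's inequality polynomial in \<open>1 / \<epsilon>\<close>.
\<close>

lemma slow_growth_step:
  fixes f :: "nat \<Rightarrow> nat" and \<epsilon> :: real
  assumes f0: "f 0 \<ge> 1" and f: "\<And>s. f s \<le> (s + 1) ^ d" and \<epsilon>: "0 < \<epsilon>" "\<epsilon> \<le> 1"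
  shows "\<exists>s. real (f (Suc s)) \<le> (1 + \<epsilon>) * f s \<and>
    real (s + 1) \<le> (2 ^ d * real (d + 1) ^ (d + 1) + 2) * (1 / \<epsilon>) ^ (d + 1)"
proof -
  \<comment> \<open>Large enough for the comparison of growth rates below to fail.\<close>
  define M where "M = nat \<lceil>2 ^ d * (real (d + 1) / \<epsilon>) ^ (d + 1)\<rceil> + 1"
  have M: "2 ^ d * (real (d + 1) / \<epsilon>) ^ (d + 1) < real M"
    unfolding M_def by linarith
  have "1 \<le> real (d + 1) / \<epsilon>"
  proof -
    have "\<epsilon> \<le> 1 + real d" using \<epsilon>(2) of_nat_0_le_iff[of d, where 'a = real] by linarith
    then have "1 * \<epsilon> \<le> real (d + 1)" by simp
    then show ?thesis using \<epsilon>(1) by (simp only: le_divide_eq_1_pos mult_1_left pos_le_divide_eq)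
  qed
  then have "real (d + 1) / \<epsilon> \<le> (real (d + 1) / \<epsilon>) ^ (d + 1)"
    by (rule self_le_power) simp
  moreover have "real (d + 1) \<le> real (d + 1) / \<epsilon>"
  proof -
    have "real (d + 1) * \<epsilon> \<le> real (d + 1) * 1" using \<epsilon> by (intro mult_left_mono) auto
    then show ?thesis using \<epsilon>(1) by (simp only: pos_le_divide_eq mult_1_right)
  qed
  moreover have "(real (d + 1) / \<epsilon>) ^ (d + 1) \<le> 2 ^ d * (real (d + 1) / \<epsilon>) ^ (d + 1)"
  proof -
    have "1 * x \<le> 2 ^ d * x" if "x \<ge> 0" for x :: real
      using that by (intro mult_right_mono) auto
    from this[of "(real (d + 1) / \<epsilon>) ^ (d + 1)"] show ?thesis using \<epsilon> by simp
  qed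
  ultimately have "real (d + 1) < real M" using M by linarith
  then have dM: "d + 1 \<le> M" by linarith
  have "\<exists>s<M. real (f (Suc s)) \<le> (1 + \<epsilon>) * f s"
  proof (rule ccontr)
    assume "\<not> ?thesis"
    then have step: "(1 + \<epsilon>) * f s < real (f (Suc s))" if "s < M" for s using that by auto
    have "(1 + \<epsilon>) ^ s \<le> real (f s)" if "s \<le> M" for s
      using that
    proof (induction s)
      case 0
      then show ?case using f0 by simp
    next
      case (Suc s)
      then have "(1 + \<epsilon>) * (1 + \<epsilon>) ^ s \<le> (1 + \<epsilon>) * f s"
        using \<epsilon> by (intro mult_left_mono) auto
      with step[of s] Suc.prems show ?case by simp
    qed
    then have "(1 + \<epsilon>) ^ M \<le> real (f M)" by simp
    also have "real (f M) \<le> real (M + 1) ^ d" using f[of M] by (metis of_nat_le_iff of_nat_power)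
    also have "\<dots> \<le> (2 * real M) ^ d" using dM by (intro power_mono) auto
    finally have up: "(1 + \<epsilon>) ^ M \<le> 2 ^ d * real M ^ d" by (simp add: power_mult_distrib)
    have "(real M / real (d + 1)) ^ (d + 1) * \<epsilon> ^ (d + 1) \<le> real (M choose (d + 1)) * \<epsilon> ^ (d + 1)"
      using binomial_ge_n_over_k_pow_k[OF dM, where 'a = real] \<epsilon> by (intro mult_right_mono) auto
    also have "\<dots> \<le> (\<Sum>k\<le>M. real (M choose k) * \<epsilon> ^ k)"
      using dM \<epsilon> by (intro member_le_sum[of "d + 1" "{..M}" "\<lambda>k. real (M choose k) * \<epsilon> ^ k"]) auto
    also have "\<dots> = (1 + \<epsilon>) ^ M"
      using binomial_ring[of \<epsilon> 1 M] by (simp add: add.commute)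
    finally have "(real M / real (d + 1)) ^ (d + 1) * \<epsilon> ^ (d + 1) \<le> 2 ^ d * real M ^ d"
      using up by linarith
    moreover have "(real M / real (d + 1)) ^ (d + 1) * \<epsilon> ^ (d + 1) =
        real M ^ (d + 1) / (real (d + 1) / \<epsilon>) ^ (d + 1)"
    proof -
      have "real M / real (d + 1) * \<epsilon> = real M / (real (d + 1) / \<epsilon>)" by simp
      then show ?thesis by (simp only: power_mult_distrib[symmetric] power_divide[symmetric])
    qed
    ultimately have "real M ^ (d + 1) / (real (d + 1) / \<epsilon>) ^ (d + 1) \<le> 2 ^ d * real M ^ d" by simp
    moreover have "(real (d + 1) / \<epsilon>) ^ (d + 1) > 0" using \<epsilon> by (intro zero_less_power) simp
    ultimately have "real M ^ (d + 1) \<le> 2 ^ d * real M ^ d * (real (d + 1) / \<epsilon>) ^ (d + 1)"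
      by (simp only: pos_divide_le_eq)
    then have "real M * real M ^ d \<le> 2 ^ d * (real (d + 1) / \<epsilon>) ^ (d + 1) * real M ^ d"
      by (simp only: Suc_eq_plus1[symmetric] power_Suc mult_ac)
    moreover have "real M ^ d > 0" using dM by simp
    ultimately have "real M \<le> 2 ^ d * (real (d + 1) / \<epsilon>) ^ (d + 1)"
      by (simp only: mult_le_cancel_right_pos)
    with M show False by linarith
  qed
  then obtain s where s: "s < M" "real (f (Suc s)) \<le> (1 + \<epsilon>) * f s" by blast
  have "real (s + 1) \<le> 2 ^ d * (real (d + 1) / \<epsilon>) ^ (d + 1) + 2"
    using s(1) \<epsilon> unfolding M_def by (simp add: nat_less_real_le) linarith
  also have "\<dots> \<le> (2 ^ d * real (d + 1) ^ (d + 1) + 2) * (1 / \<epsilon>) ^ (d + 1)"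
  proof -
    have "1 \<le> (1 / \<epsilon>) ^ (d + 1)" using \<epsilon> by (intro one_le_power) auto
    then have "2 \<le> 2 * (1 / \<epsilon>) ^ (d + 1)" by linarith
    moreover have "(real (d + 1) / \<epsilon>) ^ (d + 1) = real (d + 1) ^ (d + 1) * (1 / \<epsilon>) ^ (d + 1)"
      by (simp add: power_divide)
    ultimately show ?thesis
      by (simp only: distrib_right mult.assoc add_left_mono)
  qed
  finally show ?thesis using s(2) by blast
qed

context conjugates
begin

text \<open>
  Bounding the total degree, unlike bounding the degree in each root, is compatible with
  substitutions that identify roots.
\<close>

definition exps :: "nat \<Rightarrow> (nat \<Rightarrow> nat) set" where
  "exps s = {e \<in> {..<d} \<rightarrow>\<^sub>E {..s}. (\<Sum>i<d. e i) \<le> s}"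

definition mon :: "(nat \<Rightarrow> nat) \<Rightarrow> (nat \<Rightarrow> nat) \<Rightarrow> 'k fls" where
  "mon e \<sigma> = (\<Prod>i<d. \<rho> (\<sigma> i) ^ e i)"

definition mons :: "nat \<Rightarrow> 'k fls set" where
  "mons s = (\<lambda>e. mon e idmap) ` exps s"

definition root_size :: int where "root_size = (\<Sum>i<d. \<bar>fls_subdegree (\<rho> i)\<bar>)"

lemma root_size_nonneg: "root_size \<ge> 0"
  by (simp add: root_size_def sum_nonneg)

lemma ord_ge_root: "i < d \<Longrightarrow> ord_ge (\<rho> i) (- root_size)"
proof -
  assume "i < d"
  then have "\<bar>fls_subdegree (\<rho> i)\<bar> \<le> root_size"
    unfolding root_size_def by (intro member_le_sum) auto
  then show ?thesis by (intro ord_ge_mono[OF ord_ge_subdegree]) auto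
qed

lemma finite_exps [simp]: "finite (exps s)"
  unfolding exps_def by (rule finite_subset[of _ "{..<d} \<rightarrow>\<^sub>E {..s}"]) (auto simp: finite_PiE)

lemma card_exps: "card (exps s) \<le> (s + 1) ^ d"
proof -
  have "card (exps s) \<le> card ({..<d} \<rightarrow>\<^sub>E {..s})"
    unfolding exps_def by (intro card_mono finite_PiE) auto
  also have "\<dots> = (s + 1) ^ d" by (simp add: card_PiE)
  finally show ?thesis .
qed

lemma mon_idmap: "mon e idmap = (\<Prod>i<d. \<rho> i ^ e i)"
  by (simp add: mon_def)

lemma conj_family_mon: "conj_family (mon e)"
  unfolding mon_def by (intro family_prod family_power family_root) auto

lemma exps_restrict: "(\<Sum>i<d. e i) \<le> s \<Longrightarrow> restrict e {..<d} \<in> exps s"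
proof -
  assume s: "(\<Sum>i<d. e i) \<le> s"
  have "e i \<le> s" if "i < d" for i
    using member_le_sum[of i "{..<d}" e] that s by auto
  then show ?thesis using s by (auto simp: exps_def)
qed

lemma mon_in_mons: "(\<Sum>i<d. e i) \<le> s \<Longrightarrow> (\<Prod>i<d. \<rho> i ^ e i) \<in> mons s"
  unfolding mons_def
  by (rule image_eqI[of _ _ "restrict e {..<d}"]) (auto simp: mon_idmap exps_restrict)

lemma mon_selfmap:
  assumes "e \<in> exps s" "\<sigma> \<in> selfmaps"
  shows "mon e \<sigma> \<in> mons s"
proof -
  define e' where "e' j = (\<Sum>i\<in>{i. i \<in> {..<d} \<and> \<sigma> i = j}. e i)" for j
  have sub: "\<sigma> ` {..<d} \<subseteq> {..<d}" using selfmaps_less[OF assms(2)] by auto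
  have "mon e \<sigma> = (\<Prod>j<d. \<Prod>i\<in>{i. i \<in> {..<d} \<and> \<sigma> i = j}. \<rho> (\<sigma> i) ^ e i)"
    unfolding mon_def using prod.group[OF _ _ sub, of "\<lambda>i. \<rho> (\<sigma> i) ^ e i"] by simp
  also have "\<dots> = (\<Prod>j<d. \<rho> j ^ e' j)"
    by (intro prod.cong refl) (simp add: e'_def power_sum)
  finally have "mon e \<sigma> = (\<Prod>j<d. \<rho> j ^ e' j)" .
  moreover have "(\<Sum>j<d. e' j) = (\<Sum>i<d. e i)"
    unfolding e'_def by (rule sum.group[OF _ _ sub]) auto
  ultimately show ?thesis using assms(1) mon_in_mons[of e' s] by (simp add: exps_def)
qed

lemma root_mult_mon:
  assumes "0 < d" "b \<in> mons s"
  shows "\<rho> 0 * b \<in> mons (Suc s)"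
proof -
  obtain e where e: "b = (\<Prod>i<d. \<rho> i ^ e i)" "(\<Sum>i<d. e i) \<le> s"
    using assms(2) by (auto simp: mons_def mon_idmap exps_def)
  have "(\<Sum>i<d. (e(0 := Suc (e 0))) i) = Suc (\<Sum>i<d. e i)"
    using assms(1) by (simp add: sum.remove[of "{..<d}" 0])
  moreover have "(\<Prod>i<d. \<rho> i ^ (e(0 := Suc (e 0))) i) = \<rho> 0 * b"
    using assms(1) by (simp add: e(1) prod.remove[of "{..<d}" 0])
  ultimately show ?thesis
    using mon_in_mons[of "e(0 := Suc (e 0))" "Suc s"] e(2) by (simp del: fun_upd_apply)
qed

lemma finite_mons [simp]: "finite (mons s)"
  by (simp add: mons_def)

lemma dim_mons_le: "fls_vs.dim (mons s) \<le> (s + 1) ^ d"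
proof -
  have "fls_vs.dim (mons s) \<le> card (mons s)"
    by (rule fls_vs.dim_le_card) (auto intro: fls_vs.span_base)
  also have "\<dots> \<le> card (exps s)" unfolding mons_def by (rule card_image_le) simp
  finally show ?thesis using card_exps[of s] by linarith
qed

lemma dim_mons_pos: "fls_vs.dim (mons s) \<ge> 1"
proof -
  have "1 \<in> mons s" using mon_in_mons[of "\<lambda>_. 0" s] by simp
  then have "card {1 :: 'k fls} \<le> fls_vs.dim (mons s)"
    by (intro independent_card_le_dim) (auto intro: fls_vs.span_base)
  then show ?thesis by simp
qed

lemma ord_ge_mons:
  assumes "b \<in> mons s"
  shows "ord_ge b (- (int s * root_size))"
proof -
  obtain e where e: "b = (\<Prod>i<d. \<rho> i ^ e i)" "(\<Sum>i<d. e i) \<le> s"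
    using assms by (auto simp: mons_def mon_idmap exps_def)
  have "ord_ge b (\<Sum>i<d. int (e i) * - root_size)"
    unfolding e(1) by (intro ord_ge_prod ord_ge_power ord_ge_root) auto
  moreover have "(\<Sum>i<d. int (e i) * - root_size) = - (int (\<Sum>i<d. e i) * root_size)"
    by (simp add: sum_distrib_right sum_negf)
  moreover have "int (\<Sum>i<d. e i) * root_size \<le> int s * root_size"
    using e(2) root_size_nonneg by (intro mult_right_mono) linarith+
  ultimately show ?thesis by (auto intro: ord_ge_mono)
qed

text \<open>
  The Wronskian inequality for \<open>q V\<^sub>s\<^sub>+\<^sub>1 + p V\<^sub>s\<close> and its subspace \<open>(p - q \<rho>\<^sub>0) V\<^sub>s\<close>, where \<open>V\<^sub>s\<close> is spanned by
  \<open>mons s\<close>. The sum of \<open>q V\<^sub>s\<^sub>+\<^sub>1\<close> and \<open>p V\<^sub>s\<close> need not be direct, as a smaller dimension only improves the bound.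
\<close>

lemma approximation_bound:
  fixes s :: nat
  defines "k \<equiv> int (fls_vs.dim (mons (Suc s)))" and "l \<equiv> int (fls_vs.dim (mons s))"
  assumes d: "0 < d" and pq: "p \<in> nonpos_supp" "q \<in> nonpos_supp" "q \<noteq> 0"
    and ne: "p - q * \<rho> 0 \<noteq> 0"
  shows "l * fls_subdegree (p - q * \<rho> 0) \<le>
    k * (- fls_subdegree q) + (k + l) * root_size * (int s + 1) + Delta_deg * (k + l)\<^sup>2"
proof (cases "fls_subdegree (p - q * \<rho> 0) < fls_subdegree q - root_size")
  case True
  \<comment> \<open>The left side is not positive; in the other case \<open>p\<close> is bounded in terms of \<open>q\<close>.\<close>
  have "fls_subdegree q \<le> 0" by (rule nonpos_supp_subdegree[OF pq(2)])
  then have "l * fls_subdegree (p - q * \<rho> 0) \<le> 0"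
    using True root_size_nonneg by (intro mult_nonneg_nonpos) (auto simp: l_def)
  moreover have "0 \<le> k * (- fls_subdegree q) + (k + l) * root_size * (int s + 1) + Delta_deg * (k + l)\<^sup>2"
    using \<open>fls_subdegree q \<le> 0\<close> root_size_nonneg Delta_deg_nonneg
    by (intro add_nonneg_nonneg mult_nonneg_nonneg) (auto simp: k_def l_def)
  ultimately show ?thesis by linarith
next
  case False
  define Dq where "Dq = - fls_subdegree q"
  define v where "v = fls_subdegree (p - q * \<rho> 0)"
  have Dq: "Dq \<ge> 0" using nonpos_supp_subdegree[OF pq(2)] by (simp add: Dq_def)
  have oq: "ord_ge q (- Dq)" by (simp add: Dq_def)
  have ov: "ord_ge (p - q * \<rho> 0) v" by (simp add: v_def)
  have op: "ord_ge p (- (Dq + root_size))"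
  proof -
    have "ord_ge (p - q * \<rho> 0) (- (Dq + root_size))"
      using False by (intro ord_ge_mono[OF ov]) (simp add: v_def Dq_def)
    moreover have "ord_ge (q * \<rho> 0) (- (Dq + root_size))"
      using ord_ge_mult[OF oq ord_ge_root[OF d]] by simp
    ultimately show ?thesis using ord_ge_add by fastforce
  qed
  define I where "I = exps (Suc s) <+> exps s"
  define \<phi> where "\<phi> = (\<lambda>x \<sigma>. case x of Inl e \<Rightarrow> q * mon e \<sigma> | Inr e \<Rightarrow> p * mon e \<sigma>)"
  define E where "E = (\<lambda>i. \<phi> i idmap) ` I"
  have E: "E = (*) q ` mons (Suc s) \<union> (*) p ` mons s"
    unfolding E_def I_def Plus_def image_Un image_image by (simp add: \<phi>_def mons_def image_image)
  obtain B1 where B1: "B1 \<subseteq> mons (Suc s)" "fls_vs.independent B1" "mons (Suc s) \<subseteq> fls_vs.span B1"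
      "card B1 = fls_vs.dim (mons (Suc s))"
    by (rule fls_vs.basis_exists)
  obtain B where B: "B \<subseteq> mons s" "fls_vs.independent B" "mons s \<subseteq> fls_vs.span B"
      "card B = fls_vs.dim (mons s)"
    by (rule fls_vs.basis_exists)
  have fin: "finite B1" "finite B" using B1(1) B(1) finite_subset[OF _ finite_mons] by auto
  define U where "U = (*) (p - q * \<rho> 0) ` B"
  have "inj_on ((*) (p - q * \<rho> 0)) B" using ne by (simp add: inj_on_def)
  then have cardU: "int (card U) = l" by (simp add: U_def card_image B(4) l_def)
  have "E \<subseteq> fls_vs.span ((*) q ` B1 \<union> (*) p ` B)"
    unfolding E
  proof (intro Un_least image_subsetI)
    show "q * x \<in> fls_vs.span ((*) q ` B1 \<union> (*) p ` B)" if "x \<in> mons (Suc s)" for x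
      using span_mult_image[of x B1 q] fls_vs.span_mono[of "(*) q ` B1" "(*) q ` B1 \<union> (*) p ` B"]
        that B1(3) by blast
    show "p * x \<in> fls_vs.span ((*) q ` B1 \<union> (*) p ` B)" if "x \<in> mons s" for x
      using span_mult_image[of x B p] fls_vs.span_mono[of "(*) p ` B" "(*) q ` B1 \<union> (*) p ` B"]
        that B(3) by blast
  qed
  then have "fls_vs.dim E \<le> card ((*) q ` B1 \<union> (*) p ` B)"
    by (rule fls_vs.dim_le_card) (use fin in auto)
  also have "\<dots> \<le> card ((*) q ` B1) + card ((*) p ` B)" by (rule card_Un_le)
  also have "\<dots> \<le> card B1 + card B" by (intro add_mono card_image_le fin)
  finally have dimE: "int (fls_vs.dim E) \<le> k + l" by (simp add: k_def l_def B1(4) B(4))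
  have stable: "\<phi> i \<sigma> \<in> E" if "i \<in> I" "\<sigma> \<in> selfmaps" for i \<sigma>
    using that mon_selfmap unfolding E by (auto simp: I_def \<phi>_def)
  have Ui: "fls_vs.independent U"
    unfolding U_def by (rule independent_mult_image[OF B(2) ne])
  have UE: "U \<subseteq> fls_vs.span E"
  proof
    fix x assume "x \<in> U"
    then obtain b where b: "b \<in> mons s" "x = (p - q * \<rho> 0) * b" using B(1) by (auto simp: U_def)
    have "x = p * b - q * (\<rho> 0 * b)" by (simp add: b(2) algebra_simps)
    also have "\<dots> \<in> fls_vs.span E"
      using b(1) root_mult_mon[OF d b(1)] unfolding E
      by (intro fls_vs.span_diff) (auto intro: fls_vs.span_base)
    finally show "x \<in> fls_vs.span E" .
  qed
  have fam: "conj_family (\<phi> i)" if "i \<in> I" for i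
  proof (cases i)
    case (Inl e)
    then show ?thesis using family_scale[OF conj_family_mon pq(2)] by (simp add: \<phi>_def)
  next
    case (Inr e)
    then show ?thesis using family_scale[OF conj_family_mon pq(1)] by (simp add: \<phi>_def)
  qed
  have oU: "ord_ge x (v - int s * root_size)" if "x \<in> U" for x
    using that ord_ge_mult[OF ov ord_ge_mons[of _ s]] B(1) by (auto simp: U_def)
  have oE: "ord_ge x (- (Dq + (int s + 1) * root_size))" if "x \<in> E" for x
    using that ord_ge_mult[OF oq ord_ge_mons[of _ "Suc s"]] ord_ge_mult[OF op ord_ge_mons[of _ s]]
    unfolding E by (auto simp: algebra_simps)
  have "finite I" by (simp add: I_def)
  note W = wronskian_inequality[OF this, of \<phi> U "v - int s * root_size" "- (Dq + (int s + 1) * root_size)",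
      folded E_def, OF fam fls_vs.span_base[OF stable] UE Ui oU oE]
  define m where "m = int (fls_vs.dim E)"
  have m: "l \<le> m" "m \<le> k + l" using W(2) dimE by (simp_all add: m_def flip: cardU)
  have l0: "l \<ge> 0" "k \<ge> 0" by (simp_all add: l_def k_def)
  define u where "u = Dq + (int s + 1) * root_size"
  have u0: "u \<ge> 0" using Dq root_size_nonneg by (simp add: u_def)
  have "l * (v - int s * root_size) - (m - l) * u \<le> Delta_deg * m\<^sup>2"
    using W(1) by (simp add: cardU m_def u_def algebra_simps)
  moreover have "(m - l) * u \<le> k * u" using m u0 by (intro mult_right_mono) auto
  moreover have "Delta_deg * m\<^sup>2 \<le> Delta_deg * (k + l)\<^sup>2"
    using m l0 Delta_deg_nonneg by (intro mult_left_mono power_mono) auto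
  moreover have "l * (int s * root_size) \<le> l * ((int s + 1) * root_size)"
    using l0 root_size_nonneg by (intro mult_left_mono mult_right_mono) auto
  ultimately have "l * v \<le> k * u + l * ((int s + 1) * root_size) + Delta_deg * (k + l)\<^sup>2"
    by (simp add: right_diff_distrib)
  then show ?thesis by (simp add: u_def v_def Dq_def algebra_simps)
qed

text \<open>
  The polynomial dependence of the error term on \<open>1 / \<epsilon>\<close> is essential for \<open>log_denominator_growth\<close>, which
  lets \<open>\<epsilon>\<close> tend to \<open>0\<close>.
\<close>

theorem effective_roth:
  assumes d: "0 < d"
  shows "\<exists>A::real\<ge>0. \<exists>b::nat. \<forall>\<epsilon>::real. 0 < \<epsilon> \<longrightarrow> \<epsilon> \<le> 1 \<longrightarrow>
    (\<forall>p\<in>nonpos_supp. \<forall>q\<in>nonpos_supp. q \<noteq> 0 \<longrightarrow> p - q * \<rho> 0 \<noteq> 0 \<longrightarrow>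
      fls_subdegree (p - q * \<rho> 0) \<le> (1 + \<epsilon>) * (- fls_subdegree q) + A * (1 / \<epsilon>) ^ b)"
proof -
  define K where "K = 2 ^ d * real (d + 1) ^ (d + 1) + 2"
  define A where "A = (3 * root_size + 9 * Delta_deg) * K ^ d"
  have K1: "K \<ge> 1" by (simp add: K_def add_increasing)
  have A: "A \<ge> 0" using root_size_nonneg Delta_deg_nonneg K1 by (simp add: A_def)
  show ?thesis
  proof (intro exI[of _ A] exI[of _ "(d + 1) * d"] conjI A allI impI ballI)
    fix \<epsilon> :: real and p q
    assume \<epsilon>: "0 < \<epsilon>" "\<epsilon> \<le> 1" and pq: "p \<in> nonpos_supp" "q \<in> nonpos_supp" "q \<noteq> 0"
      and ne: "p - q * \<rho> 0 \<noteq> 0"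
    define f where "f s = fls_vs.dim (mons s)" for s
    obtain s where s: "real (f (Suc s)) \<le> (1 + \<epsilon>) * f s" "real (s + 1) \<le> K * (1 / \<epsilon>) ^ (d + 1)"
      using slow_growth_step[of f d \<epsilon>] dim_mons_pos[of 0] dim_mons_le \<epsilon>
      unfolding f_def K_def by blast
    define l k v D where "l = real (f s)" and "k = real (f (Suc s))"
      and "v = real_of_int (fls_subdegree (p - q * \<rho> 0))" and "D = real_of_int (- fls_subdegree q)"
    have l: "1 \<le> l" "l \<le> real (s + 1) ^ d"
      using dim_mons_pos[of s] dim_mons_le[of s]
      by (simp_all add: l_def f_def flip: of_nat_power) (metis of_nat_le_iff of_nat_Suc of_nat_power)
    have kl: "k \<le> (1 + \<epsilon>) * l" using s(1) by (simp add: k_def l_def)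
    have D0: "D \<ge> 0" using nonpos_supp_subdegree[OF pq(2)] by (simp add: D_def)
    have "real_of_int (int (f s) * fls_subdegree (p - q * \<rho> 0)) \<le> real_of_int (int (f (Suc s)) * (- fls_subdegree q) +
        (int (f (Suc s)) + int (f s)) * root_size * (int s + 1) + Delta_deg * (int (f (Suc s)) + int (f s))\<^sup>2)"
      using approximation_bound[OF d pq ne, of s] unfolding f_def of_int_le_iff .
    then have "l * v \<le> k * D + (k + l) * root_size * (real s + 1) + Delta_deg * (k + l)\<^sup>2"
      by (simp add: l_def k_def v_def D_def)
    also have "\<dots> \<le> ((1 + \<epsilon>) * l) * D + (3 * l) * root_size * (real s + 1) + Delta_deg * (3 * l)\<^sup>2"
    proof -
      have "(1 + \<epsilon>) * l \<le> 2 * l" using \<epsilon> l(1) by (intro mult_right_mono) auto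
      then have "k + l \<le> 3 * l" using kl by simp
      then show ?thesis using kl D0 root_size_nonneg Delta_deg_nonneg l(1)
        by (intro add_mono mult_right_mono mult_left_mono power_mono) (auto simp: k_def)
    qed
    also have "\<dots> = l * ((1 + \<epsilon>) * D + 3 * root_size * (real s + 1) + 9 * Delta_deg * l)"
      by (simp add: algebra_simps power2_eq_square)
    finally have "v \<le> (1 + \<epsilon>) * D + 3 * root_size * (real s + 1) + 9 * Delta_deg * l"
      using l(1) by (simp only: mult_le_cancel_left_pos)
    also have "\<dots> \<le> (1 + \<epsilon>) * D + 3 * root_size * real (s + 1) ^ d + 9 * Delta_deg * real (s + 1) ^ d"
      using \<epsilon> root_size_nonneg Delta_deg_nonneg l(2) d self_le_power[of "real (s + 1)" d]
      by (intro add_mono mult_left_mono) (auto simp: add.commute)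
    also have "\<dots> = (1 + \<epsilon>) * D + (3 * root_size + 9 * Delta_deg) * real (s + 1) ^ d"
      by (simp add: algebra_simps)
    also have "\<dots> \<le> (1 + \<epsilon>) * D + (3 * root_size + 9 * Delta_deg) * (K * (1 / \<epsilon>) ^ (d + 1)) ^ d"
      using s(2) root_size_nonneg Delta_deg_nonneg by (intro add_left_mono mult_left_mono power_mono) auto
    also have "\<dots> = (1 + \<epsilon>) * D + A * (1 / \<epsilon>) ^ ((d + 1) * d)"
      by (simp only: power_mult_distrib A_def mult.assoc power_mult)
    finally show "fls_subdegree (p - q * \<rho> 0) \<le>
        (1 + \<epsilon>) * (- fls_subdegree q) + A * (1 / \<epsilon>) ^ ((d + 1) * d)"
      by (simp add: v_def D_def)
  qed
qed

text \<open>
  The Wronskian inequality for the span of the conjugate values \<open>Q(\<rho>\<^sub>i)\<close> and its element \<open>Q(\<rho>\<^sub>0)\<close>; the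
  trivial lower bound for the orders of the other values suffices.
\<close>

theorem liouville:
  assumes d: "0 < d" and Q: "\<And>j. coeff Q j \<in> nonpos_supp" "degree Q \<le> 2"
    and h: "\<And>j. ord_ge (coeff Q j) (- h)" "h \<ge> 0" and ne: "poly Q (\<rho> 0) \<noteq> 0"
  shows "fls_subdegree (poly Q (\<rho> 0)) \<le> int (d - 1) * (h + 2 * root_size) + Delta_deg * (int d)\<^sup>2"
proof -
  define \<phi> where "\<phi> i \<sigma> = poly Q (\<rho> (\<sigma> i))" for i and \<sigma> :: "nat \<Rightarrow> nat"
  define E where "E = (\<lambda>i. \<phi> i idmap) ` {..<d}"
  have E: "E = (\<lambda>i. poly Q (\<rho> i)) ` {..<d}" by (simp add: E_def \<phi>_def)
  have QE: "poly Q (\<rho> i) \<in> E" if "i < d" for i using that by (simp add: E)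
  have oQ: "ord_ge x (- (h + 2 * root_size))" if x: "x \<in> E" for x
  proof -
    obtain i where i: "i < d" "x = poly Q (\<rho> i)" using x by (auto simp: E)
    have "ord_ge (coeff Q j * \<rho> i ^ j) (- (h + 2 * root_size))" if "j \<le> degree Q" for j
    proof -
      have "ord_ge (coeff Q j * \<rho> i ^ j) (- h + int j * - root_size)"
        by (intro ord_ge_mult h ord_ge_power ord_ge_root i)
      moreover have "int j * root_size \<le> 2 * root_size" using that Q(2) root_size_nonneg by (intro mult_right_mono) auto
      ultimately show ?thesis by (auto intro: ord_ge_mono)
    qed
    then show ?thesis unfolding i(2) poly_altdef by (intro ord_ge_sum) auto
  qed
  have "poly Q (\<rho> 0) \<in> E" using QE d by simp
  note W = wronskian_inequality[of "{..<d}" \<phi> "{poly Q (\<rho> 0)}" "fls_subdegree (poly Q (\<rho> 0))"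
      "- (h + 2 * root_size)", folded E_def]
  have st: "\<phi> i \<sigma> \<in> fls_vs.span E" if "i \<in> {..<d}" "\<sigma> \<in> selfmaps" for i \<sigma>
    using QE[OF selfmaps_less[OF that(2)]] that(1) by (auto simp: \<phi>_def intro: fls_vs.span_base)
  have fam: "conj_family (\<phi> i)" if "i \<in> {..<d}" for i
    unfolding \<phi>_def using that Q(1) by (intro family_poly) auto
  have U: "{poly Q (\<rho> 0)} \<subseteq> fls_vs.span E" "fls_vs.independent {poly Q (\<rho> 0)}"
    using \<open>poly Q (\<rho> 0) \<in> E\<close> ne by (auto intro: fls_vs.span_base)
  have oU: "ord_ge x (fls_subdegree (poly Q (\<rho> 0)))" if "x \<in> {poly Q (\<rho> 0)}" for x
    using that by simp
  note W' = W[OF finite_lessThan fam st U oU oQ]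
  have "fls_vs.dim E \<le> card E"
    by (rule fls_vs.dim_le_card[OF fls_vs.span_superset]) (simp add: E_def)
  also have "\<dots> \<le> d" using card_image_le[of "{..<d}" "\<lambda>i. \<phi> i idmap"] by (simp add: E_def)
  finally have m: "fls_vs.dim E \<le> d" .
  define m where "m = int (fls_vs.dim E)"
  have mm: "1 \<le> m" "m \<le> int d" using W' m by (auto simp: m_def)
  have "fls_subdegree (poly Q (\<rho> 0)) \<le> (m - 1) * (h + 2 * root_size) + Delta_deg * m\<^sup>2"
    using W' by (simp add: m_def algebra_simps)
  also have "\<dots> \<le> int (d - 1) * (h + 2 * root_size) + Delta_deg * (int d)\<^sup>2"
    using mm h(2) root_size_nonneg Delta_deg_nonneg
    by (intro add_mono mult_right_mono mult_left_mono power_mono) auto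
  finally show ?thesis .
qed

end

section \<open>Hensel's lemma and Puiseux expansions\<close>

lemma bezout_linear_power:
  fixes h :: "'k::field poly"
  assumes "poly h a \<noteq> 0"
  shows "\<exists>s t. s * [:- a, 1:] ^ m + t * h = 1"
proof (induction m)
  case 0
  show ?case by (intro exI[of _ 1] exI[of _ 0]) simp
next
  case (Suc m)
  then obtain s t where st: "s * [:- a, 1:] ^ m + t * h = 1" by blast
  have "[:- a, 1:] dvd h - [:poly h a:]" by (simp add: poly_eq_0_iff_dvd[symmetric])
  then obtain u where "h - [:poly h a:] = [:- a, 1:] * u" by (elim dvdE)
  then have u: "h - [:- a, 1:] * u = [:poly h a:]" by (simp add: algebra_simps)
  define c where "c = [:1 / poly h a:]"
  have "c * h - c * u * [:- a, 1:] = c * (h - [:- a, 1:] * u)" by (simp only: algebra_simps)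
  also have "\<dots> = 1" unfolding u c_def using assms by (simp add: one_pCons)
  finally have 1: "c * h - c * u * [:- a, 1:] = 1" .
  have "(- c * u * s) * x ^ Suc m + (c * (s * x ^ m + t * h) - c * u * x * t) * h
      = (c * h - c * u * x) * (s * x ^ m + t * h)" for x
    by (simp add: algebra_simps)
  from this[of "[:- a, 1:]"] have "(- c * u * s) * [:- a, 1:] ^ Suc m +
      (c * (s * [:- a, 1:] ^ m + t * h) - c * u * [:- a, 1:] * t) * h = 1"
    unfolding 1 st by (simp only: mult_1_left)
  then show ?case by blast
qed

lemma split_low_degree:
  fixes g h r s t :: "'k::field poly"
  assumes st: "s * g + t * h = 1" and g: "degree g > 0" and h: "degree h > 0"
    and r: "degree r < degree g + degree h"
  shows "\<exists>a b. degree a < degree g \<and> degree b < degree h \<and> r = g * b + a * h"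
proof -
  define a where "a = (r * t) mod g"
  define b where "b = r * s + h * ((r * t) div g)"
  have g0: "g \<noteq> 0" using g by auto
  have a: "degree a < degree g"
    using degree_mod_less[OF g0, of "r * t"] g by (auto simp: a_def)
  have rt: "g * ((r * t) div g) + a = r * t" by (simp add: a_def)
  have "g * b + a * h = r * s * g + h * (g * ((r * t) div g) + a)"
    by (simp add: b_def algebra_simps)
  also have "\<dots> = r * (s * g + t * h)" unfolding rt by (simp add: algebra_simps)
  finally have "g * b + a * h = r * (s * g + t * h)" .
  then have eq: "r = g * b + a * h" by (simp add: st)
  have "degree b < degree h"
  proof (cases "b = 0")
    case False
    have "degree (a * h) < degree g + degree h"
      using degree_mult_le[of a h] a by linarith
    moreover have "g * b = r - a * h" using eq by simp
    ultimately have "degree (g * b) < degree g + degree h"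
      using r by (simp add: degree_diff_less)
    then show ?thesis using False g0 by (simp add: degree_mult_eq)
  qed (use h in simp)
  with a eq show ?thesis by blast
qed

text \<open>
  Coefficients with respect to the variable of the power series are compared one by one: the new
  terms \<open>A n\<close> and \<open>B n\<close> have to solve \<open>g B\<^sub>n + A\<^sub>n h = R\<close>, where \<open>R\<close> depends on earlier terms only.
\<close>

lemma hensel_sequence:
  fixes g h :: "'k::field poly" and q :: "nat \<Rightarrow> 'k poly"
  assumes st: "s * g + t * h = 1" and g: "degree g > 0" and h: "degree h > 0"
    and q0: "q 0 = g * h" and q: "\<And>j. j > 0 \<Longrightarrow> degree (q j) < degree g + degree h"
  shows "\<exists>A B. A 0 = g \<and> B 0 = h \<and> (\<forall>j>0. degree (A j) < degree g \<and> degree (B j) < degree h)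
    \<and> (\<forall>j. q j = (\<Sum>i\<le>j. A i * B (j - i)))"
proof -
  define P where "P f n r \<longleftrightarrow> (n = 0 \<longrightarrow> r = (g, h)) \<and>
    (n > 0 \<longrightarrow> degree (fst r) < degree g \<and> degree (snd r) < degree h \<and>
      q n = g * snd r + fst r * h + (\<Sum>i\<in>{0<..<n}. fst (f i) * snd (f (n - i))))"
    for f :: "nat \<Rightarrow> 'k poly \<times> 'k poly" and n r
  have "\<exists>f. \<forall>n. P f n (f n)"
  proof (rule dependent_wellorder_choice)
    fix r and f f' :: "nat \<Rightarrow> 'k poly \<times> 'k poly" and n :: nat
    assume "\<And>y. y < n \<Longrightarrow> f y = f' y"
    then have "(\<Sum>i\<in>{0<..<n}. fst (f i) * snd (f (n - i))) = (\<Sum>i\<in>{0<..<n}. fst (f' i) * snd (f' (n - i)))"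
      by (intro sum.cong) auto
    then show "P f n r = P f' n r" by (simp add: P_def)
  next
    fix n :: nat and f :: "nat \<Rightarrow> 'k poly \<times> 'k poly"
    assume IH: "\<And>y. y < n \<Longrightarrow> P f y (f y)"
    show "\<exists>r. P f n r"
    proof (cases "n = 0")
      case False
      define R where "R = q n - (\<Sum>i\<in>{0<..<n}. fst (f i) * snd (f (n - i)))"
      have "degree (fst (f i) * snd (f (n - i))) < degree g + degree h" if "i \<in> {0<..<n}" for i
      proof -
        have "degree (fst (f i)) < degree g" "degree (snd (f (n - i))) < degree h"
          using IH[of i] IH[of "n - i"] that by (auto simp: P_def)
        then show ?thesis using degree_mult_le[of "fst (f i)" "snd (f (n - i))"] by linarith
      qed
      then have "degree (\<Sum>i\<in>{0<..<n}. fst (f i) * snd (f (n - i))) < degree g + degree h"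
        using g by (intro degree_sum_less) auto
      then have "degree R < degree g + degree h"
        using q[of n] False by (simp add: R_def degree_diff_less)
      from split_low_degree[OF st g h this] obtain a b
        where "degree a < degree g" "degree b < degree h" "R = g * b + a * h" by blast
      then have "P f n (a, b)" using False by (simp add: P_def R_def algebra_simps)
      then show ?thesis by blast
    qed (simp add: P_def)
  qed
  then obtain f where f: "\<And>n. P f n (f n)" by blast
  have f0: "f 0 = (g, h)" using f[of 0] by (simp add: P_def)
  have "q j = (\<Sum>i\<le>j. fst (f i) * snd (f (j - i)))" for j
  proof (cases "j = 0")
    case False
    have "{..j} = insert 0 (insert j {0<..<j})" using False by auto
    then have "(\<Sum>i\<le>j. fst (f i) * snd (f (j - i))) = g * snd (f j) + (fst (f j) * h +
        (\<Sum>i\<in>{0<..<j}. fst (f i) * snd (f (j - i))))"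
      using False by (simp add: f0)
    then show ?thesis using f[of j] False by (simp add: P_def algebra_simps)
  qed (simp add: f0 q0)
  moreover have "\<forall>j>0. degree (fst (f j)) < degree g \<and> degree (snd (f j)) < degree h"
    using f by (auto simp: P_def)
  ultimately show ?thesis
    by (intro exI[of _ "\<lambda>j. fst (f j)"] exI[of _ "\<lambda>j. snd (f j)"]) (simp add: f0)
qed

text \<open>
  A polynomial whose coefficients are power series, given by the sequence of polynomials that are
  its coefficients with respect to the variable of the power series.
\<close>

definition poly_of_layers :: "nat \<Rightarrow> (nat \<Rightarrow> 'k::field poly) \<Rightarrow> 'k fls poly" where
  "poly_of_layers n A = (\<Sum>i\<le>n. monom (fps_to_fls (Abs_fps (\<lambda>j. coeff (A j) i))) i)"

lemma coeff_poly_of_layers: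
  assumes "\<And>j. degree (A j) \<le> n"
  shows "coeff (poly_of_layers n A) i = fps_to_fls (Abs_fps (\<lambda>j. coeff (A j) i))"
proof -
  have "Abs_fps (\<lambda>j. coeff (A j) i) = 0" if "n < i"
  proof (rule fps_ext)
    show "fps_nth (Abs_fps (\<lambda>j. coeff (A j) i)) j = fps_nth 0 j" for j
      using assms[of j] that by (simp add: coeff_eq_0)
  qed
  then show ?thesis by (auto simp: poly_of_layers_def coeff_sum)
qed

lemma degree_poly_of_layers:
  assumes "lead_coeff (A 0) = 1" "\<And>j. j > 0 \<Longrightarrow> degree (A j) < degree (A 0)"
  shows "degree (poly_of_layers (degree (A 0)) A) = degree (A 0)"
proof (rule antisym)
  have le: "degree (A j) \<le> degree (A 0)" for j
    using assms(2)[of j] by (cases "j = 0") auto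
  show "degree (poly_of_layers (degree (A 0)) A) \<le> degree (A 0)"
    unfolding poly_of_layers_def
  proof (rule degree_sum_le)
    fix i assume "i \<in> {..degree (A 0)}"
    then show "degree (monom (fps_to_fls (Abs_fps (\<lambda>j. coeff (A j) i))) i) \<le> degree (A 0)"
      using degree_monom_le[of "fps_to_fls (Abs_fps (\<lambda>j. coeff (A j) i))" i] by simp
  qed simp
  have "fps_nth (Abs_fps (\<lambda>j. coeff (A j) (degree (A 0)))) 0 = 1" using assms(1) by simp
  then have "Abs_fps (\<lambda>j. coeff (A j) (degree (A 0))) \<noteq> 0" by (metis fps_zero_nth zero_neq_one)
  then show "degree (A 0) \<le> degree (poly_of_layers (degree (A 0)) A)"
    by (intro le_degree) (simp add: coeff_poly_of_layers[OF le])
qed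

lemma fps_to_fls_sum: "fps_to_fls (sum f A) = (\<Sum>x\<in>A. fps_to_fls (f x))"
  by (induction A rule: infinite_finite_induct) (auto simp: fps_to_fls_plus)

lemma hensel_factorization:
  fixes P :: "'k::field fls poly"
  assumes monic: "lead_coeff P = 1" and int: "\<And>i. ord_ge (coeff P i) 0"
    and red: "map_poly (\<lambda>c. fls_nth c 0) P = g * h"
    and st: "s * g + t * h = 1" and g: "degree g > 0" "lead_coeff g = 1"
    and h: "degree h > 0" "lead_coeff h = 1"
  shows "\<exists>G H. P = G * H \<and> 0 < degree G \<and> 0 < degree H"
proof -
  define q where "q j = map_poly (\<lambda>c. fls_nth c (int j)) P" for j :: nat
  have coeff_q: "coeff (q j) i = fls_nth (coeff P i) (int j)" for i j
    unfolding q_def by (simp add: coeff_map_poly)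
  have q0: "q 0 = g * h" using red by (simp add: q_def)
  have dP: "degree P = degree g + degree h"
  proof -
    have "g \<noteq> 0" "h \<noteq> 0" using g h by auto
    then have "degree (q 0) = degree g + degree h" by (simp add: q0 degree_mult_eq)
    moreover have "degree (q 0) = degree P"
    proof (rule antisym)
      show "degree (q 0) \<le> degree P" unfolding q_def by (rule degree_map_poly_le)
      show "degree P \<le> degree (q 0)" by (rule le_degree) (simp add: coeff_q monic)
    qed
    ultimately show ?thesis by simp
  qed
  have dq: "degree (q j) < degree g + degree h" if "j > 0" for j
  proof -
    have "coeff (q j) i = 0" if "degree P - 1 < i" for i
    proof (cases "i = degree P")
      case True
      then show ?thesis using \<open>j > 0\<close> by (simp add: coeff_q monic)
    next
      case False
      then have "coeff P i = 0" using that by (intro coeff_eq_0) auto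
      then show ?thesis by (simp add: coeff_q)
    qed
    then have "degree (q j) \<le> degree P - 1" by (intro degree_le) auto
    then show ?thesis using dP g(1) by linarith
  qed
  obtain A B where AB: "A 0 = g" "B 0 = h"
      "\<And>j. j > 0 \<Longrightarrow> degree (A j) < degree g" "\<And>j. j > 0 \<Longrightarrow> degree (B j) < degree h"
      "\<And>j. q j = (\<Sum>i\<le>j. A i * B (j - i))"
    using hensel_sequence[where q = q, OF st g(1) h(1) q0 dq] by blast
  define G where "G = poly_of_layers (degree g) A"
  define H where "H = poly_of_layers (degree h) B"
  have leA: "degree (A j) \<le> degree g" for j using AB(1) AB(3)[of j] by (cases "j = 0") auto
  have leB: "degree (B j) \<le> degree h" for j using AB(2) AB(4)[of j] by (cases "j = 0") auto
  have "coeff P i = coeff (G * H) i" for i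
  proof -
    let ?a = "\<lambda>k. Abs_fps (\<lambda>j. coeff (A j) k)" and ?b = "\<lambda>k. Abs_fps (\<lambda>j. coeff (B j) k)"
    have "coeff (G * H) i = fps_to_fls (\<Sum>k\<le>i. ?a k * ?b (i - k))"
      by (simp add: coeff_mult G_def H_def coeff_poly_of_layers[OF leA] coeff_poly_of_layers[OF leB]
          fls_times_fps_to_fls fps_to_fls_sum)
    moreover have "coeff P i = fps_to_fls (Abs_fps (\<lambda>j. coeff (q j) i))"
    proof (rule fls_eqI)
      fix n show "fls_nth (coeff P i) n = fls_nth (fps_to_fls (Abs_fps (\<lambda>j. coeff (q j) i))) n"
        using int[of i] by (cases "n < 0") (auto simp: coeff_q ord_ge_def)
    qed
    moreover have "Abs_fps (\<lambda>j. coeff (q j) i) = (\<Sum>k\<le>i. ?a k * ?b (i - k))"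
    proof (rule fps_ext)
      fix j
      have "fps_nth (\<Sum>k\<le>i. ?a k * ?b (i - k)) j =
          (\<Sum>k\<le>i. \<Sum>l\<le>j. coeff (A l) k * coeff (B (j - l)) (i - k))"
        by (simp add: fps_sum_nth fps_mult_nth atLeast0AtMost)
      also have "\<dots> = (\<Sum>l\<le>j. \<Sum>k\<le>i. coeff (A l) k * coeff (B (j - l)) (i - k))"
        by (rule sum.swap)
      also have "\<dots> = coeff (q j) i" by (simp add: AB(5) coeff_sum coeff_mult)
      finally show "fps_nth (Abs_fps (\<lambda>j. coeff (q j) i)) j = fps_nth (\<Sum>k\<le>i. ?a k * ?b (i - k)) j"
        by simp
    qed
    ultimately show ?thesis by simp
  qed
  then have "P = G * H" by (rule poly_eqI)
  moreover have "degree G = degree g"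
    using degree_poly_of_layers[of A] AB(1,3) g(2) by (simp add: G_def)
  moreover have "degree H = degree h"
    using degree_poly_of_layers[of B] AB(2,4) h(2) by (simp add: H_def)
  ultimately show ?thesis using g(1) h(1) by (intro exI[of _ G] exI[of _ H]) auto
qed

lemma compose_power_compose_power:
  assumes "a > 0" "b > 0"
  shows "fls_compose_power (fls_compose_power f a) b = fls_compose_power f (a * b)"
proof (rule fls_eqI)
  fix n
  show "fls_nth (fls_compose_power (fls_compose_power f a) b) n = fls_nth (fls_compose_power f (a * b)) n"
  proof (cases "int b dvd n")
    case True
    then obtain k where k: "n = int b * k" by (elim dvdE)
    show ?thesis
      using assms by (simp add: fls_nth_compose_power k mult.commute[of "int a"])
  next
    case False
    then have "\<not> int (a * b) dvd n" using dvd_mult_right[of "int a" "int b" n] by auto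
    then show ?thesis using assms False by (simp add: fls_nth_compose_power)
  qed
qed

lemma subdegree_compose_power:
  assumes "e > 0"
  shows "fls_subdegree (fls_compose_power f e) = int e * fls_subdegree f"
proof (cases "f = 0")
  case False
  show ?thesis
  proof (rule fls_subdegree_eqI)
    show "fls_nth (fls_compose_power f e) (int e * fls_subdegree f) \<noteq> 0"
      using assms False by (simp add: fls_nth_compose_power)
    fix k assume k: "k < int e * fls_subdegree f"
    show "fls_nth (fls_compose_power f e) k = 0"
    proof (cases "int e dvd k")
      case True
      then obtain j where j: "k = int e * j" by (elim dvdE)
      then have "j < fls_subdegree f" using k assms by simp
      then show ?thesis using assms by (simp add: fls_nth_compose_power j)
    qed (use assms in \<open>simp add: fls_nth_compose_power\<close>)
  qed
qed simp

lemma compose_power_eq_0_iff: "e > 0 \<Longrightarrow> fls_compose_power f e = 0 \<longleftrightarrow> f = 0"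
proof
  assume e: "e > 0" and 0: "fls_compose_power f e = 0"
  have "fls_nth f n = 0" for n
  proof -
    have "fls_nth (fls_compose_power f e) (int e * n) = 0" using 0 by simp
    then show ?thesis using e by (simp add: fls_nth_compose_power)
  qed
  then show "f = 0" by (intro fls_eqI) simp
qed simp

lemma compose_power_hom:
  assumes "e > 0"
  shows "inj_idom_hom (\<lambda>f :: 'k::field fls. fls_compose_power f e)"
  by unfold_locales (use assms compose_power_eq_0_iff in auto)

abbreviation cpoly :: "nat \<Rightarrow> 'k::field fls poly \<Rightarrow> 'k fls poly" where
  "cpoly e \<equiv> map_poly (\<lambda>f. fls_compose_power f e)"

lemma cpoly_1: "cpoly 1 P = P"
  by (intro poly_eqI fls_eqI) (simp add: coeff_map_poly fls_nth_compose_power)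

lemma monic_scale_factor:
  fixes Q :: "'b::field poly"
  assumes "c \<noteq> 0" "P = smult b (pcompose Q [:0, c:])" "b \<noteq> 0" "Q = G * H"
    "0 < degree G" "0 < degree H"
  shows "\<exists>G H. P = G * H \<and> 0 < degree G \<and> 0 < degree H"
  by (rule exI[of _ "smult b (pcompose G [:0, c:])"], rule exI[of _ "pcompose H [:0, c:]"])
    (use assms in \<open>simp add: pcompose_mult\<close>)

lemma coeff_pcompose_monom_linear: "coeff (pcompose Q [:0, c:]) i = c ^ i * coeff Q i"
  for Q :: "'b::comm_semiring_1 poly"
proof (induction Q arbitrary: i)
  case (pCons a Q)
  show ?case
    by (cases i) (simp_all add: pcompose_pCons pCons.IH algebra_simps)
qed simp

text \<open>
  Unless \<open>P\<close> is a power of the unknown, choose \<open>i0\<close> on the edge of the Newton polygon that ends at the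
  leading coefficient. The substitution \<open>X \<mapsto> X\<^sup>e\<close> makes its slope an integer \<open>r\<close>, and rescaling the unknown by \<open>X\<^sup>r\<close> yields an integral monic polynomial \<open>Q\<close> whose reduction \<open>q\<close>
  is not a power of the unknown. As the coefficient below the leading one vanishes and the
  characteristic is \<open>0\<close>, \<open>q\<close> is not the power of any linear polynomial, so it has two coprime factors,
  which lift by Hensel's lemma.
\<close>

lemma depressed_reducible:
  fixes P :: "'k::{alg_closed_field, field_char_0} fls poly"
  assumes monic: "lead_coeff P = 1" and n: "degree P > 1" and dep: "coeff P (degree P - 1) = 0"
  shows "\<exists>e>0. \<exists>G H. cpoly e P = G * H \<and> 0 < degree G \<and> 0 < degree H"
proof (cases "\<forall>i<degree P. coeff P i = 0")
  case True
  have "P = monom 1 (degree P)"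
  proof (rule poly_eqI)
    show "coeff P i = coeff (monom 1 (degree P)) i" for i
      using True monic by (cases i "degree P" rule: linorder_cases) (auto simp: coeff_eq_0)
  qed
  also have "\<dots> = monom 1 1 * monom 1 (degree P - 1)"
    using n by (simp add: mult_monom)
  finally have P: "P = monom 1 1 * monom 1 (degree P - 1)" .
  with cpoly_1[of P] show ?thesis
    using n by (intro exI[of _ 1] conjI exI[of _ "monom 1 1"] exI[of _ "monom 1 (degree P - 1)"])
      (simp_all add: degree_monom_eq)
next
  case False
  define n where "n = degree P"
  define S where "S = {i. i < n \<and> coeff P i \<noteq> 0}"
  \<comment> \<open>Up to sign, the slopes of the lines to the vertex of the leading coefficient; the least one is that of an edge.\<close>
  define slope where "slope i = real_of_int (fls_subdegree (coeff P i)) / real (n - i)" for i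
  have S: "finite S" "S \<noteq> {}" using False by (auto simp: S_def n_def)
  define i0 where "i0 = arg_min_on slope S"
  have i0: "i0 \<in> S" and min: "\<And>i. i \<in> S \<Longrightarrow> slope i0 \<le> slope i"
    using arg_min_if_finite(1)[OF S] arg_min_least[OF S] unfolding i0_def by auto
  define e where "e = n - i0"
  define r where "r = fls_subdegree (coeff P i0)"
  have e: "e > 0" using i0 by (simp add: e_def S_def)
  interpret cp: inj_idom_hom "\<lambda>f :: 'k fls. fls_compose_power f e" by (rule compose_power_hom[OF e])
  have val: "r * int (n - i) \<le> int e * fls_subdegree (coeff P i)" if "i \<in> S" for i
  proof -
    have pos: "real e > 0" "real (n - i) > 0" using e that by (auto simp: S_def)
    have "real_of_int r / real e \<le> real_of_int (fls_subdegree (coeff P i)) / real (n - i)"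
      using min[OF that] by (simp add: slope_def r_def e_def)
    then have "real_of_int r * real (n - i) \<le> real_of_int (fls_subdegree (coeff P i)) * real e"
      using pos by (simp add: divide_le_eq pos_le_divide_eq mult.commute)
    then have "real_of_int (r * int (n - i)) \<le> real_of_int (int e * fls_subdegree (coeff P i))"
      by (simp add: mult.commute)
    then show ?thesis by (simp only: of_int_le_iff)
  qed
  define Q where
    "Q = (\<Sum>i\<le>n. monom (fls_X_intpow (- r * int (n - i)) * fls_compose_power (coeff P i) e) i)"
  have coeff_Q: "coeff Q i = fls_X_intpow (- r * int (n - i)) * fls_compose_power (coeff P i) e" for i
    by (cases "i \<le> n") (simp_all add: Q_def coeff_sum n_def coeff_eq_0)
  have degQ: "degree Q = n"
  proof (rule antisym)
    show "degree Q \<le> n" by (rule degree_le) (simp add: coeff_Q coeff_eq_0 n_def)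
    show "n \<le> degree Q" by (rule le_degree) (use e monic in \<open>simp add: coeff_Q n_def\<close>)
  qed
  have coeff_Qn: "coeff Q n = 1" using e monic by (simp add: coeff_Q n_def)
  have sub: "fls_subdegree (coeff Q i) = int e * fls_subdegree (coeff P i) - r * int (n - i)"
    if "coeff P i \<noteq> 0" for i
  proof -
    have "fls_compose_power (coeff P i) e \<noteq> 0" using that e by (simp add: compose_power_eq_0_iff)
    from fls_subdegree_mult[OF fls_X_intpow_nonzero this, of "- r * int (n - i)"]
    have "fls_subdegree (coeff Q i) =
        - r * int (n - i) + fls_subdegree (fls_compose_power (coeff P i) e)"
      unfolding coeff_Q fls_subdegree_fls_X_intpow .
    then show ?thesis using e by (simp add: subdegree_compose_power)
  qed
  have int: "ord_ge (coeff Q i) 0" for i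
  proof (cases "coeff P i = 0 \<or> i > n")
    case True
    then show ?thesis by (auto simp: coeff_Q n_def coeff_eq_0)
  next
    case F: False
    show ?thesis
    proof (cases "i = n")
      case True
      then show ?thesis by (simp add: coeff_Qn)
    next
      case False
      then have "i \<in> S" using F by (auto simp: S_def)
      then show ?thesis using val[of i] sub[of i] F by (simp add: ord_ge_iff)
    qed
  qed
  define q where "q = map_poly (\<lambda>c. fls_nth c 0) Q"
  have coeff_q: "coeff q i = fls_nth (coeff Q i) 0" for i by (simp add: q_def coeff_map_poly)
  have q_i0: "coeff q i0 \<noteq> 0"
  proof -
    have "coeff P i0 \<noteq> 0" using i0 by (simp add: S_def)
    then have "coeff Q i0 \<noteq> 0"
      by (simp only: coeff_Q mult_eq_0_iff fls_X_intpow_nonzero compose_power_eq_0_iff[OF e]) simp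
    moreover have "fls_subdegree (coeff Q i0) = 0"
      using sub[of i0] \<open>coeff P i0 \<noteq> 0\<close> by (simp add: e_def r_def mult.commute)
    ultimately show ?thesis unfolding coeff_q by (metis nth_fls_subdegree_nonzero)
  qed
  have qn: "coeff q n = 1" by (simp add: coeff_q coeff_Qn)
  have degq: "degree q = n"
  proof (rule antisym)
    show "degree q \<le> n" unfolding q_def using degree_map_poly_le[of _ Q] degQ by metis
    show "n \<le> degree q" by (rule le_degree) (simp add: qn)
  qed
  have q0: "q \<noteq> 0" using qn by auto
  have "degree q > 0" using degq \<open>degree P > 1\<close> by (simp add: n_def)
  then obtain a where a: "poly q a = 0" using alg_closed_imp_poly_has_root by blast
  define m where "m = order a q"
  obtain h where h: "q = [:- a, 1:] ^ m * h" "\<not> [:- a, 1:] dvd h"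
    using order_decomp[OF q0, of a] unfolding m_def by blast
  have m: "m > 0" using a q0 by (simp add: m_def order_root)
  have h0: "h \<noteq> 0" using h(2) by auto
  have deg_m: "degree ([:- a, 1:] ^ m) = m" by (simp add: degree_linear_power)
  have lc_m: "lead_coeff ([:- a, 1:] ^ m) = 1" by (simp add: lead_coeff_power)
  have dmh: "n = m + degree h"
    using degree_mult_eq[of "[:- a, 1:] ^ m" h] h0 by (simp add: h(1)[symmetric] degq deg_m)
  have lch: "lead_coeff h = 1"
    using lead_coeff_mult[of "[:- a, 1:] ^ m" h] lc_m qn by (simp add: h(1)[symmetric] degq)
  have "degree h > 0"
  proof (rule ccontr)
    assume "\<not> degree h > 0"
    then have "h = [:1:]" using lch by (metis degree_0_id gr0I lead_coeff_pCons(1) degree_pCons_0 coeff_pCons_0 degree_eq_zeroE)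
    then have q: "q = [:- a, 1:] ^ n" using h(1) dmh by simp
    have "coeff q (n - 1) = of_nat n * - a"
    proof -
      have "coeff q (n - 1) = of_nat (n choose (n - 1)) * 1 ^ (n - 1) * (- a) ^ (n - (n - 1))"
        unfolding q by (rule coeff_linear_poly_power) simp
      then show ?thesis using \<open>degree P > 1\<close> binomial_symmetric[of 1 n] by (simp add: n_def)
    qed
    moreover have "coeff q (n - 1) = 0" using dep by (simp add: coeff_q coeff_Q n_def)
    ultimately have "a = 0" using \<open>degree P > 1\<close> by (simp add: n_def)
    then have "q = monom 1 n" unfolding q by (simp add: monom_altdef)
    then show False using q_i0 i0 by (simp add: S_def)
  qed
  moreover have "poly h a \<noteq> 0" using h(2) by (simp add: poly_eq_0_iff_dvd)
  then obtain s t where st: "s * [:- a, 1:] ^ m + t * h = 1" using bezout_linear_power by blast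
  have "lead_coeff Q = 1" using coeff_Qn degQ by simp
  ultimately obtain G H where GH: "Q = G * H" "0 < degree G" "0 < degree H"
    using hensel_factorization[OF _ int h(1)[unfolded q_def] st _ lc_m _ lch] m deg_m by auto
  have "cpoly e P = smult (fls_X_intpow (r * int n)) (pcompose Q [:0, fls_X_intpow (- r):])"
  proof (rule poly_eqI)
    fix i
    show "coeff (cpoly e P) i = coeff (smult (fls_X_intpow (r * int n)) (pcompose Q [:0, fls_X_intpow (- r):])) i"
    proof (cases "i \<le> n")
      case True
      have "fls_X_intpow (r * int n) * (fls_X_intpow (- r) ^ i * fls_X_intpow (- r * int (n - i))) = (1 :: 'k fls)"
        unfolding fls_X_intpow_power fls_X_intpow_times_fls_X_intpow using True
        by (simp add: of_nat_diff algebra_simps)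
      then show ?thesis
        by (simp add: coeff_map_poly coeff_pcompose_monom_linear coeff_Q mult.assoc[symmetric]
            del: fls_X_intpow_times_fls_X_intpow)
    qed (simp add: coeff_map_poly coeff_pcompose_monom_linear coeff_Q n_def coeff_eq_0)
  qed
  from monic_scale_factor[OF fls_X_intpow_nonzero this fls_X_intpow_nonzero GH] e show ?thesis by (intro exI[of _ e]) simp
qed

text \<open>
  Translating the unknown by the mean of the roots reduces this to \<open>depressed_reducible\<close>.
\<close>

lemma puiseux_reducible:
  fixes P :: "'k::{alg_closed_field, field_char_0} fls poly"
  assumes n: "degree P > 1"
  shows "\<exists>e>0. \<exists>G H. cpoly e P = G * H \<and> 0 < degree G \<and> 0 < degree H"
proof -
  define n where "n = degree P"
  define b where "b = lead_coeff P"
  have b: "b \<noteq> 0" using n by (auto simp: b_def)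
  define a where "a = coeff P (n - 1) / b"
  define c where "c = a / of_nat n"
  define P1 where "P1 = smult (1 / b) (pcompose P [:- c, 1:])"
  have deg1: "degree P1 = n" using b by (simp add: P1_def n_def)
  have lc1: "lead_coeff P1 = 1"
    using b n lead_coeff_comp[of "[:- c, 1:]" P] unfolding deg1 by (simp add: P1_def b_def n_def)
  have "coeff P1 (n - 1) = 0"
  proof -
    define R where "R = P - monom b n - monom (coeff P (n - 1)) (n - 1)"
    have R: "degree R < n - 1 \<or> R = 0"
    proof -
      have "coeff R i = 0" if "n - 1 \<le> i" for i
        using that n by (cases "i = n"; cases "i = n - 1")
          (auto simp: R_def b_def n_def coeff_eq_0)
      then show ?thesis
        by (metis leading_coeff_0_iff not_le)
    qed
    have P: "P = monom b n + monom (coeff P (n - 1)) (n - 1) + R" by (simp add: R_def)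
    have pm: "pcompose (monom x k) [:- c, 1:] = smult x ([:- c, 1:] ^ k)" for x k
      by (simp add: monom_altdef pcompose_smult pcompose_hom.hom_power pcompose_pCons)
    have "pcompose P [:- c, 1:] = smult b ([:- c, 1:] ^ n) + smult (coeff P (n - 1)) ([:- c, 1:] ^ (n - 1))
        + pcompose R [:- c, 1:]"
      by (subst P) (simp only: pcompose_add pm)
    moreover have "coeff ([:- c, 1:] ^ n) (n - 1) = of_nat n * - c"
      using n binomial_symmetric[of 1 n] coeff_linear_poly_power[of "n - 1" n "- c" 1]
      by (simp add: n_def)
    moreover have "coeff ([:- c, 1:] ^ (n - 1)) (n - 1) = 1" by (rule coeff_linear_power)
    moreover have "coeff (pcompose R [:- c, 1:]) (n - 1) = 0"
      using R by (elim disjE) (simp_all add: coeff_eq_0)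
    ultimately have "coeff (pcompose P [:- c, 1:]) (n - 1) = b * (of_nat n * - c) + coeff P (n - 1)"
      by simp
    also have "\<dots> = 0"
      using n b by (simp add: c_def a_def n_def)
    finally show ?thesis by (simp add: P1_def)
  qed
  then obtain e G H where e: "e > 0" and GH: "cpoly e P1 = G * H" "0 < degree G" "0 < degree H"
    using depressed_reducible[of P1] lc1 n deg1 by (auto simp: n_def)
  interpret cp: inj_idom_hom "\<lambda>f :: 'k fls. fls_compose_power f e" by (rule compose_power_hom[OF e])
  interpret cpp: map_poly_inj_idom_hom "\<lambda>f :: 'k fls. fls_compose_power f e" ..
  have "P = smult b (pcompose P1 [:c, 1:])"
    using b by (simp add: P1_def pcompose_smult pcompose_assoc[symmetric] pcompose_pCons)
  then have "cpoly e P = cpoly e (smult b (pcompose P1 [:c, 1:]))" by simp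
  also have "\<dots> = smult (fls_compose_power b e) (pcompose (cpoly e P1) [:fls_compose_power c e, 1:])"
    using e by (simp add: cp.map_poly_hom_smult cp.map_poly_pcompose map_poly_pCons)
  also have "\<dots> = smult (fls_compose_power b e) (pcompose G [:fls_compose_power c e, 1:]) *
      pcompose H [:fls_compose_power c e, 1:]"
    by (simp add: GH(1) pcompose_mult)
  finally show ?thesis
    using GH(2,3) b e compose_power_eq_0_iff[OF e, of b]
    by (intro exI[of _ e] conjI exI[of _ "smult (fls_compose_power b e) (pcompose G [:fls_compose_power c e, 1:])"]
        exI[of _ "pcompose H [:fls_compose_power c e, 1:]"]) auto
qed

theorem newton_puiseux:
  fixes P :: "'k::{alg_closed_field, field_char_0} fls poly"
  assumes "P \<noteq> 0"
  shows "\<exists>e>0. \<exists>rs. cpoly e P = smult (lead_coeff (cpoly e P)) (\<Prod>r\<leftarrow>rs. [:- r, 1:])"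
  using assms
proof (induction "degree P" arbitrary: P rule: less_induct)
  case less
  consider "degree P = 0" | "degree P = 1" | "degree P > 1" by linarith
  then show ?case
  proof cases
    case 1
    then obtain c where P: "P = [:c:]" by (metis degree_eq_zeroE)
    show ?thesis
      by (rule exI[of _ 1], rule conjI, simp, rule exI[of _ "[]"]) (simp add: P cpoly_1 del: One_nat_def)
  next
    case 2
    then obtain b c where P: "P = [:b, c:]" "c \<noteq> 0" by (metis degree1_coeffs)
    show ?thesis
      by (rule exI[of _ 1], rule conjI, simp, rule exI[of _ "[- b / c]"])
        (use P in \<open>simp add: cpoly_1 del: One_nat_def\<close>)
  next
    case 3
    from puiseux_reducible[OF this] obtain e G H where e: "e > 0"
      and GH: "cpoly e P = G * H" "0 < degree G" "0 < degree H" by blast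
    have nz: "G \<noteq> 0" "H \<noteq> 0" using GH by auto
    interpret c1: inj_idom_hom "\<lambda>f :: 'k fls. fls_compose_power f e" by (rule compose_power_hom[OF e])
    have "degree P = degree G + degree H"
      using nz by (simp add: GH(1)[symmetric] degree_mult_eq[symmetric] c1.degree_map_poly_hom)
    then have lt: "degree G < degree P" "degree H < degree P" using GH by auto
    obtain e1 rs1 where e1: "e1 > 0"
      and G: "cpoly e1 G = smult (lead_coeff (cpoly e1 G)) (\<Prod>r\<leftarrow>rs1. [:- r, 1:])"
      using less.hyps[OF lt(1) nz(1)] by blast
    interpret c2: inj_idom_hom "\<lambda>f :: 'k fls. fls_compose_power f e1" by (rule compose_power_hom[OF e1])
    interpret c2p: map_poly_inj_idom_hom "\<lambda>f :: 'k fls. fls_compose_power f e1" ..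
    have "degree (cpoly e1 H) < degree P" "cpoly e1 H \<noteq> 0"
      using lt(2) nz(2) by (auto simp: c2.degree_map_poly_hom)
    then obtain e2 rs2 where e2: "e2 > 0"
      and H: "cpoly e2 (cpoly e1 H) = smult (lead_coeff (cpoly e2 (cpoly e1 H))) (\<Prod>r\<leftarrow>rs2. [:- r, 1:])"
      using less.hyps by blast
    interpret c3: inj_idom_hom "\<lambda>f :: 'k fls. fls_compose_power f e2" by (rule compose_power_hom[OF e2])
    interpret c3p: map_poly_inj_idom_hom "\<lambda>f :: 'k fls. fls_compose_power f e2" ..
    define rs where "rs = map (\<lambda>r. fls_compose_power r e2) rs1 @ rs2"
    have "cpoly e2 (\<Prod>r\<leftarrow>rs1. [:- r, 1:]) = (\<Prod>r\<leftarrow>map (\<lambda>r. fls_compose_power r e2) rs1. [:- r, 1:])"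
    proof (induction rs1)
      case (Cons r rs1)
      have "cpoly e2 [:- r, 1:] = [:- fls_compose_power r e2, 1:]"
        using e2 by (simp add: map_poly_pCons)
      then show ?case using Cons by (simp only: list.map prod_list.Cons c3p.hom_mult)
    qed simp
    with arg_cong[OF G, of "cpoly e2"] obtain k1 where k1: "cpoly e2 (cpoly e1 G) =
        smult k1 (\<Prod>r\<leftarrow>map (\<lambda>r. fls_compose_power r e2) rs1. [:- r, 1:])"
      by (auto simp only: c3.map_poly_hom_smult)
    from H obtain k2 where k2: "cpoly e2 (cpoly e1 H) = smult k2 (\<Prod>r\<leftarrow>rs2. [:- r, 1:])" by blast
    obtain k where k: "cpoly e2 (cpoly e1 (cpoly e P)) = smult k (\<Prod>r\<leftarrow>rs. [:- r, 1:])"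
      unfolding GH(1) c2p.hom_mult c3p.hom_mult k1 k2 rs_def
      by (auto simp only: map_append prod_list.append mult_smult_left mult_smult_right smult_smult)
    have E: "cpoly e2 (cpoly e1 (cpoly e P)) = cpoly (e * e1 * e2) P"
      using e e1 e2
      by (intro poly_eqI) (simp add: coeff_map_poly compose_power_compose_power mult.assoc)
    have "lead_coeff (\<Prod>r\<leftarrow>rs. [:- r, 1:]) = 1"
    proof (induction rs)
      case (Cons r rs)
      then show ?case by (simp only: list.map prod_list.Cons lead_coeff_mult) simp
    qed simp
    then have "k = lead_coeff (cpoly (e * e1 * e2) P)"
      using k by (simp add: E)
    then show ?thesis using e e1 e2 k
      by (intro exI[of _ "e * e1 * e2"] conjI exI[of _ rs]) (simp_all add: E)
  qed
qed

section \<open>Conjugates of an algebraic element\<close>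

definition nonpos_polys :: "'k::field fls poly set" where
  "nonpos_polys = {P. \<forall>j. coeff P j \<in> nonpos_supp}"

lemma nonpos_polys_add: "P \<in> nonpos_polys \<Longrightarrow> Q \<in> nonpos_polys \<Longrightarrow> P + Q \<in> nonpos_polys"
  by (simp add: nonpos_polys_def nonpos_supp_add)

lemma nonpos_polys_diff: "P \<in> nonpos_polys \<Longrightarrow> Q \<in> nonpos_polys \<Longrightarrow> P - Q \<in> nonpos_polys"
  by (simp add: nonpos_polys_def nonpos_supp_diff)

lemma nonpos_polys_uminus: "P \<in> nonpos_polys \<Longrightarrow> - P \<in> nonpos_polys"
  by (simp add: nonpos_polys_def nonpos_supp_uminus)

lemma nonpos_polys_mult: "P \<in> nonpos_polys \<Longrightarrow> Q \<in> nonpos_polys \<Longrightarrow> P * Q \<in> nonpos_polys"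
  by (simp add: nonpos_polys_def coeff_mult nonpos_supp_sum nonpos_supp_mult)

lemma nonpos_polys_smult: "c \<in> nonpos_supp \<Longrightarrow> Q \<in> nonpos_polys \<Longrightarrow> smult c Q \<in> nonpos_polys"
  by (simp add: nonpos_polys_def nonpos_supp_mult)

lemma nonpos_polys_pderiv: "P \<in> nonpos_polys \<Longrightarrow> pderiv P \<in> nonpos_polys"
  unfolding nonpos_polys_def coeff_pderiv mem_Collect_eq
  by (intro allI nonpos_supp_mult nonpos_supp_of_nat) simp

lemma nonpos_polys_0 [simp]: "0 \<in> nonpos_polys"
  by (simp add: nonpos_polys_def)

lemma nonpos_polys_1 [simp]: "1 \<in> nonpos_polys"
  by (simp add: nonpos_polys_def coeff_1)

lemma pseudo_division:
  assumes "F \<in> nonpos_polys" and G: "G \<in> nonpos_polys" "G \<noteq> 0"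
  shows "\<exists>c Q S. c \<in> nonpos_supp \<and> c \<noteq> 0 \<and> Q \<in> nonpos_polys \<and> S \<in> nonpos_polys \<and>
    smult c F = G * Q + S \<and> (S = 0 \<or> degree S < degree G)"
  using assms(1)
proof (induction "degree F" arbitrary: F rule: less_induct)
  case less
  show ?case
  proof (cases "F = 0 \<or> degree F < degree G")
    case True
    then show ?thesis using less.prems by (intro exI[of _ 1] exI[of _ 0] exI[of _ F]) auto
  next
    case False
    define b where "b = lead_coeff G"
    have b: "b \<in> nonpos_supp" "b \<noteq> 0" using G by (auto simp: b_def nonpos_polys_def)
    define M where "M = monom (lead_coeff F) (degree F - degree G)"
    have M: "M \<in> nonpos_polys" using less.prems by (simp add: M_def nonpos_polys_def)
    \<comment> \<open>One step of the division; multiplying by \<open>b\<close> replaces the division by the leading coefficient.\<close>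
    define F1 where "F1 = smult b F - G * M"
    have F1: "F1 \<in> nonpos_polys"
      using less.prems b G M by (auto simp: F1_def intro!: nonpos_polys_diff nonpos_polys_smult nonpos_polys_mult)
    have lcF: "lead_coeff F \<noteq> 0" using False by auto
    have dGM: "degree (G * M) = degree F"
      using False G(2) lcF by (simp add: M_def degree_mult_eq degree_monom_eq)
    have lcGM: "lead_coeff (G * M) = b * lead_coeff F"
    proof -
      have "lead_coeff M = lead_coeff F" unfolding M_def degree_monom_eq[OF lcF] by simp
      then show ?thesis by (simp add: lead_coeff_mult b_def)
    qed
    show ?thesis
    proof (cases "F1 = 0")
      case True
      then show ?thesis using b M
        by (intro exI[of _ b] exI[of _ M] exI[of _ 0]) (auto simp: F1_def)
    next
      case F1nz: False
      have "degree F1 \<le> degree F"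
        unfolding F1_def using dGM by (intro degree_diff_le) auto
      moreover have "coeff F1 (degree F) = 0"
        using lcGM by (simp add: F1_def dGM)
      ultimately have "degree F1 < degree F"
        using F1nz by (metis leading_coeff_0_iff le_neq_implies_less)
      from less.hyps[OF this F1] obtain c Q S where IH: "c \<in> nonpos_supp" "c \<noteq> 0"
          "Q \<in> nonpos_polys" "S \<in> nonpos_polys" "smult c F1 = G * Q + S" "S = 0 \<or> degree S < degree G"
        by blast
      have "smult (c * b) F = G * (Q + smult c M) + S"
        using IH(5) by (simp add: F1_def smult_diff_right algebra_simps)
      then show ?thesis using IH b M
        by (intro exI[of _ "c * b"] exI[of _ "Q + smult c M"] exI[of _ S])
          (auto intro!: nonpos_supp_mult nonpos_polys_add nonpos_polys_smult)
    qed
  qed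
qed

text \<open>
  A nonzero combination \<open>G\<close> of \<open>P\<close> and its derivative of least degree divides both up to nonzero
  factors from the coefficient ring. If \<open>G\<close> were not constant, then \<open>G\<close> or its cofactor in \<open>P\<close> would be an
  annihilator of \<open>\<alpha>\<close> of smaller degree than \<open>P\<close>.
\<close>

lemma separable_bezout:
  fixes P :: "'k::field_char_0 fls poly"
  assumes P: "P \<in> nonpos_polys" "P \<noteq> 0" "poly P \<alpha> = 0"
    and min: "\<And>Q. Q \<in> nonpos_polys \<Longrightarrow> Q \<noteq> 0 \<Longrightarrow> poly Q \<alpha> = 0 \<Longrightarrow> degree P \<le> degree Q"
  shows "\<exists>U\<in>nonpos_polys. \<exists>V\<in>nonpos_polys. \<exists>\<Delta>\<in>nonpos_supp. \<Delta> \<noteq> 0 \<and> U * P + V * pderiv P = [:\<Delta>:]"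
proof -
  define J where "J G \<longleftrightarrow> G \<noteq> 0 \<and> (\<exists>U\<in>nonpos_polys. \<exists>V\<in>nonpos_polys. G = U * P + V * pderiv P)" for G
  have "J P"
    unfolding J_def by (rule conjI[OF P(2)], rule bexI[of _ 1], rule bexI[of _ 0]) simp_all
  then obtain G where G: "J G" and Gmin: "\<And>G'. J G' \<Longrightarrow> degree G \<le> degree G'"
    by (metis (mono_tags) exists_least_iff linorder_not_less
        arg_min_nat_lemma[of J _ degree])
  obtain U V where UV: "U \<in> nonpos_polys" "V \<in> nonpos_polys" "G = U * P + V * pderiv P"
    using G by (auto simp: J_def)
  have Gn: "G \<in> nonpos_polys" "G \<noteq> 0"
    using UV P(1) G by (auto simp: J_def intro!: nonpos_polys_add nonpos_polys_mult nonpos_polys_pderiv)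
  have div: "\<exists>c Q. c \<noteq> 0 \<and> Q \<in> nonpos_polys \<and> smult c F = G * Q"
    if F: "F = A * P + B * pderiv P" "A \<in> nonpos_polys" "B \<in> nonpos_polys" for F A B
  proof -
    have "F \<in> nonpos_polys"
      using F P(1) by (auto intro!: nonpos_polys_add nonpos_polys_mult nonpos_polys_pderiv)
    from pseudo_division[OF this Gn] obtain c Q S where D: "c \<in> nonpos_supp" "c \<noteq> 0"
        "Q \<in> nonpos_polys" "S \<in> nonpos_polys" "smult c F = G * Q + S" "S = 0 \<or> degree S < degree G"
      by blast
    have "S = smult c F - G * Q" using D(5) by simp
    also have "\<dots> = (smult c A - U * Q) * P + (smult c B - V * Q) * pderiv P"
      by (simp add: F(1) UV(3) smult_add_right algebra_simps)
    finally have "S = (smult c A - U * Q) * P + (smult c B - V * Q) * pderiv P" .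
    moreover have "smult c A - U * Q \<in> nonpos_polys" "smult c B - V * Q \<in> nonpos_polys"
      using D F UV by (auto intro!: nonpos_polys_diff nonpos_polys_mult nonpos_polys_smult)
    ultimately have "S \<noteq> 0 \<Longrightarrow> J S" unfolding J_def by blast
    then have "S = 0" using D(6) Gmin[of S] not_le by blast
    then show ?thesis using D by auto
  qed
  have dP: "degree P > 0"
  proof (rule ccontr)
    assume "\<not> degree P > 0"
    then obtain c where "P = [:c:]" by (metis degree_eq_zeroE gr0I)
    then show False using P(2,3) by simp
  qed
  have "degree G = 0"
  proof (rule ccontr)
    assume dG: "degree G \<noteq> 0"
    obtain c Q where Q: "c \<noteq> 0" "Q \<in> nonpos_polys" "smult c P = G * Q"
      using div[of P 1 0] by auto
    obtain c' Q' where Q': "c' \<noteq> 0" "smult c' (pderiv P) = G * Q'"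
      using div[of "pderiv P" 0 1] by auto
    have dP0: "pderiv P \<noteq> 0" using dP by (simp add: pderiv_eq_0_iff)
    have "Q \<noteq> 0" using Q P(2) by auto
    then have "degree P = degree G + degree Q"
      using arg_cong[OF Q(3), of degree] Q(1) Gn(2) by (simp add: degree_mult_eq)
    then have "poly Q \<alpha> \<noteq> 0" using min[OF Q(2) \<open>Q \<noteq> 0\<close>] dG by linarith
    moreover have "poly G \<alpha> * poly Q \<alpha> = 0"
      using arg_cong[OF Q(3), of "\<lambda>R. poly R \<alpha>"] P(3) by simp
    ultimately have "poly G \<alpha> = 0" by simp
    then have "degree P \<le> degree G" using min Gn by blast
    moreover have "degree G \<le> degree (pderiv P)"
    proof -
      have "Q' \<noteq> 0" using Q' dP0 by auto
      then show ?thesis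
        using arg_cong[OF Q'(2), of degree] Q'(1) Gn(2) by (simp add: degree_mult_eq)
    qed
    ultimately show False using dP by (simp add: degree_pderiv)
  qed
  then obtain \<Delta> where \<Delta>: "G = [:\<Delta>:]" by (metis degree_eq_zeroE)
  have "\<Delta> \<in> nonpos_supp" using Gn(1) unfolding \<Delta> nonpos_polys_def by (auto dest!: spec[of _ 0])
  then show ?thesis using UV \<Delta> Gn(2) by (intro bexI[of _ U] bexI[of _ V] bexI[of _ \<Delta>]) auto
qed

lemma (in derivation) D_poly:
  "D (poly P x) = poly (map_poly D P) x + poly (pderiv P) x * D x"
proof (induction P)
  case (pCons a P)
  have "map_poly D (pCons a P) = pCons (D a) (map_poly D P)"
    by (rule poly_eqI) (simp add: coeff_map_poly coeff_pCons split: nat.splits)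
  then show ?case by (simp add: D_add D_mult pCons.IH pderiv_pCons algebra_simps)
qed simp

definition map_ac :: "'a::field fls \<Rightarrow> 'a alg_closure fls" where
  "map_ac f = Abs_fls (\<lambda>n. to_ac (fls_nth f n))"

lemma nth_map_ac [simp]: "fls_nth (map_ac f) n = to_ac (fls_nth f n)"
  unfolding map_ac_def
  by (subst nth_Abs_fls_lower_bound[of "fls_subdegree f"]) auto

lemma map_ac_eq_0_iff [simp]: "map_ac f = 0 \<longleftrightarrow> f = 0"
  by (auto simp: fls_eq_iff)

lemma subdegree_map_ac [simp]: "fls_subdegree (map_ac f) = fls_subdegree f"
proof (cases "f = 0")
  case True
  then have "map_ac f = 0" by simp
  then have "fls_subdegree (map_ac f) = 0" by (simp only: fls_zero_subdegree)
  with True show ?thesis by (simp del: map_ac_eq_0_iff)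
qed (auto intro!: fls_subdegree_eqI)

lemma map_ac_hom: "inj_idom_hom map_ac"
proof unfold_locales
  show "map_ac (f * g) = map_ac f * map_ac g" for f g :: "'a fls"
    by (rule fls_eqI) (simp add: fls_times_nth(2) to_ac_sum)
qed (auto intro!: fls_eqI)

lemma nonpos_supp_eq_range: "(nonpos_supp :: 'b::field fls set) = range poly_in_T"
proof
  show "(nonpos_supp :: 'b fls set) \<subseteq> range poly_in_T"
  proof
    fix f :: "'b fls" assume "f \<in> nonpos_supp"
    then have "f = poly_in_T (floor_T f)"
      by (intro fls_eqI) (auto simp: nth_floor_T nonpos_supp_def)
    then show "f \<in> range poly_in_T" by blast
  qed
qed (auto simp: nonpos_supp_def nth_poly_in_T)

lemma poly_in_T_nonpos [simp]: "poly_in_T p \<in> nonpos_supp"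
  by (simp add: nonpos_supp_eq_range)

lemma poly_in_T_eq_0_iff [simp]: "poly_in_T p = 0 \<longleftrightarrow> p = 0"
proof
  assume "poly_in_T p = 0"
  then have "fls_nth (poly_in_T p) (- int i) = 0" for i by simp
  then show "p = 0" by (intro poly_eqI) (simp add: nth_poly_in_T)
qed (simp add: poly_in_T_def)

lemma mem_ratfun_field_iff:
  "x \<in> ratfun_field \<longleftrightarrow> (\<exists>a\<in>nonpos_supp. \<exists>b\<in>nonpos_supp. b \<noteq> 0 \<and> x = a / b)"
  unfolding ratfun_field_def nonpos_supp_eq_range by auto

lemma ratfun_poly_clear_denominators:
  fixes P :: "'a::field fls poly"
  assumes "\<forall>i. coeff P i \<in> ratfun_field"
  shows "\<exists>b\<in>nonpos_supp. b \<noteq> 0 \<and> smult b P \<in> nonpos_polys"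
proof -
  obtain N D where ND: "\<And>i. N i \<in> nonpos_supp" "\<And>i. D i \<in> nonpos_supp" "\<And>i. D i \<noteq> 0"
      "\<And>i. coeff P i = N i / D i"
    using assms unfolding mem_ratfun_field_iff by metis
  define b where "b = (\<Prod>i\<le>degree P. D i)"
  have "coeff (smult b P) i \<in> nonpos_supp" for i
  proof (cases "i \<le> degree P")
    case True
    have "b = D i * (\<Prod>j\<in>{..degree P} - {i}. D j)"
      unfolding b_def using True by (intro prod.remove) auto
    then have "coeff (smult b P) i = N i * (\<Prod>j\<in>{..degree P} - {i}. D j)"
      using ND(3)[of i] by (simp add: ND(4))
    then show ?thesis using ND by (auto intro!: nonpos_supp_mult nonpos_supp_prod)
  qed (simp add: coeff_eq_0)
  then show ?thesis
    using ND by (intro bexI[of _ b]) (auto simp: b_def nonpos_polys_def intro!: nonpos_supp_prod)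
qed

text \<open>
  For an annihilator of \<open>\<alpha>\<close> of least degree \<open>d\<close> and with leading coefficient \<open>c\<close>, multiplication by
  \<open>c\<^sup>d\<^sup>-\<^sup>1\<close> makes it monic in \<open>c \<alpha>\<close>. The degree stays minimal, as annihilators of \<open>c \<alpha>\<close> give annihilators of \<open>\<alpha>\<close>
  of the same degree.
\<close>

lemma monic_separable_annihilator:
  fixes \<alpha> :: "'a::field_char_0 fls"
  assumes "algebraic_over_subfield ratfun_field \<alpha>"
  shows "\<exists>c\<in>nonpos_supp. c \<noteq> 0 \<and> (\<exists>P\<in>nonpos_polys. lead_coeff P = 1 \<and> poly P (c * \<alpha>) = 0 \<and>
    (\<exists>U\<in>nonpos_polys. \<exists>V\<in>nonpos_polys. \<exists>\<Delta>\<in>nonpos_supp. \<Delta> \<noteq> 0 \<and> U * P + V * pderiv P = [:\<Delta>:]))"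
proof -
  define ann where "ann P \<longleftrightarrow> P \<in> nonpos_polys \<and> P \<noteq> 0 \<and> poly P \<alpha> = 0" for P
  obtain P0 where P0: "\<forall>i. coeff P0 i \<in> ratfun_field" "P0 \<noteq> 0" "poly P0 \<alpha> = 0"
    using assms unfolding algebraic_over_subfield_def by blast
  obtain b where "b \<noteq> 0" "smult b P0 \<in> nonpos_polys"
    using ratfun_poly_clear_denominators[OF P0(1)] by blast
  then have "ann (smult b P0)" using P0 by (simp add: ann_def)
  then obtain P1 where P1: "ann P1" and min: "\<And>Q. ann Q \<Longrightarrow> degree P1 \<le> degree Q"
    by (metis arg_min_nat_lemma[of ann _ degree])
  define d where "d = degree P1"
  define c where "c = lead_coeff P1"
  have c: "c \<noteq> 0" "c \<in> nonpos_supp" using P1 by (auto simp: c_def ann_def nonpos_polys_def)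
  have d0: "d > 0"
  proof (rule ccontr)
    assume "\<not> d > 0"
    then obtain k where "P1 = [:k:]" unfolding d_def by (metis degree_eq_zeroE gr0I)
    then show False using P1 by (simp add: ann_def)
  qed
  define P where "P = monom 1 d + (\<Sum>i<d. monom (c ^ (d - 1 - i) * coeff P1 i) i)"
  have coeff_P: "coeff P i = (if i = d then 1 else if i < d then c ^ (d - 1 - i) * coeff P1 i else 0)" for i
    by (auto simp: P_def coeff_sum)
  have "degree P \<le> d" by (rule degree_le) (simp add: coeff_P)
  moreover have "d \<le> degree P" by (rule le_degree) (simp add: coeff_P)
  ultimately have degP: "degree P = d" by simp
  have "P \<noteq> 0" using coeff_P[of d] by auto
  moreover have "P \<in> nonpos_polys"
    using P1 c by (auto simp: nonpos_polys_def coeff_P ann_def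
        intro!: nonpos_supp_mult nonpos_supp_power)
  ultimately have Pn: "P \<in> nonpos_polys" "P \<noteq> 0" by blast+
  have "poly P (c * \<alpha>) = (c * \<alpha>) ^ d + (\<Sum>i<d. c ^ (d - 1 - i) * coeff P1 i * (c * \<alpha>) ^ i)"
    by (simp add: P_def poly_monom poly_sum)
  also have "\<dots> = c ^ (d - 1) * (c * \<alpha> ^ d + (\<Sum>i<d. coeff P1 i * \<alpha> ^ i))"
  proof -
    have "c ^ (d - 1 - i) * coeff P1 i * (c * \<alpha>) ^ i = c ^ (d - 1) * (coeff P1 i * \<alpha> ^ i)" if "i < d" for i
    proof -
      have "c ^ (d - 1) = c ^ (d - 1 - i) * c ^ i" using that by (simp flip: power_add)
      then show ?thesis by (simp add: power_mult_distrib)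
    qed
    then have "(\<Sum>i<d. c ^ (d - 1 - i) * coeff P1 i * (c * \<alpha>) ^ i) =
        (\<Sum>i<d. c ^ (d - 1) * (coeff P1 i * \<alpha> ^ i))"
      by (intro sum.cong refl) (simp only: lessThan_iff)
    moreover have "(c * \<alpha>) ^ d = c ^ (d - 1) * (c * \<alpha> ^ d)"
      using d0 by (cases d) (simp_all add: power_mult_distrib)
    ultimately show ?thesis by (simp only: distrib_left sum_distrib_left)
  qed
  also have "c * \<alpha> ^ d + (\<Sum>i<d. coeff P1 i * \<alpha> ^ i) = poly P1 \<alpha>"
    unfolding poly_altdef using d0
    by (simp add: d_def[symmetric] c_def lessThan_Suc_atMost[symmetric])
  also have "\<dots> = 0" using P1 by (simp add: ann_def)
  finally have root: "poly P (c * \<alpha>) = 0" by simp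
  have minP: "degree P \<le> degree Q" if Q: "Q \<in> nonpos_polys" "Q \<noteq> 0" "poly Q (c * \<alpha>) = 0" for Q
  proof -
    have "ann (pcompose Q [:0, c:])"
      using Q c by (auto simp: ann_def nonpos_polys_def coeff_pcompose_monom_linear poly_pcompose
          pcompose_eq_0_iff mult.commute intro!: nonpos_supp_mult nonpos_supp_power)
    from min[OF this] show ?thesis using c by (simp add: degP d_def)
  qed
  have lc: "lead_coeff P = 1" by (simp add: degP coeff_P)
  have sb: "\<exists>U\<in>nonpos_polys. \<exists>V\<in>nonpos_polys. \<exists>\<Delta>\<in>nonpos_supp. \<Delta> \<noteq> 0 \<and> U * P + V * pderiv P = [:\<Delta>:]"
    by (rule separable_bezout[OF Pn root]) (rule minP)
  show ?thesis
    by (intro sb c lc root Pn(1) bexI[of _ c] conjI bexI[of _ P])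
qed

lemma compose_map_ac_nonpos:
  assumes "f \<in> nonpos_supp" "e > 0"
  shows "fls_compose_power (map_ac f) e \<in> nonpos_supp"
proof -
  have "fls_nth (fls_compose_power (map_ac f) e) k = 0" if k: "k > 0" for k
  proof (cases "int e dvd k")
    case True
    then obtain j where j: "k = int e * j" by (elim dvdE)
    then have "j > 0" using k assms(2) by (simp add: zero_less_mult_iff)
    then show ?thesis
      using assms by (simp add: j fls_nth_compose_power nonpos_supp_def)
  qed (use assms in \<open>simp add: fls_nth_compose_power\<close>)
  then show ?thesis by (simp add: nonpos_supp_def)
qed

text \<open>
  Implicit differentiation of \<open>P(\<rho>) = 0\<close> gives \<open>P'(\<rho>) D \<rho> = - P\<^sup>D(\<rho>)\<close>, where \<open>D\<close> is the Euler derivation and \<open>P\<^sup>D\<close>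
  arises from \<open>P\<close> by deriving the coefficients. Multiplying by the cofactor of \<open>P'\<close> in the Bezout identity
  produces \<open>\<Delta> D \<rho>\<close> as a polynomial in \<open>\<rho>\<close>.
\<close>

lemma conjugates_exist:
  fixes \<alpha> :: "'a::field_char_0 fls"
  assumes "algebraic_over_subfield ratfun_field \<alpha>"
  obtains c :: "'a fls" and e d :: nat and \<rho> \<Delta> G
  where "c \<in> nonpos_supp" "c \<noteq> 0" "e > 0" "d > 0" "conjugates d \<rho> \<Delta> G"
    "\<rho> 0 = fls_compose_power (map_ac (c * \<alpha>)) e"
proof -
  obtain c P U V \<Delta> where c: "c \<in> nonpos_supp" "c \<noteq> 0" and P: "P \<in> nonpos_polys" "lead_coeff P = 1"
      "poly P (c * \<alpha>) = 0" and UV: "U \<in> nonpos_polys" "V \<in> nonpos_polys" "\<Delta> \<in> nonpos_supp" "\<Delta> \<noteq> 0"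
      "U * P + V * pderiv P = [:\<Delta>:]"
    using monic_separable_annihilator[OF assms] by blast
  interpret ac: inj_idom_hom "map_ac :: 'a fls \<Rightarrow> _" by (rule map_ac_hom)
  have "map_poly map_ac P \<noteq> 0" using P(2) by auto
  from newton_puiseux[OF this] obtain e rs where e: "e > 0"
    and rs: "cpoly e (map_poly map_ac P) =
      smult (lead_coeff (cpoly e (map_poly map_ac P))) (\<Prod>r\<leftarrow>rs. [:- r, 1:])" by blast
  define \<psi> where "\<psi> f = fls_compose_power (map_ac f) e" for f :: "'a fls"
  interpret cp: inj_idom_hom "\<lambda>f :: 'a alg_closure fls. fls_compose_power f e"
    by (rule compose_power_hom[OF e])
  interpret \<psi>: inj_idom_hom \<psi>
    by unfold_locales (simp_all add: \<psi>_def ac.hom_add ac.hom_mult e compose_power_eq_0_iff)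
  interpret \<psi>p: map_poly_inj_idom_hom \<psi> ..
  have \<psi>P: "cpoly e (map_poly map_ac P) = map_poly \<psi> P"
    by (rule poly_eqI) (simp add: coeff_map_poly \<psi>_def)
  have lead: "lead_coeff (map_poly \<psi> P) = 1" using P(2) by simp
  have split: "map_poly \<psi> P = (\<Prod>r\<leftarrow>rs. [:- r, 1:])"
    using rs unfolding \<psi>P lead by simp
  have \<psi>_nonpos: "\<psi> f \<in> nonpos_supp" if "f \<in> nonpos_supp" for f
    unfolding \<psi>_def using that e by (rule compose_map_ac_nonpos)
  have "poly (map_poly \<psi> P) (\<psi> (c * \<alpha>)) = 0" using P(3) by simp
  then have "\<psi> (c * \<alpha>) \<in> set rs"
    unfolding split by (induction rs) (auto simp: poly_mult)
  then obtain xs ys where xy: "rs = xs @ \<psi> (c * \<alpha>) # ys" by (meson split_list)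
  define rs' where "rs' = \<psi> (c * \<alpha>) # xs @ ys"
  define d where "d = length rs'"
  define \<rho> where "\<rho> i = rs' ! i" for i
  have prod: "(\<Prod>i<d. [:- \<rho> i, 1:]) = map_poly \<psi> P"
  proof -
    have "(\<Prod>i<d. [:- \<rho> i, 1:]) = (\<Prod>r\<leftarrow>rs'. [:- r, 1:])"
      by (simp add: d_def \<rho>_def prod.list_conv_set_nth atLeast0LessThan)
    also have "\<dots> = (\<Prod>r\<leftarrow>rs. [:- r, 1:])" by (simp only: rs'_def xy map_append list.map prod_list.append prod_list.Cons mult_ac)
    finally show ?thesis by (simp add: split)
  qed
  define G where "G = - (map_poly \<psi> V * map_poly euler (map_poly \<psi> P))"
  have \<psi>_polys: "map_poly \<psi> F \<in> nonpos_polys" if "F \<in> nonpos_polys" for F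
    using that by (auto simp: nonpos_polys_def coeff_map_poly intro: \<psi>_nonpos)
  have "conjugates d \<rho> (\<psi> \<Delta>) G"
  proof
    show "coeff (\<Prod>i<d. [:- \<rho> i, 1:]) j \<in> nonpos_supp" for j
      using \<psi>_polys[OF P(1)] unfolding prod by (simp add: nonpos_polys_def)
    show "\<psi> \<Delta> \<in> nonpos_supp" by (rule \<psi>_nonpos[OF UV(3)])
    show "\<psi> \<Delta> \<noteq> 0" using UV(4) by simp
    have "map_poly euler (map_poly \<psi> P) \<in> nonpos_polys"
      using \<psi>_polys[OF P(1)] by (auto simp: nonpos_polys_def coeff_map_poly euler_def intro: nonpos_supp_euler[unfolded euler_def])
    then have "G \<in> nonpos_polys"
      unfolding G_def by (intro nonpos_polys_uminus nonpos_polys_mult \<psi>_polys UV)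
    then show "coeff G j \<in> nonpos_supp" for j by (simp add: nonpos_polys_def)
    fix i assume i: "i < d"
    have root: "poly (map_poly \<psi> P) (\<rho> i) = 0"
      unfolding prod[symmetric] poly_prod using i by (intro prod_zero) auto
    interpret eu: derivation "euler :: 'a alg_closure fls \<Rightarrow> _" by (rule derivation_euler)
    have 1: "poly (map_poly euler (map_poly \<psi> P)) (\<rho> i) + poly (pderiv (map_poly \<psi> P)) (\<rho> i) * euler (\<rho> i) = 0"
      using eu.D_poly[of "map_poly \<psi> P" "\<rho> i"] root by simp
    have "map_poly \<psi> (U * P + V * pderiv P) = [:\<psi> \<Delta>:]"
      unfolding UV(5) by (rule poly_eqI) (simp add: coeff_map_poly coeff_pCons split: nat.splits)
    then have "map_poly \<psi> U * map_poly \<psi> P + map_poly \<psi> V * pderiv (map_poly \<psi> P) = [:\<psi> \<Delta>:]"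
      by (simp add: \<psi>p.hom_add \<psi>p.hom_mult \<psi>.map_poly_pderiv)
    from arg_cong[OF this, of "\<lambda>F. poly F (\<rho> i)"]
    have 2: "poly (map_poly \<psi> V) (\<rho> i) * poly (pderiv (map_poly \<psi> P)) (\<rho> i) = \<psi> \<Delta>"
      using root by simp
    have "\<psi> \<Delta> * euler (\<rho> i) = poly (map_poly \<psi> V) (\<rho> i) * (poly (pderiv (map_poly \<psi> P)) (\<rho> i) * euler (\<rho> i))"
      by (simp add: 2[symmetric])
    also have "poly (pderiv (map_poly \<psi> P)) (\<rho> i) * euler (\<rho> i) =
        - poly (map_poly euler (map_poly \<psi> P)) (\<rho> i)"
      using 1 by (simp add: add_eq_0_iff)
    finally show "\<psi> \<Delta> * euler (\<rho> i) = poly G (\<rho> i)" by (simp add: G_def)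
  qed
  then show thesis
    by (rule that[OF c e, rotated]) (simp_all add: d_def rs'_def \<rho>_def \<psi>_def)
qed

text \<open>
  Orders are multiplied by \<open>e\<close> under \<open>\<psi>\<close>, so the inequality for \<open>\<psi> (c \<alpha>)\<close> can be divided by \<open>e\<close>. The factor \<open>c\<close>
  costs a constant, which \<open>A\<close> absorbs since \<open>1 / \<epsilon> \<ge> 1\<close>.
\<close>

theorem roth_algebraic:
  fixes \<alpha> :: "'a::field_char_0 fls"
  assumes "algebraic_over_subfield ratfun_field \<alpha>"
  shows "\<exists>A::real\<ge>0. \<exists>b::nat. \<forall>\<epsilon>::real. 0 < \<epsilon> \<longrightarrow> \<epsilon> \<le> 1 \<longrightarrow>
    (\<forall>p\<in>nonpos_supp. \<forall>q\<in>nonpos_supp. q \<noteq> 0 \<longrightarrow> p - q * \<alpha> \<noteq> 0 \<longrightarrow>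
      fls_subdegree (p - q * \<alpha>) \<le> (1 + \<epsilon>) * (- fls_subdegree q) + A * (1 / \<epsilon>) ^ b)"
proof -
  obtain c e d \<rho> \<Delta> G where c: "c \<in> nonpos_supp" "c \<noteq> 0" and e: "e > 0" and d: "d > 0"
    and conj: "conjugates d \<rho> \<Delta> G" and \<rho>0: "\<rho> 0 = fls_compose_power (map_ac (c * \<alpha>)) e"
    by (rule conjugates_exist[OF assms])
  interpret conjugates d \<rho> \<Delta> G by (rule conj)
  define \<psi> where "\<psi> f = fls_compose_power (map_ac f) e" for f :: "'a fls"
  interpret ac: inj_idom_hom "map_ac :: 'a fls \<Rightarrow> _" by (rule map_ac_hom)
  interpret \<psi>: inj_idom_hom \<psi>
    by unfold_locales (simp_all add: \<psi>_def ac.hom_add ac.hom_mult e compose_power_eq_0_iff)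
  have sub: "fls_subdegree (\<psi> f) = int e * fls_subdegree f" for f
    using e by (simp add: \<psi>_def subdegree_compose_power)
  obtain A b where A: "A \<ge> 0" and roth: "\<And>\<epsilon>::real. \<And>p q. 0 < \<epsilon> \<Longrightarrow> \<epsilon> \<le> 1 \<Longrightarrow>
      p \<in> nonpos_supp \<Longrightarrow> q \<in> nonpos_supp \<Longrightarrow> q \<noteq> 0 \<Longrightarrow> p - q * \<rho> 0 \<noteq> 0 \<Longrightarrow>
      fls_subdegree (p - q * \<rho> 0) \<le> (1 + \<epsilon>) * (- fls_subdegree q) + A * (1 / \<epsilon>) ^ b"
    using effective_roth[OF d] by blast
  define A' where "A' = A - fls_subdegree c"
  have c0: "fls_subdegree c \<le> 0" by (rule nonpos_supp_subdegree[OF c(1)])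
  have A': "A' \<ge> 0" using A c0 by (simp add: A'_def)
  show ?thesis
  proof (rule exI[of _ A'], rule conjI[OF A'], rule exI[of _ b], intro allI impI ballI)
    fix \<epsilon> :: real and p q :: "'a fls"
    assume \<epsilon>: "0 < \<epsilon>" "\<epsilon> \<le> 1" and pq: "p \<in> nonpos_supp" "q \<in> nonpos_supp" "q \<noteq> 0"
      and ne: "p - q * \<alpha> \<noteq> 0"
    have eq: "\<psi> (c * p) - \<psi> q * \<rho> 0 = \<psi> (c * (p - q * \<alpha>))"
      unfolding \<rho>0 \<psi>_def[symmetric] by (simp add: \<psi>.hom_mult \<psi>.hom_minus algebra_simps)
    have "\<psi> (c * p) \<in> nonpos_supp" "\<psi> q \<in> nonpos_supp"
      unfolding \<psi>_def using c(1) pq(1,2) e by (auto intro!: compose_map_ac_nonpos nonpos_supp_mult)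
    from roth[OF \<epsilon> this] have "real_of_int (fls_subdegree (\<psi> (c * (p - q * \<alpha>)))) \<le>
        (1 + \<epsilon>) * (- fls_subdegree (\<psi> q)) + A * (1 / \<epsilon>) ^ b"
      unfolding eq using c(2) pq(3) ne by simp
    moreover have "fls_subdegree (c * (p - q * \<alpha>)) = fls_subdegree c + fls_subdegree (p - q * \<alpha>)"
      using c(2) ne by (rule fls_subdegree_mult)
    ultimately have "real e * (fls_subdegree c + fls_subdegree (p - q * \<alpha>)) \<le>
        (1 + \<epsilon>) * (real e * (- fls_subdegree q)) + A * (1 / \<epsilon>) ^ b"
      by (simp add: sub)
    also have "\<dots> \<le> (1 + \<epsilon>) * (real e * (- fls_subdegree q)) + real e * (A * (1 / \<epsilon>) ^ b)"
    proof -
      have "1 * (A * (1 / \<epsilon>) ^ b) \<le> real e * (A * (1 / \<epsilon>) ^ b)"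
        using e A \<epsilon> by (intro mult_right_mono) auto
      then show ?thesis by simp
    qed
    also have "\<dots> = real e * ((1 + \<epsilon>) * (- fls_subdegree q) + A * (1 / \<epsilon>) ^ b)"
      by (simp only: distrib_left mult_ac)
    finally have "fls_subdegree c + fls_subdegree (p - q * \<alpha>) \<le>
        (1 + \<epsilon>) * (- fls_subdegree q) + A * (1 / \<epsilon>) ^ b"
      using e by (simp only: mult_le_cancel_left_pos of_nat_0_less_iff of_int_add)
    moreover have "- real_of_int (fls_subdegree c) * 1 \<le> - real_of_int (fls_subdegree c) * (1 / \<epsilon>) ^ b"
      using c0 \<epsilon> by (intro mult_left_mono one_le_power) auto
    ultimately show "fls_subdegree (p - q * \<alpha>) \<le> (1 + \<epsilon>) * (- fls_subdegree q) + A' * (1 / \<epsilon>) ^ b"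
      by (simp add: A'_def left_diff_distrib)
  qed
qed

theorem liouville_algebraic:
  fixes \<alpha> :: "'a::field_char_0 fls"
  assumes "algebraic_over_subfield ratfun_field \<alpha>"
  shows "\<exists>c1\<ge>0. \<exists>c2. \<forall>Q\<in>nonpos_polys. \<forall>h\<ge>0. degree Q \<le> 2 \<longrightarrow> (\<forall>j. ord_ge (coeff Q j) (- h)) \<longrightarrow>
    poly Q \<alpha> \<noteq> 0 \<longrightarrow> fls_subdegree (poly Q \<alpha>) \<le> c1 * h + c2"
proof -
  obtain c e d \<rho> \<Delta> G where c: "c \<in> nonpos_supp" "c \<noteq> 0" and e: "e > 0" and d: "d > 0"
    and conj: "conjugates d \<rho> \<Delta> G" and \<rho>0: "\<rho> 0 = fls_compose_power (map_ac (c * \<alpha>)) e"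
    by (rule conjugates_exist[OF assms])
  interpret conjugates d \<rho> \<Delta> G by (rule conj)
  define \<psi> where "\<psi> f = fls_compose_power (map_ac f) e" for f :: "'a fls"
  interpret ac: inj_idom_hom "map_ac :: 'a fls \<Rightarrow> _" by (rule map_ac_hom)
  interpret \<psi>: inj_idom_hom \<psi>
    by unfold_locales (simp_all add: \<psi>_def ac.hom_add ac.hom_mult e compose_power_eq_0_iff)
  have sub: "fls_subdegree (\<psi> f) = int e * fls_subdegree f" for f
    using e by (simp add: \<psi>_def subdegree_compose_power)
  define v where "v = - fls_subdegree c"
  have v: "v \<ge> 0" using nonpos_supp_subdegree[OF c(1)] by (simp add: v_def)
  define K where "K = int (d - 1) * (2 * int e * v + 2 * root_size) + Delta_deg * (int d)\<^sup>2 + 2 * int e * v"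
  have K0: "K \<ge> 0" unfolding K_def using v root_size_nonneg Delta_deg_nonneg
    by (intro add_nonneg_nonneg mult_nonneg_nonneg) auto
  show ?thesis
  proof (rule exI[of _ "int (d - 1)"], rule conjI, simp, rule exI[of _ K], intro ballI allI impI)
    fix Q :: "'a fls poly" and h :: int
    assume Q: "Q \<in> nonpos_polys" "degree Q \<le> 2" and h: "0 \<le> h" "\<forall>j. ord_ge (coeff Q j) (- h)"
      and ne: "poly Q \<alpha> \<noteq> 0"
    \<comment> \<open>The coefficients of the polynomial that takes the value \<open>c\<^sup>2 Q(\<alpha>)\<close> at \<open>c \<alpha>\<close>.\<close>
    define C where "C j = c ^ (2 - j) * coeff Q j" for j
    define Q' where "Q' = (\<Sum>j\<le>2. monom (\<psi> (C j)) j)"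
    have coeff_Q': "coeff Q' j = (if j \<le> 2 then \<psi> (C j) else 0)" for j
      by (simp add: Q'_def coeff_sum)
    have Cj: "ord_ge (C j) (- (h + 2 * v))" for j
    proof -
      have "ord_ge (c ^ (2 - j)) (int (2 - j) * - v)"
        by (intro ord_ge_power) (simp add: v_def)
      then have "ord_ge (C j) (int (2 - j) * - v + - h)"
        unfolding C_def using h(2) by (intro ord_ge_mult) auto
      moreover have "int (2 - j) * v \<le> 2 * v" using v by (intro mult_right_mono) auto
      ultimately show ?thesis by (auto intro: ord_ge_mono)
    qed
    have deg': "degree Q' \<le> 2" by (rule degree_le) (simp add: coeff_Q')
    have np': "coeff Q' j \<in> nonpos_supp" for j
      using Q(1) c(1) e unfolding coeff_Q'
      by (auto simp: \<psi>_def C_def nonpos_polys_def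
          intro!: compose_map_ac_nonpos nonpos_supp_mult nonpos_supp_power)
    have ord': "ord_ge (coeff Q' j) (- (int e * (h + 2 * v)))" for j
    proof (cases "C j = 0")
      case False
      then have "- (h + 2 * v) \<le> fls_subdegree (C j)" using Cj[of j] by (simp add: ord_ge_iff)
      then have "int e * - (h + 2 * v) \<le> int e * fls_subdegree (C j)"
        by (intro mult_left_mono) auto
      then show ?thesis by (simp add: coeff_Q' ord_ge_iff sub algebra_simps)
    qed (simp add: coeff_Q')
    have val: "poly Q' (\<rho> 0) = \<psi> (c ^ 2 * poly Q \<alpha>)"
    proof -
      have "poly Q' (\<rho> 0) = (\<Sum>j\<le>2. \<psi> (C j * (c * \<alpha>) ^ j))"
        unfolding Q'_def poly_sum poly_monom \<rho>0 \<psi>_def[symmetric]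
        by (simp add: \<psi>.hom_mult \<psi>.hom_power)
      also have "\<dots> = \<psi> (\<Sum>j\<le>2. C j * (c * \<alpha>) ^ j)" by (simp add: \<psi>.hom_sum)
      also have "(\<Sum>j\<le>2. C j * (c * \<alpha>) ^ j) = (\<Sum>j\<le>2. c ^ 2 * (coeff Q j * \<alpha> ^ j))"
      proof (intro sum.cong refl)
        fix j :: nat assume "j \<in> {..2}"
        then have "c ^ 2 = c ^ (2 - j) * c ^ j" by (simp flip: power_add)
        then show "C j * (c * \<alpha>) ^ j = c ^ 2 * (coeff Q j * \<alpha> ^ j)"
          by (simp add: C_def power_mult_distrib)
      qed
      also have "\<dots> = c ^ 2 * poly Q \<alpha>"
        unfolding sum_distrib_left[symmetric] poly_altdef
        using Q(2) by (intro arg_cong[of _ _ "(*) (c ^ 2)"] sum.mono_neutral_right)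
          (auto simp: coeff_eq_0)
      finally show ?thesis .
    qed
    have ne': "poly Q' (\<rho> 0) \<noteq> 0" unfolding val using ne c(2) by simp
    have h': "int e * (h + 2 * v) \<ge> 0" using h(1) v by simp
    from liouville[OF d np' deg' ord' h' ne']
    have "int e * fls_subdegree (c ^ 2 * poly Q \<alpha>) \<le>
        int (d - 1) * (int e * (h + 2 * v) + 2 * root_size) + Delta_deg * (int d)\<^sup>2"
      by (simp add: val sub)
    moreover have "fls_subdegree (c ^ 2 * poly Q \<alpha>) = - 2 * v + fls_subdegree (poly Q \<alpha>)"
      using c(2) ne by (simp add: v_def fls_subdegree_pow)
    then have "int e * fls_subdegree (poly Q \<alpha>) = int e * fls_subdegree (c ^ 2 * poly Q \<alpha>) + 2 * int e * v"
      by (simp add: right_diff_distrib)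
    moreover have "int (d - 1) * (int e * (h + 2 * v) + 2 * root_size) =
        int e * (int (d - 1) * h) + int (d - 1) * (2 * int e * v + 2 * root_size)"
      by (simp only: distrib_left distrib_right mult_ac)
    ultimately have "int e * fls_subdegree (poly Q \<alpha>) \<le> int e * (int (d - 1) * h) + K"
      unfolding K_def by linarith
    also have "\<dots> \<le> int e * (int (d - 1) * h) + int e * K"
      using K0 e mult_right_mono[of 1 "int e" K] by simp
    also have "\<dots> = int e * (int (d - 1) * h + K)" by (simp add: distrib_left)
    finally show "fls_subdegree (poly Q \<alpha>) \<le> int (d - 1) * h + K"
      using e by (simp only: mult_le_cancel_left_pos of_nat_0_less_iff)
  qed
qed

section \<open>Continued fractions of Laurent series\<close>

lemma poly_in_T_hom: "comm_ring_hom (poly_in_T :: 'a::field poly \<Rightarrow> _)"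
proof -
  interpret fc: comm_ring_hom "fls_const :: 'a \<Rightarrow> _" by (rule fls_const_hom)
  interpret map_poly_comm_ring_hom "fls_const :: 'a \<Rightarrow> _" ..
  show ?thesis
    by unfold_locales (simp_all add: poly_in_T_def hom_add hom_mult)
qed

lemma ord_ge_minus_floor: "ord_ge (x - poly_in_T (floor_T x)) 1"
  by (auto simp: ord_ge_def nth_floor_T)

locale infinite_continued_fraction =
  fixes \<alpha> :: "'a::field fls"
  assumes infinite: "infinite_cf \<alpha>"
begin

abbreviation cq :: "nat \<Rightarrow> 'a fls" where "cq \<equiv> complete_quotient \<alpha>"

definition quot :: "nat \<Rightarrow> 'a fls" where "quot n = poly_in_T (partial_quotient \<alpha> n)"

definition quot_deg :: "nat \<Rightarrow> int" where "quot_deg n = - fls_subdegree (cq n)"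

definition denom_deg :: "nat \<Rightarrow> int" where "denom_deg n = (\<Sum>j=1..n. quot_deg j)"

definition denom :: "nat \<Rightarrow> 'a fls" where "denom n = poly_in_T (shifted_denom (partial_quotient \<alpha>) n)"

text \<open>
  As for the denominators, indices are shifted by two: \<open>numer (i + 2)\<close> and \<open>denom (i + 2)\<close> belong to the
  \<open>i\<close>-th convergent, and \<open>denom_deg i\<close> is the degree of \<open>denom (i + 2)\<close>.
\<close>

fun numer :: "nat \<Rightarrow> 'a fls" where
  "numer 0 = 0"
| "numer (Suc 0) = 1"
| "numer (Suc (Suc n)) = quot n * numer (Suc n) + numer n"

definition err :: "nat \<Rightarrow> 'a fls" where "err n = denom n * \<alpha> - numer n"

lemma quot_nonpos [simp]: "quot n \<in> nonpos_supp"
  by (simp add: quot_def)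

lemma cq_neq_quot: "cq n - quot n \<noteq> 0"
  using infinite by (simp add: infinite_cf_def quot_def)

lemma cq_Suc: "cq (Suc n) = 1 / (cq n - quot n)"
  by (simp add: quot_def partial_quotient_def)

lemma cq_Suc_nonzero: "cq (Suc n) \<noteq> 0"
  unfolding cq_Suc using cq_neq_quot[of n] by simp

lemma ord_ge_cq_minus_quot: "ord_ge (cq n - quot n) 1"
  using ord_ge_minus_floor[of "cq n"] by (simp add: quot_def partial_quotient_def)

lemma quot_deg_Suc_pos: "quot_deg (Suc n) \<ge> 1"
proof -
  have "1 \<le> fls_subdegree (cq n - quot n)"
    using ord_ge_cq_minus_quot[of n] cq_neq_quot[of n] by (simp add: ord_ge_iff)
  then show ?thesis
    unfolding quot_deg_def cq_Suc using cq_neq_quot[of n] by (simp add: fls_divide_subdegree)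
qed

lemma quot_deg_pos: "n > 0 \<Longrightarrow> quot_deg n \<ge> 1"
  using quot_deg_Suc_pos by (cases n) auto

lemma subdegree_quot: "n > 0 \<Longrightarrow> fls_subdegree (quot n) = - quot_deg n" and quot_nonzero: "n > 0 \<Longrightarrow> quot n \<noteq> 0"
proof -
  assume n: "n > 0"
  obtain m where m: "n = Suc m" using n by (cases n) auto
  have nz: "fls_nth (cq n) (- quot_deg n) \<noteq> 0" using cq_Suc_nonzero[of m] by (simp add: quot_deg_def m)
  have eq: "fls_nth (quot n) k = fls_nth (cq n) k" if "k \<le> 0" for k
    using that nth_floor_T[of "cq n" k] by (simp add: quot_def partial_quotient_def)
  have d: "quot_deg n \<ge> 1" using quot_deg_pos[OF n] .
  show "fls_subdegree (quot n) = - quot_deg n"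
  proof (rule fls_subdegree_eqI)
    show "fls_nth (quot n) (- quot_deg n) \<noteq> 0" using eq nz d by simp
    show "fls_nth (quot n) k = 0" if "k < - quot_deg n" for k using that eq d by (simp add: quot_deg_def)
  qed
  then show "quot n \<noteq> 0" using d by auto
qed

lemma denom_simps [simp]: "denom 0 = 1" "denom (Suc 0) = 0" "denom (Suc (Suc n)) = quot n * denom (Suc n) + denom n"
proof -
  interpret h: comm_ring_hom "poly_in_T :: 'a poly \<Rightarrow> _" by (rule poly_in_T_hom)
  show "denom 0 = 1" "denom (Suc 0) = 0" "denom (Suc (Suc n)) = quot n * denom (Suc n) + denom n"
    by (simp_all add: denom_def quot_def h.hom_add h.hom_mult)
qed

lemma denom_nonpos [simp]: "denom n \<in> nonpos_supp"
  by (simp add: denom_def)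

lemma numer_nonpos [simp]: "numer n \<in> nonpos_supp"
  by (induction n rule: numer.induct) (auto intro!: nonpos_supp_add nonpos_supp_mult)

lemma err_simps: "err 0 = \<alpha>" "err (Suc 0) = - 1" "err (Suc (Suc n)) = quot n * err (Suc n) + err n"
  by (simp_all add: err_def algebra_simps)

lemma err_cq: "err n = - cq n * err (Suc n)"
proof (induction n)
  case 0
  then show ?case by (simp add: err_simps)
next
  case (Suc n)
  have "err (Suc (Suc n)) = - (cq n - quot n) * err (Suc n)"
    using Suc.IH by (simp add: err_simps algebra_simps)
  moreover have "- (1 / z) * (- z * x) = x" if "z \<noteq> 0" for z x :: "'a fls"
    using that by simp
  ultimately show ?case unfolding cq_Suc using cq_neq_quot[of n] by metis
qed

lemma denom_deg_simps [simp]: "denom_deg 0 = 0" "denom_deg (Suc n) = denom_deg n + quot_deg (Suc n)"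
  by (simp_all add: denom_deg_def)

lemma denom_deg_nonneg: "denom_deg n \<ge> 0"
proof (induction n)
  case (Suc n)
  then show ?case using quot_deg_Suc_pos[of n] by simp
qed simp

lemma denom_deg_mono: "m \<le> n \<Longrightarrow> denom_deg m \<le> denom_deg n"
proof (induction n rule: dec_induct)
  case (step n)
  then show ?case using quot_deg_Suc_pos[of n] by simp
qed simp

lemma subdegree_err: "err (Suc n) \<noteq> 0 \<and> fls_subdegree (err (Suc n)) = denom_deg n"
proof (induction n)
  case 0
  then show ?case by (simp add: err_simps)
next
  case (Suc n)
  have eq: "err (Suc n) = - cq (Suc n) * err (Suc (Suc n))" by (rule err_cq)
  then have nz: "err (Suc (Suc n)) \<noteq> 0" using Suc.IH by auto
  have "fls_subdegree (err (Suc n)) = fls_subdegree (cq (Suc n)) + fls_subdegree (err (Suc (Suc n)))"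
    unfolding eq using nz cq_Suc_nonzero[of n]
    by (simp del: complete_quotient.simps)
  then show ?case using nz Suc.IH by (simp add: quot_deg_def)
qed

lemma denom_subdegree_aux:
  "denom (Suc (Suc n)) \<noteq> 0 \<and> fls_subdegree (denom (Suc (Suc n))) = - denom_deg n \<and> ord_ge (denom (Suc n)) (- denom_deg n + 1)"
proof (induction n)
  case 0
  then show ?case by simp
next
  case (Suc n)
  let ?x = "quot (Suc n) * denom (Suc (Suc n))" and ?y = "denom (Suc n)"
  have x: "?x \<noteq> 0" "fls_subdegree ?x = - denom_deg (Suc n)"
    using Suc.IH quot_nonzero[of "Suc n"] subdegree_quot[of "Suc n"] by (simp_all del: denom_simps)
  have d: "quot_deg (Suc n) \<ge> 1" by (rule quot_deg_Suc_pos)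
  have sum: "?x + ?y \<noteq> 0 \<and> fls_subdegree (?x + ?y) = - denom_deg (Suc n)"
  proof (cases "?y = 0")
    case False
    then have lt: "fls_subdegree ?x < fls_subdegree ?y"
      using Suc.IH x d by (simp add: ord_ge_iff del: denom_simps)
    then have "fls_subdegree (?x + ?y) = fls_subdegree ?x"
      using x(1) by (intro fls_subdegree_add_eq1)
    moreover have "fls_nth (?x + ?y) (fls_subdegree ?x) \<noteq> 0"
      using lt x(1) by (simp del: denom_simps)
    ultimately show ?thesis using x(2) by (metis fls_zero_nth)
  qed (use x in simp)
  have "ord_ge (denom (Suc (Suc n))) (- denom_deg (Suc n) + 1)"
    using Suc.IH d by (simp add: ord_ge_iff del: denom_simps)
  with sum show ?case unfolding denom_simps(3)[of "Suc n"] by blast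
qed

lemma subdegree_denom: "denom (Suc (Suc n)) \<noteq> 0" "fls_subdegree (denom (Suc (Suc n))) = - denom_deg n"
  using denom_subdegree_aux by blast+

lemma ord_ge_denom: "ord_ge (denom (Suc n)) (- denom_deg (n - 1))"
proof (cases n)
  case (Suc m)
  then show ?thesis using subdegree_denom[of m] by (simp add: ord_ge_iff)
qed simp

lemma ord_ge_numer: "ord_ge (numer (Suc n)) (- (denom_deg (n - 1) + \<bar>fls_subdegree \<alpha>\<bar>))"
proof -
  have "numer (Suc n) = denom (Suc n) * \<alpha> - err (Suc n)" by (simp add: err_def)
  moreover have "ord_ge (denom (Suc n) * \<alpha>) (- denom_deg (n - 1) + fls_subdegree \<alpha>)"
    by (intro ord_ge_mult ord_ge_denom) simp
  then have "ord_ge (denom (Suc n) * \<alpha>) (- (denom_deg (n - 1) + \<bar>fls_subdegree \<alpha>\<bar>))"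
    by (rule ord_ge_mono) simp
  moreover have "ord_ge (err (Suc n)) (- (denom_deg (n - 1) + \<bar>fls_subdegree \<alpha>\<bar>))"
    using subdegree_err[of n] denom_deg_nonneg[of n] denom_deg_nonneg[of "n - 1"] by (simp add: ord_ge_iff)
  ultimately show ?thesis by (simp add: ord_ge_diff)
qed

lemma determinant_nonzero: "numer n * denom (Suc n) - numer (Suc n) * denom n \<noteq> 0"
proof (induction n)
  case (Suc n)
  have "numer (Suc n) * denom (Suc (Suc n)) - numer (Suc (Suc n)) * denom (Suc n) =
      - (numer n * denom (Suc n) - numer (Suc n) * denom n)"
    by (simp add: algebra_simps)
  then show ?case using Suc.IH by simp
qed simp

lemma not_rational: "\<alpha> \<notin> ratfun_field"
proof
  assume "\<alpha> \<in> ratfun_field"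
  then obtain a b where ab: "a \<in> nonpos_supp" "b \<in> nonpos_supp" "b \<noteq> 0" "\<alpha> = a / b"
    unfolding mem_ratfun_field_iff by blast
  define n where "n = nat (- fls_subdegree b) + 1"
  have "int n \<le> denom_deg n"
  proof (induction n)
    case (Suc n)
    then show ?case using quot_deg_Suc_pos[of n] by simp
  qed simp
  have ba: "b * \<alpha> = a" using ab(3) by (subst ab(4)) simp
  have "b * err (Suc n) = denom (Suc n) * (b * \<alpha>) - numer (Suc n) * b"
    by (simp add: err_def algebra_simps)
  also have "\<dots> = denom (Suc n) * a - numer (Suc n) * b" unfolding ba ..
  also have "\<dots> \<in> nonpos_supp" using ab(1,2) by (intro nonpos_supp_diff nonpos_supp_mult) auto
  finally have "fls_subdegree (b * err (Suc n)) \<le> 0" by (rule nonpos_supp_subdegree)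
  then have "fls_subdegree b + denom_deg n \<le> 0" using subdegree_err[of n] ab(3) by simp
  moreover have "- fls_subdegree b < int n" by (simp add: n_def)
  ultimately show False using \<open>int n \<le> denom_deg n\<close> by linarith
qed

text \<open>
  The difference of two complete quotients with the same polynomial part is, up to sign, the difference
  of the next ones divided by their product; so each common partial quotient adds twice its degree to
  the order.
\<close>

lemma common_prefix_close:
  assumes "\<And>i. i \<le> L \<Longrightarrow> partial_quotient \<alpha> (m + i) = partial_quotient \<alpha> (n + i)"
  shows "ord_ge (cq m - cq n) (2 * (denom_deg (n + L) - denom_deg n))"
  using assms
proof (induction L arbitrary: m n)
  case 0
  have "cq m - cq n = (cq m - quot m) - (cq n - quot n)"
    using 0[of 0] by (simp add: quot_def)
  also have "ord_ge \<dots> 1" by (intro ord_ge_diff ord_ge_cq_minus_quot)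
  finally show ?case by (auto intro: ord_ge_mono)
next
  case (Suc L)
  have IH: "ord_ge (cq (Suc m) - cq (Suc n)) (2 * (denom_deg (Suc n + L) - denom_deg (Suc n)))"
    using Suc.prems[of "Suc _"] by (intro Suc.IH) simp
  have dd: "quot_deg (Suc m) = quot_deg (Suc n)"
    using Suc.prems[of 1] subdegree_quot[of "Suc m"] subdegree_quot[of "Suc n"] by (simp add: quot_def)
  have inv: "cq k - quot k = 1 / cq (Suc k)" for k by (simp only: cq_Suc) simp
  have "cq m - cq n = (cq m - quot m) - (cq n - quot n)"
    using Suc.prems[of 0] by (simp add: quot_def)
  also have "\<dots> = (cq (Suc n) - cq (Suc m)) * (inverse (cq (Suc m)) * inverse (cq (Suc n)))"
    unfolding inv using cq_Suc_nonzero[of m] cq_Suc_nonzero[of n] by (simp add: field_simps del: complete_quotient.simps)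
  finally have eq: "cq m - cq n = - (cq (Suc m) - cq (Suc n)) * (inverse (cq (Suc m)) * inverse (cq (Suc n)))"
    by simp
  have "ord_ge (inverse (cq (Suc m)) * inverse (cq (Suc n))) (quot_deg (Suc m) + quot_deg (Suc n))"
    by (intro ord_ge_mult) (simp_all add: ord_ge_iff quot_deg_def del: complete_quotient.simps)
  from ord_ge_mult[OF ord_ge_uminus[OF IH] this] show ?case
    unfolding eq by (simp add: dd algebra_simps)
qed

end

section \<open>Quasi-periodic continued fractions\<close>

locale quasi_periodic_algebraic =
  fixes \<alpha> :: "'a::field_char_0 fls" and l r n :: "nat \<Rightarrow> nat"
  assumes qp: "quasi_periodic_cf \<alpha> l r n"
    and alg: "algebraic_over_subfield ratfun_field \<alpha>"
    and not_quadratic: "algebraic_degree ratfun_field \<alpha> \<noteq> 2"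
begin

sublocale infinite_continued_fraction \<alpha>
  using qp by unfold_locales (simp add: quasi_periodic_cf_def)

lemma nonpos_ratfun: "f \<in> nonpos_supp \<Longrightarrow> f \<in> ratfun_field"
  unfolding mem_ratfun_field_iff by (intro bexI[of _ f] bexI[of _ 1]) auto

lemma ratfun_divide_nonpos: "f \<in> nonpos_supp \<Longrightarrow> g \<in> nonpos_supp \<Longrightarrow> g \<noteq> 0 \<Longrightarrow> f / g \<in> ratfun_field"
  unfolding mem_ratfun_field_iff by blast

lemma low_degree_no_root:
  assumes Q: "Q \<in> nonpos_polys" "Q \<noteq> 0" "degree Q \<le> 2"
  shows "poly Q \<alpha> \<noteq> 0"
proof
  assume root: "poly Q \<alpha> = 0"
  define P where "P d \<longleftrightarrow> (\<exists>F. (\<forall>i. coeff F i \<in> ratfun_field) \<and> F \<noteq> 0 \<and> poly F \<alpha> = 0 \<and> degree F = d)" for d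
  have "P (degree Q)"
    using Q root nonpos_ratfun by (auto simp: P_def nonpos_polys_def)
  then have le: "algebraic_degree ratfun_field \<alpha> \<le> 2" and P: "P (algebraic_degree ratfun_field \<alpha>)"
    unfolding algebraic_degree_def P_def[symmetric] using Q(3)
    by (auto intro: LeastI order.trans[OF Least_le])
  then have "algebraic_degree ratfun_field \<alpha> \<le> 1" using not_quadratic by linarith
  with P obtain F0 where F0: "\<forall>i. coeff F0 i \<in> ratfun_field" "F0 \<noteq> 0" "poly F0 \<alpha> = 0" "degree F0 \<le> 1"
    unfolding P_def by auto
  obtain b where b: "b \<noteq> 0" "smult b F0 \<in> nonpos_polys"
    using ratfun_poly_clear_denominators[OF F0(1)] by blast
  define F where "F = smult b F0"
  have F: "F \<in> nonpos_polys" "F \<noteq> 0" "poly F \<alpha> = 0" "degree F \<le> 1"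
    using F0 b by (auto simp: F_def)
  have Feq: "F = [:coeff F 0, coeff F 1:]"
    using F(4) by (intro poly_eqI) (auto simp: coeff_pCons coeff_eq_0 split: nat.splits)
  have "poly F \<alpha> = coeff F 0 + \<alpha> * coeff F 1" by (subst Feq) simp
  then have eq: "coeff F 0 + \<alpha> * coeff F 1 = 0" using F(3) by simp
  have c1: "coeff F 1 \<noteq> 0"
  proof
    assume "coeff F 1 = 0"
    then have "F = 0" using eq Feq by simp
    then show False using F(2) by simp
  qed
  have "\<alpha> * coeff F 1 = - coeff F 0" using eq by (simp add: add_eq_0_iff)
  then have "\<alpha> = - coeff F 0 / coeff F 1" by (simp only: nonzero_eq_divide_eq[OF c1])
  also have "\<dots> \<in> ratfun_field"
    using F(1) c1 by (intro ratfun_divide_nonpos) (auto simp: nonpos_polys_def nonpos_supp_uminus)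
  finally show False using not_rational by simp
qed

text \<open>
  The expression is the value at \<open>\<alpha>\<close> of \<open>Q = L\<^sub>m L\<^sub>k\<^sub>+\<^sub>1 - L\<^sub>m\<^sub>+\<^sub>1 L\<^sub>k\<close> with the linear forms \<open>L\<^sub>j = q\<^sub>j X - p\<^sub>j\<close>, as
  \<open>err j = - cq j * err (j + 1)\<close>. The polynomial \<open>Q\<close> is not zero because at the root of \<open>L\<^sub>m\<^sub>+\<^sub>1\<close> it takes the
  value \<open>L\<^sub>m L\<^sub>k\<^sub>+\<^sub>1\<close>, and different convergents are different fractions.
\<close>

lemma quadratic_form_bound:
  "\<exists>c1\<ge>0. \<exists>c2\<ge>0. \<forall>m k. m > 0 \<longrightarrow> k > m \<longrightarrow> cq k \<noteq> cq m \<and>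
    fls_subdegree ((cq k - cq m) * err (Suc m) * err (Suc k)) \<le> c1 * (denom_deg (m - 1) + denom_deg (k - 1)) + c2"
proof -
  obtain c1 c2 where c1: "c1 \<ge> 0" and L: "\<And>Q h. Q \<in> nonpos_polys \<Longrightarrow> h \<ge> 0 \<Longrightarrow> degree Q \<le> 2 \<Longrightarrow>
      (\<And>j. ord_ge (coeff Q j) (- h)) \<Longrightarrow> poly Q \<alpha> \<noteq> 0 \<Longrightarrow> fls_subdegree (poly Q \<alpha>) \<le> c1 * h + c2"
    using liouville_algebraic[OF alg] by blast
  define a where "a = \<bar>fls_subdegree \<alpha>\<bar>"
  show ?thesis
  proof (rule exI[of _ c1], rule conjI[OF c1], rule exI[of _ "c1 * (2 * a) + \<bar>c2\<bar>"], rule conjI,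
      use c1 a_def in simp, intro allI impI)
    fix m k :: nat assume m: "m > 0" and k: "m < k"
    define h where "h = denom_deg (m - 1) + denom_deg (k - 1) + 2 * a"
    have h0: "h \<ge> 0" using denom_deg_nonneg by (simp add: h_def a_def)
    define lin where "lin j = [:- numer j, denom j:]" for j
    have lin_val: "poly (lin j) \<alpha> = err j" for j by (simp add: lin_def err_def mult.commute)
    define Q where "Q = lin m * lin (Suc k) - lin (Suc m) * lin k"
    have lin_n: "lin j \<in> nonpos_polys" for j
      by (auto simp: lin_def nonpos_polys_def coeff_pCons nonpos_supp_uminus split: nat.splits)
    have Qn: "Q \<in> nonpos_polys"
      unfolding Q_def by (intro nonpos_polys_diff nonpos_polys_mult lin_n)
    have dl: "degree (lin i * lin j) \<le> 2" for i j
      using degree_mult_le[of "lin i" "lin j"] by (auto simp: lin_def split: if_splits)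
    have dQ: "degree Q \<le> 2" unfolding Q_def by (intro degree_diff_le dl)
    have lin_o: "ord_ge (coeff (lin (Suc j)) i) (- (denom_deg (j - 1) + a))" for i j
    proof (cases i)
      case 0
      then show ?thesis using ord_ge_numer[of j] by (simp add: lin_def a_def ord_ge_uminus)
    next
      case (Suc i')
      have "ord_ge (denom (Suc j)) (- (denom_deg (j - 1) + a))"
        using ord_ge_denom[of j] by (rule ord_ge_mono) (simp add: a_def)
      then show ?thesis by (cases i') (simp_all add: lin_def Suc)
    qed
    have prod_o: "ord_ge (coeff (lin (Suc i) * lin (Suc j)) t) (- (denom_deg (i - 1) + a) + - (denom_deg (j - 1) + a))" for i j t
      unfolding coeff_mult by (intro ord_ge_sum ord_ge_mult lin_o)
    obtain m' k' where mk: "m = Suc m'" "k = Suc k'" using m k by (cases m; cases k) auto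
    have oQ: "ord_ge (coeff Q t) (- h)" for t
    proof -
      have "ord_ge (coeff (lin m * lin (Suc k)) t) (- h)"
        unfolding mk using denom_deg_mono[of "m' - 1" m']
        by (intro ord_ge_mono[OF prod_o]) (simp add: h_def mk)
      moreover have "ord_ge (coeff (lin (Suc m) * lin k) t) (- h)"
        unfolding mk using denom_deg_mono[of "k' - 1" k']
        by (intro ord_ge_mono[OF prod_o]) (simp add: h_def mk)
      ultimately show ?thesis unfolding Q_def coeff_diff by (rule ord_ge_diff)
    qed
    have val: "poly Q \<alpha> = (cq k - cq m) * err (Suc m) * err (Suc k)"
      unfolding Q_def poly_diff poly_mult lin_val by (subst err_cq[of m], subst err_cq[of k]) (simp add: algebra_simps)
    have Q0: "Q \<noteq> 0"
    proof
      assume "Q = 0"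
      \<comment> \<open>At the root of \<open>lin (Suc m)\<close> only the first product of \<open>Q\<close> survives.\<close>
      define x where "x = numer (Suc m) / denom (Suc m)"
      have qm: "denom (Suc m) \<noteq> 0" "denom (Suc k) \<noteq> 0" using subdegree_denom mk by auto
      have "poly Q x = 0" using \<open>Q = 0\<close> by simp
      moreover have "poly (lin (Suc m)) x = 0" using qm by (simp add: lin_def x_def)
      ultimately have "poly (lin m) x * poly (lin (Suc k)) x = 0" by (simp add: Q_def)
      moreover have "poly (lin m) x \<noteq> 0"
      proof -
        have "poly (lin m) x * denom (Suc m) = - (numer m * denom (Suc m) - numer (Suc m) * denom m)"
          using qm by (simp add: lin_def x_def field_simps)
        then show ?thesis using determinant_nonzero[of m] by auto
      qed
      moreover have "poly (lin (Suc k)) x \<noteq> 0"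
      proof
        assume "poly (lin (Suc k)) x = 0"
        then have "denom (Suc k) * numer (Suc m) = numer (Suc k) * denom (Suc m)"
          using qm by (simp add: lin_def x_def field_simps add_eq_0_iff)
        then have "denom (Suc k) * err (Suc m) = denom (Suc m) * err (Suc k)"
          by (simp add: err_def algebra_simps)
        then have "fls_subdegree (denom (Suc k) * err (Suc m)) = fls_subdegree (denom (Suc m) * err (Suc k))"
          by simp
        then have "- denom_deg k' + denom_deg m = - denom_deg m' + denom_deg k"
          using qm subdegree_err[of m] subdegree_err[of k] subdegree_denom(2)[of k'] subdegree_denom(2)[of m']
          by (simp add: mk del: denom_simps denom_deg_simps)
        then have "denom_deg m + denom_deg m' = denom_deg k + denom_deg k'" by linarith
        moreover have "denom_deg m' \<le> denom_deg k'" using k mk by (intro denom_deg_mono) simp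
        moreover have "denom_deg m < denom_deg k" using denom_deg_mono[of m k'] k mk quot_deg_Suc_pos[of k'] by simp
        ultimately show False by linarith
      qed
      ultimately show False by simp
    qed
    have "fls_subdegree (poly Q \<alpha>) \<le> c1 * h + c2"
      by (rule L[OF Qn h0 dQ oQ low_degree_no_root[OF Qn Q0 dQ]])
    also have "\<dots> \<le> c1 * (denom_deg (m - 1) + denom_deg (k - 1)) + (c1 * (2 * a) + \<bar>c2\<bar>)"
      by (simp add: h_def distrib_left)
    finally have "fls_subdegree ((cq k - cq m) * err (Suc m) * err (Suc k)) \<le>
        c1 * (denom_deg (m - 1) + denom_deg (k - 1)) + (c1 * (2 * a) + \<bar>c2\<bar>)"
      unfolding val .
    moreover have "cq k \<noteq> cq m" using low_degree_no_root[OF Qn Q0 dQ] unfolding val by auto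
    ultimately show "cq k \<noteq> cq m \<and> fls_subdegree ((cq k - cq m) * err (Suc m) * err (Suc k)) \<le>
        c1 * (denom_deg (m - 1) + denom_deg (k - 1)) + (c1 * (2 * a) + \<bar>c2\<bar>)" by blast
  qed
qed

end

lemma power_le_fact_mult_exp:
  fixes y :: real
  assumes "y \<ge> 0"
  shows "y ^ m \<le> fact m * exp y"
proof -
  have "(\<Sum>k\<in>{m}. inverse (fact k) * y ^ k) \<le> (\<Sum>k. inverse (fact k) * y ^ k)"
    using summable_exp[of y] assms by (intro sum_le_suminf) auto
  then have "inverse (fact m) * y ^ m \<le> exp y"
    by (simp add: exp_def divide_inverse mult.commute)
  then show ?thesis by (simp add: field_simps)
qed

context infinite_continued_fraction
begin

lemma denom_deg_add: "denom_deg (p + q) = denom_deg p + (\<Sum>j<q. quot_deg (p + 1 + j))"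
  by (induction q) auto

end

context quasi_periodic_algebraic
begin

lemma l_ge_2: "l i \<ge> 2" and r_pos: "r i > 0" and n_pos: "n i > 0" and strict_mono_n: "strict_mono n"
  and repetition: "n i \<le> m \<Longrightarrow> m \<le> n i + (l i - 1) * r i - 1 \<Longrightarrow>
    partial_quotient \<alpha> (m + r i) = partial_quotient \<alpha> m"
  using qp unfolding quasi_periodic_cf_def by auto

text \<open>
  Let \<open>s\<close> be the degree of the denominator before the repetitions and \<open>R \<ge> 1\<close> the degree contributed by
  one period. The quadratic form of \<open>quadratic_form_bound\<close> for two positions one period apart has order at
  least \<open>2 s + (2 l - 1) R\<close>, and at most \<open>c1 (2 s + R) + c2\<close>.
\<close>

lemma repetition_count_bound: "\<exists>C\<ge>1. \<forall>i. int (l i) \<le> C * (1 + denom_deg (n i - 1))"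
proof -
  obtain c1 c2 where c: "c1 \<ge> 0" "c2 \<ge> 0" and bound: "\<And>m k. m > 0 \<Longrightarrow> k > m \<Longrightarrow> cq k \<noteq> cq m \<and>
    fls_subdegree ((cq k - cq m) * err (Suc m) * err (Suc k)) \<le> c1 * (denom_deg (m - 1) + denom_deg (k - 1)) + c2"
    using quadratic_form_bound by blast
  have "int (l i) \<le> (1 + 3 * c1 + c2) * (1 + denom_deg (n i - 1))" for i
  proof -
    define m where "m = n i - 1"
    define s where "s = denom_deg m"
    define p where "p = r i"
    define L where "L = (l i - 1) * p - 1"
    have n: "n i = Suc m" using n_pos[of i] by (simp add: m_def)
    have p: "p > 0" using r_pos by (simp add: p_def)
    have l: "l i - 1 > 0" using l_ge_2[of i] by simp
    have L: "L + 1 = (l i - 1) * p" using p l by (simp add: L_def)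
    have rep: "partial_quotient \<alpha> (Suc m + j + p) = partial_quotient \<alpha> (Suc m + j)" if "j \<le> L" for j
      using repetition[of i "Suc m + j"] that L by (simp add: n p_def)
    have dper: "quot_deg (Suc m + j + p) = quot_deg (Suc m + j)" if "j \<le> L" for j
      using rep[OF that] subdegree_quot[of "Suc m + j + p"] subdegree_quot[of "Suc m + j"] by (simp add: quot_def)
    define R where "R = (\<Sum>j<p. quot_deg (Suc m + j))"
    have R1: "R \<ge> 1"
    proof -
      have "(\<Sum>j<p. 1 :: int) \<le> R" unfolding R_def by (intro sum_mono quot_deg_pos) simp
      then show ?thesis using p by simp
    qed
    have block: "(\<Sum>j<p. quot_deg (Suc m + t * p + j)) = R" if "t < l i - 1" for t
      using that
    proof (induction t)
      case (Suc t)
      have "quot_deg (Suc m + Suc t * p + j) = quot_deg (Suc m + t * p + j)" if "j < p" for j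
      proof -
        have "Suc t * p \<le> (l i - 1) * p" using Suc.prems by (intro mult_right_mono) auto
        then have "t * p + j \<le> L" using that L by simp
        from dper[OF this] show ?thesis by (simp add: algebra_simps)
      qed
      then show ?case using Suc by simp
    qed (simp add: R_def)
    have Sblock: "denom_deg (m + t * p) = s + int t * R" if "t \<le> l i - 1" for t
      using that
    proof (induction t)
      case (Suc t)
      have "denom_deg (m + Suc t * p) = denom_deg ((m + t * p) + p)" by (simp add: algebra_simps)
      also have "\<dots> = denom_deg (m + t * p) + (\<Sum>j<p. quot_deg (Suc m + t * p + j))"
        unfolding denom_deg_add[of "m + t * p" p] by (simp add: add.commute add.left_commute)
      finally show ?case using Suc block[of t] by (simp add: algebra_simps)
    qed (simp add: s_def)
    have SL: "denom_deg (Suc m + L) = s + int (l i - 1) * R"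
    proof -
      have "Suc m + L = m + (l i - 1) * p" using L by simp
      then show ?thesis by (simp only: Sblock[OF order_refl])
    qed
    have Sp: "denom_deg (m + p) = s + R" using Sblock[of 1] l by simp
    have dp: "quot_deg (Suc m + p) = quot_deg (Suc m)" using dper[of 0] by simp
    have close: "ord_ge (cq (Suc m + p) - cq (Suc m)) (2 * (denom_deg (Suc m + L) - denom_deg (Suc m)))"
      using rep by (intro common_prefix_close) (simp add: ac_simps)
    have B: "cq (Suc m + p) \<noteq> cq (Suc m)"
        "fls_subdegree ((cq (Suc m + p) - cq (Suc m)) * err (Suc (Suc m)) * err (Suc (Suc m + p)))
          \<le> c1 * (s + (s + R)) + c2"
      using bound[of "Suc m" "Suc m + p"] p Sp by (simp_all add: s_def)
    have "2 * (denom_deg (Suc m + L) - denom_deg (Suc m)) + denom_deg (Suc m) + denom_deg (Suc m + p) \<le>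
        fls_subdegree ((cq (Suc m + p) - cq (Suc m)) * err (Suc (Suc m)) * err (Suc (Suc m + p)))"
      using close B(1) subdegree_err[of "Suc m"] subdegree_err[of "Suc m + p"]
      by (simp add: ord_ge_iff del: denom_deg_simps complete_quotient.simps)
    also note B(2)
    finally have "2 * s + (2 * int (l i - 1) + 1) * R \<le> c1 * (s + (s + R)) + c2"
      using SL Sp dp by (simp add: s_def[symmetric] algebra_simps)
    moreover have s0: "s \<ge> 0" using denom_deg_nonneg by (simp add: s_def)
    ultimately have "(2 * int (l i - 1) + 1 - c1) * R \<le> 2 * c1 * s + c2"
      by (simp add: algebra_simps)
    moreover have "z \<le> z * R \<or> z \<le> 0" for z
    proof (cases "z \<le> 0")
      case False
      then have "z * 1 \<le> z * R" using R1 by (intro mult_left_mono) auto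
      then show ?thesis by simp
    qed simp
    moreover have "2 * c1 * s + c2 \<ge> 0" using c s0 by simp
    ultimately have "2 * int (l i - 1) + 1 - c1 \<le> 2 * c1 * s + c2" by (meson order.trans)
    then have "2 * int (l i) \<le> 1 + c1 + c2 + 2 * c1 * s" using l by simp
    also have "\<dots> \<le> 2 * ((1 + 3 * c1 + c2) * (1 + s))"
    proof -
      have "0 \<le> c1 * s" "0 \<le> c2 * s" using c s0 by auto
      then show ?thesis using c s0 by (simp add: algebra_simps)
    qed
    finally show ?thesis by (simp add: s_def m_def)
  qed
  then show ?thesis using c by (intro exI[of _ "1 + 3 * c1 + c2"]) auto
qed

text \<open>
  The convergents turn Roth's inequality into \<open>u (k + 1) \<le> (1 + \<epsilon>) u k + A \<epsilon>\<^sup>-\<^sup>b\<close> for \<open>u = denom_deg\<close>, and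
  adding \<open>K = A \<epsilon>\<^sup>-\<^sup>b / \<epsilon>\<close> to \<open>u\<close> makes this a geometric recursion.
\<close>

lemma denominator_growth: "\<exists>A::real\<ge>0. \<exists>b::nat. \<forall>\<epsilon>::real. \<forall>k. 0 < \<epsilon> \<longrightarrow> \<epsilon> \<le> 1 \<longrightarrow>
  denom_deg k \<le> A * (1 / \<epsilon>) ^ b * exp (\<epsilon> * k)"
proof -
  obtain A b where A: "A \<ge> 0" and roth: "\<And>\<epsilon>::real. \<And>p q. 0 < \<epsilon> \<Longrightarrow> \<epsilon> \<le> 1 \<Longrightarrow>
      p \<in> nonpos_supp \<Longrightarrow> q \<in> nonpos_supp \<Longrightarrow> q \<noteq> 0 \<Longrightarrow> p - q * \<alpha> \<noteq> 0 \<Longrightarrow>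
      fls_subdegree (p - q * \<alpha>) \<le> (1 + \<epsilon>) * (- fls_subdegree q) + A * (1 / \<epsilon>) ^ b"
    using roth_algebraic[OF alg] by blast
  have "denom_deg k \<le> A * (1 / \<epsilon>) ^ Suc b * exp (\<epsilon> * k)" if \<epsilon>: "0 < \<epsilon>" "\<epsilon> \<le> 1" for \<epsilon> :: real and k
  proof -
    define K where "K = A * (1 / \<epsilon>) ^ Suc b"
    have K: "K \<ge> 0" using A \<epsilon> by (simp add: K_def)
    have step: "denom_deg (Suc k) \<le> (1 + \<epsilon>) * denom_deg k + \<epsilon> * K" for k
    proof -
      have eq: "numer (Suc (Suc k)) - denom (Suc (Suc k)) * \<alpha> = - err (Suc (Suc k))"
        by (simp only: err_def minus_diff_eq)
      have "fls_subdegree (numer (Suc (Suc k)) - denom (Suc (Suc k)) * \<alpha>) \<le>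
          (1 + \<epsilon>) * (- fls_subdegree (denom (Suc (Suc k)))) + A * (1 / \<epsilon>) ^ b"
        using subdegree_err[of "Suc k"]
        by (intro roth \<epsilon> numer_nonpos denom_nonpos subdegree_denom(1)) (simp only: eq neg_equal_0_iff_equal, simp)
      moreover have "\<epsilon> * K = A * (1 / \<epsilon>) ^ b" using \<epsilon> by (simp add: K_def)
      ultimately show ?thesis
        unfolding eq using subdegree_err[of "Suc k"] subdegree_denom(2)[of k]
        by (simp del: denom_simps denom_deg_simps)
    qed
    have "denom_deg k + K \<le> (1 + \<epsilon>) ^ k * K" for k
    proof (induction k)
      case (Suc k)
      have "denom_deg (Suc k) + K \<le> (1 + \<epsilon>) * (denom_deg k + K)" using step[of k] by (simp add: algebra_simps del: denom_deg_simps)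
      also have "\<dots> \<le> (1 + \<epsilon>) * ((1 + \<epsilon>) ^ k * K)" using Suc \<epsilon> by (intro mult_left_mono) auto
      finally show ?case by (simp add: mult.assoc)
    qed simp
    moreover have "(1 + \<epsilon>) ^ k \<le> exp (\<epsilon> * k)"
    proof -
      have "(1 + \<epsilon>) ^ k \<le> exp \<epsilon> ^ k" using \<epsilon> exp_ge_add_one_self[of \<epsilon>] by (intro power_mono) auto
      then show ?thesis by (simp add: exp_of_nat_mult[symmetric] mult.commute)
    qed
    then have "(1 + \<epsilon>) ^ k * K \<le> exp (\<epsilon> * k) * K" using K by (rule mult_right_mono)
    ultimately have "denom_deg k \<le> exp (\<epsilon> * k) * K" using K by (meson add_increasing2 order.trans le_add_same_cancel1)
    then show ?thesis by (simp add: K_def mult.commute)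
  qed
  with A show ?thesis by blast
qed

text \<open>
  The choice \<open>\<epsilon> = 1 / \<surd>(ln k)\<close> balances the two factors of \<open>denominator_growth\<close>: \<open>\<epsilon> k\<close> is the intended bound
  and a power of \<open>ln k\<close> is negligible against \<open>k\<close>.
\<close>

lemma log_denominator_growth:
  "\<exists>M::real\<ge>0. \<forall>k. k \<ge> 3 \<longrightarrow> ln (1 + real_of_int (denom_deg k)) * sqrt (ln k) \<le> M * k"
proof -
  obtain A b where A: "A \<ge> 0" and growth: "\<And>\<epsilon>::real. \<And>k. 0 < \<epsilon> \<Longrightarrow> \<epsilon> \<le> 1 \<Longrightarrow>
      denom_deg k \<le> A * (1 / \<epsilon>) ^ b * exp (\<epsilon> * k)"
    using denominator_growth by blast
  define M where "M = A * fact (Suc b) + 1"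
  have "ln (1 + real_of_int (denom_deg k)) * sqrt (ln k) \<le> M * k" if k: "k \<ge> 3" for k :: nat
  proof -
    define x where "x = sqrt (ln (real k))"
    have "exp 1 \<le> real k" using k exp_le by linarith
    then have ln1: "1 \<le> ln (real k)" using k by (subst ln_ge_iff) auto
    then have x1: "1 \<le> x" by (simp add: x_def)
    have xx: "x * x = ln (real k)" using ln1 by (simp add: x_def)
    have "denom_deg k \<le> A * x ^ b * exp (k / x)"
      using growth[of "1 / x" k] x1 by simp
    moreover have "1 \<le> exp (k / x)" using x1 by simp
    ultimately have "1 + real_of_int (denom_deg k) \<le> (1 + A * x ^ b) * exp (k / x)"
      unfolding distrib_right[of 1] mult_1_left by linarith
    moreover have "0 < 1 + real_of_int (denom_deg k)" using denom_deg_nonneg[of k] by linarith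
    ultimately have "ln (1 + real_of_int (denom_deg k)) \<le> ln ((1 + A * x ^ b) * exp (k / x))" by (intro ln_mono) auto
    also have "\<dots> = ln (1 + A * x ^ b) + k / x"
      using A x1 by (subst ln_mult_pos) (auto intro!: add_pos_nonneg)
    also have "ln (1 + A * x ^ b) \<le> A * x ^ b" using A x1 by (intro ln_add_one_self_le_self) auto
    finally have "ln (1 + real_of_int (denom_deg k)) * x \<le> (A * x ^ b + k / x) * x" using x1 by (intro mult_right_mono) auto
    also have "\<dots> = A * x ^ Suc b + k" using x1 by (simp add: field_simps)
    also have "\<dots> \<le> A * (fact (Suc b) * real k) + k"
    proof -
      have "x ^ Suc b \<le> ln k ^ Suc b"
        using x1 mult_left_mono[of 1 x x] by (intro power_mono) (auto simp: xx)
      also have "\<dots> \<le> fact (Suc b) * exp (ln k)" using ln1 by (intro power_le_fact_mult_exp) auto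
      also have "exp (ln k) = k" using k by simp
      finally have "x ^ Suc b \<le> fact (Suc b) * real k" .
      then have "A * x ^ Suc b \<le> A * (fact (Suc b) * real k)" using A by (rule mult_left_mono)
      then show ?thesis by (rule add_right_mono)
    qed
    finally show ?thesis by (simp add: M_def x_def algebra_simps)
  qed
  then show ?thesis using A by (intro exI[of _ M]) (auto simp: M_def)
qed

lemma n_ge: "i \<le> n i"
  using strict_mono_n by (rule strict_mono_imp_increasing)

lemma log_repetition_count_bounded:
  fixes \<mu> :: real
  assumes \<mu>: "\<mu> > 1"
  shows "limsup (\<lambda>i. ereal (log \<mu> (real (l i)) * sqrt (log \<mu> (real (n i))) / real (n i))) \<noteq> \<infinity>"
proof -
  obtain C where C: "C \<ge> 1" "\<And>i. int (l i) \<le> C * (1 + denom_deg (n i - 1))"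
    using repetition_count_bound by blast
  obtain M where M: "M \<ge> 0" "\<And>k. k \<ge> 3 \<Longrightarrow> ln (1 + real_of_int (denom_deg k)) * sqrt (ln k) \<le> M * k"
    using log_denominator_growth by blast
  define B where "B = (ln C + M) / (ln \<mu> * sqrt (ln \<mu>))"
  have ln\<mu>: "ln \<mu> > 0" using \<mu> by simp
  have "log \<mu> (real (l i)) * sqrt (log \<mu> (real (n i))) / real (n i) \<le> B" if i: "i \<ge> 3" for i
  proof -
    define k where "k = n i"
    have k: "k \<ge> 3" using n_ge[of i] i by (simp add: k_def)
    have lC: "int (l i) \<le> C * (1 + denom_deg k)"
    proof -
      have "C * (1 + denom_deg (k - 1)) \<le> C * (1 + denom_deg k)"
        using C(1) denom_deg_mono[of "k - 1" k] by (intro mult_left_mono) auto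
      then show ?thesis using C(2)[of i] by (simp add: k_def)
    qed
    have "real (l i) = real_of_int (int (l i))" by simp
    also have "\<dots> \<le> real_of_int (C * (1 + denom_deg k))" using lC by (simp only: of_int_le_iff)
    finally have "real (l i) \<le> real_of_int C * (1 + real_of_int (denom_deg k))" by simp
    then have "ln (l i) \<le> ln (real_of_int C * (1 + real_of_int (denom_deg k)))"
      using l_ge_2[of i] by (intro ln_mono) auto
    also have "\<dots> = ln C + ln (1 + real_of_int (denom_deg k))"
      using C(1) denom_deg_nonneg[of k] by (intro ln_mult_pos) auto
    finally have "ln (l i) * sqrt (ln k) \<le> (ln C + ln (1 + real_of_int (denom_deg k))) * sqrt (ln k)"
      using k by (intro mult_right_mono) auto
    also have "\<dots> = ln C * sqrt (ln k) + ln (1 + real_of_int (denom_deg k)) * sqrt (ln k)" by (rule distrib_right)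
    also have "\<dots> \<le> ln C * k + M * k"
    proof (intro add_mono mult_left_mono M(2) k)
      have "ln (real k) \<le> real k * real k"
      proof -
        have "ln (real k) \<le> real k - 1" using k by (intro ln_le_minus_one) auto
        moreover have "real k * 1 \<le> real k * real k" using k by (intro mult_left_mono) auto
        ultimately show ?thesis by linarith
      qed
      then show "sqrt (ln k) \<le> k" by (intro real_le_lsqrt) (simp_all add: power2_eq_square)
      show "0 \<le> ln (real_of_int C)" using C(1) by simp
    qed
    finally have "ln (l i) * sqrt (ln k) \<le> (ln C + M) * k" by (simp add: distrib_right)
    then have "ln (l i) * sqrt (ln k) / k / (ln \<mu> * sqrt (ln \<mu>)) \<le> B"
      unfolding B_def using k ln\<mu> by (intro divide_right_mono) (auto simp: divide_le_eq)
    moreover have "log \<mu> (l i) * sqrt (log \<mu> k) / k = ln (l i) * sqrt (ln k) / k / (ln \<mu> * sqrt (ln \<mu>))"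
      by (simp add: log_def real_sqrt_divide)
    ultimately show ?thesis by (simp add: k_def)
  qed
  then have "eventually (\<lambda>i. ereal (log \<mu> (real (l i)) * sqrt (log \<mu> (real (n i))) / real (n i)) \<le> ereal B)
      sequentially"
    by (auto simp: eventually_sequentially)
  then have "limsup (\<lambda>i. ereal (log \<mu> (real (l i)) * sqrt (log \<mu> (real (n i))) / real (n i))) \<le> ereal B"
    by (rule Limsup_bounded)
  then show ?thesis by auto
qed

text \<open>
  Bounded roots of \<open>\<bar>q\<^sub>k\<bar>\<close> mean that the degree of \<open>q\<^sub>k\<close> is at most linear in \<open>k\<close>.
\<close>

lemma repetition_count_linear:
  fixes \<mu> B :: real
  assumes \<mu>: "\<mu> > 1"
    and B: "\<forall>i\<ge>1. abs_T \<mu> (poly_in_T (convergent_denom \<alpha> i)) powr (1 / real i) \<le> B"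
  shows "limsup (\<lambda>i. ereal (real (l i) / real (n i))) \<noteq> \<infinity>"
proof -
  obtain C where C: "C \<ge> 1" "\<And>i. int (l i) \<le> C * (1 + denom_deg (n i - 1))"
    using repetition_count_bound by blast
  define B' where "B' = max B 1"
  have denom_le: "denom_deg k \<le> k * log \<mu> B'" if k: "k \<ge> 1" for k
  proof -
    have "poly_in_T (convergent_denom \<alpha> k) = denom (Suc (Suc k))"
      by (simp add: convergent_denom_def denom_def)
    then have "abs_T \<mu> (poly_in_T (convergent_denom \<alpha> k)) = \<mu> powr denom_deg k"
      using subdegree_denom[of k] \<mu> by (simp add: abs_T_def powr_real_of_int' del: denom_simps)
    then have "(\<mu> powr denom_deg k) powr (1 / k) \<le> B'" using B k by (force simp: B'_def)
    then have "\<mu> powr (denom_deg k / k) \<le> B'" by (simp add: powr_powr)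
    then have "denom_deg k / k \<le> log \<mu> B'" using \<mu> by (subst le_log_iff) (auto simp: B'_def)
    then show ?thesis using k by (simp add: divide_le_eq mult.commute)
  qed
  define D where "D = C * (1 + log \<mu> B')"
  have "real (l i) / real (n i) \<le> D" for i
  proof -
    define k where "k = n i"
    have k: "k \<ge> 1" using n_pos[of i] by (simp add: k_def)
    have "real (l i) \<le> real_of_int (C * (1 + denom_deg (k - 1)))"
      using C(2)[of i] by (metis k_def of_int_le_iff of_int_of_nat_eq)
    also have "\<dots> \<le> real_of_int (C * (1 + denom_deg k))"
      using C(1) denom_deg_mono[of "k - 1" k] unfolding of_int_le_iff by (intro mult_left_mono) auto
    also have "\<dots> = C * (1 + real_of_int (denom_deg k))" by simp
    also have "\<dots> \<le> C * (k + k * log \<mu> B')"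
      using C(1) denom_le[OF k] k by (intro mult_left_mono add_mono) auto
    also have "\<dots> = D * k" by (simp add: D_def algebra_simps)
    finally show ?thesis using k by (simp add: divide_le_eq k_def)
  qed
  then have "limsup (\<lambda>i. ereal (real (l i) / real (n i))) \<le> ereal D"
    by (intro Limsup_bounded always_eventually) auto
  then show ?thesis by auto
qed

end

theorem theorem4:
  fixes \<mu> :: real
    and \<alpha> :: "'a::field_char_0 fls"
    and l r n :: "nat \<Rightarrow> nat"
  assumes "\<mu> > 1"
    and "quasi_periodic_cf \<alpha> l r n"
  shows
    "((\<exists>C::real. C > 0 \<and> (\<forall>i. real (r i) < C * real (n i))) \<and>
      limsup (\<lambda>i. ereal (log \<mu> (real (l i)) * sqrt (log \<mu> (real (n i))) / real (n i))) = \<infinity>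
      \<longrightarrow> transcendental_over_subfield ratfun_field \<alpha> \<or> quadratic_over_subfield ratfun_field \<alpha>)
   \<and> ((\<exists>B::real. \<forall>i\<ge>1. abs_T \<mu> (poly_in_T (convergent_denom \<alpha> i)) powr (1 / real i) \<le> B) \<and>
      limsup (\<lambda>i. ereal (real (l i) / real (n i))) = \<infinity>
      \<longrightarrow> transcendental_over_subfield ratfun_field \<alpha> \<or> quadratic_over_subfield ratfun_field \<alpha>)"
proof (cases "transcendental_over_subfield ratfun_field \<alpha> \<or> quadratic_over_subfield ratfun_field \<alpha>")
  case False
  then interpret quasi_periodic_algebraic \<alpha> l r n
    using assms(2)
    by unfold_locales (auto simp: transcendental_over_subfield_def quadratic_over_subfield_def)
  show ?thesis
    using log_repetition_count_bounded[OF assms(1)] repetition_count_linear[OF assms(1)] by blast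
qed blast

end
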